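(* Let $\ell\ge 2$ be an integer and let $\mathcal{W}^*$ be any set of kernels containing all kernels with range $\{0,1\}$. Let $\mathcal{D}^*_{\le\ell}\subseteq\mathbb{R}^{2\ell-2}$ be the closure of the set of points $\big(x_2(W),y_2(W),x_3(W),y_3(W),\dots,x_\ell(W),y_\ell(W)\big)$ over all $W\in\mathcal{W}^*$ with $t(N_{4,q},W)\ne 0$ for every $2\le q\le\ell$, and let $T$ be the convex hull of $\mathcal{D}^*_{\le\ell}$. Then $T=\mathcal{R}^{\ell-1}$.
   Context: A kernel is a bounded, symmetric, measurable function $W:[0,1]^2\to\mathbb{R}$. For a finite simple graph $H$ and a kernel $W$, $t(H,W)=\int_{[0,1]^{|V(H)|}}\prod_{\{i,j\}\in E(H)}W(x_i,x_j)\,\prod_i dx_i$. For an integer $q\ge 2$, the $q$-ification of a graph $G$ is obtained by adding, for every edge $uv$ of $G$, $q-2$ new vertices that are pairwise adjacent and all adjacent to $u$ and $v$ (so every edge becomes a $q$-clique). For $c\ge 3$, $q\ge2$, the necklace $N_{c,q}$ is the $q$-ification of the cycle $C_c$. For a kernel $W$ with $t(N_{4,q},W)\neq0$, set $x_q(W)=t(N_{8,q},W)/t(N_{4,q},W)^2$ and $y_q(W)=t(N_{12,q},W)/t(N_{4,q},W)^3$. $\mathcal{R}\subseteq\mathbb{R}^2$ is the convex hull of $(0,0)$ together with the points $(1/n,1/n^2)$ for all positive integers $n$; $\mathcal{R}^{\ell-1}\subseteq\mathbb{R}^{2\ell-2}$ is its $(\ell-1)$-fold Cartesian product, with coordinates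 ordered as $(x_2,y_2,\dots,x_\ell,y_\ell)$. *)

theory Defs
  imports "HOL-Analysis.Analysis"
begin

text \<open>A graph is a pair of a vertex set and a set of edges, each edge being a two-element
  set of vertices.\<close>

type_synonym 'a graph = "'a set \<times> 'a set set"

definition finite_simple_graph :: "'a graph \<Rightarrow> bool" where
  "finite_simple_graph H \<longleftrightarrow>
     finite (fst H) \<and> (\<forall>e\<in>snd H. e \<subseteq> fst H \<and> card e = 2)"

definition cycle_graph :: "nat \<Rightarrow> nat graph" where
  "cycle_graph c = ({..<c}, {{i, (i + 1) mod c} | i. i < c})"

text \<open>In the \<open>q\<close>-ification the vertices \<open>Inr (e, k)\<close> with \<open>k < q - 2\<close> are the new vertices
  belonging to the edge \<open>e\<close>.\<close>

definition qification :: "nat \<Rightarrow> 'a graph \<Rightarrow> ('a + 'a set \<times> nat) graph" where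
  "qification q G =
    (Inl ` fst G \<union> {Inr (e, k) | e k. e \<in> snd G \<and> k < q - 2},
     {Inl ` e | e. e \<in> snd G}
     \<union> {{Inr (e, k), Inr (e, m)} | e k m. e \<in> snd G \<and> k < q - 2 \<and> m < q - 2 \<and> k \<noteq> m}
     \<union> {{Inr (e, k), Inl u} | e k u. e \<in> snd G \<and> k < q - 2 \<and> u \<in> e})"

definition necklace :: "nat \<Rightarrow> nat \<Rightarrow> (nat + nat set \<times> nat) graph" where
  "necklace c q = qification q (cycle_graph c)"

lemma finite_simple_graph_cycle: "c \<ge> 3 \<Longrightarrow> finite_simple_graph (cycle_graph c)"
  unfolding finite_simple_graph_def cycle_graph_def
  apply (auto simp: card_2_iff)
  subgoal for i apply (rule exI[of _ i], rule exI[of _ "Suc i mod c"]) by (cases "Suc i = c") auto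
  done

lemma finite_simple_graph_qification: "finite_simple_graph G \<Longrightarrow> finite_simple_graph (qification q G)"
proof -
  assume a: "finite_simple_graph G"
  have "finite (snd G)" using a unfolding finite_simple_graph_def by (meson finite_Pow_iff PowI finite_subset subsetI)
  then have "finite (snd G \<times> {..<q-2})" by simp
  then have "finite ((Inr :: _ \<Rightarrow> 'a + _) ` (snd G \<times> {..<q-2}))" by (rule finite_imageI)
  moreover have "{Inr (e, k) | e k. e \<in> snd G \<and> k < q - 2} = (Inr :: _ \<Rightarrow> 'a + _) ` (snd G \<times> {..<q-2})" by auto
  ultimately have "finite (fst (qification q G))" using a by (simp add: finite_simple_graph_def qification_def)
  moreover have "e \<subseteq> fst (qification q G) \<and> card e = 2" if eq: "e \<in> snd (qification q G)" for e
  proof -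
    consider f where "f \<in> snd G" "e = Inl ` f"
      | f k m where "f \<in> snd G" "k < q - 2" "m < q - 2" "k \<noteq> m" "e = {Inr (f, k), Inr (f, m)}"
      | f k u where "f \<in> snd G" "k < q - 2" "u \<in> f" "e = {Inr (f, k), Inl u}"
      using eq unfolding qification_def snd_conv by blast
    then show ?thesis
    proof cases
      case 1
      with a have "f \<subseteq> fst G" "card f = 2" by (auto simp: finite_simple_graph_def)
      with 1 show ?thesis by (auto simp: qification_def card_image)
    next
      case 2
      then show ?thesis by (auto simp: qification_def)
    next
      case 3
      with a have "u \<in> fst G" by (auto simp: finite_simple_graph_def)
      with 3 show ?thesis by (auto simp: qification_def)
    qed
  qed
  ultimately show ?thesis by (simp add: finite_simple_graph_def)
qed

lemma finite_simple_graph_necklace: "c \<ge> 3 \<Longrightarrow> finite_simple_graph (necklace c q)"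
  unfolding necklace_def
  by (intro finite_simple_graph_qification finite_simple_graph_cycle)

text \<open>Measurable means Lebesgue measurable. Requiring \<open>W\<close> to be extensional makes kernels
  correspond exactly to functions whose domain is the unit square.\<close>

definition graph_kernel :: "(real \<times> real \<Rightarrow> real) \<Rightarrow> bool" where
  "graph_kernel W \<longleftrightarrow>
     W \<in> extensional ({0..1} \<times> {0..1}) \<and>
     bounded (W ` ({0..1} \<times> {0..1})) \<and>
     (\<forall>x\<in>{0..1}. \<forall>y\<in>{0..1}. W (x, y) = W (y, x)) \<and>
     W \<in> borel_measurable (lebesgue_on ({0..1} \<times> {0..1}))"

text \<open>The value \<open>W(x\<^sub>i, x\<^sub>j)\<close> of an unordered edge \<open>e = {i, j}\<close>; the symmetry of a kernel
  makes it independent of the order of the endpoints.\<close>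

definition edge_value :: "(real \<times> real \<Rightarrow> real) \<Rightarrow> ('a \<Rightarrow> real) \<Rightarrow> 'a set \<Rightarrow> real" where
  "edge_value W x e = (THE r. \<exists>i j. e = {i, j} \<and> r = W (x i, x j))"

lemma edge_value_eq:
  assumes "graph_kernel W"
  shows "edge_value W x {i, j} = W (x i, x j)"
proof -
  have W_sym: "W (a, b) = W (b, a)" for a b
  proof (cases "a \<in> {0..1} \<and> b \<in> {0..1}")
    case True
    then show ?thesis using assms by (simp add: graph_kernel_def)
  next
    case False
    then have "(a, b) \<notin> {0..1} \<times> {0..1}" "(b, a) \<notin> {0..1} \<times> {0..1}" by auto
    moreover have "W \<in> extensional ({0..1} \<times> {0..1})" using assms by (simp add: graph_kernel_def)
    ultimately have "W (a, b) = undefined" "W (b, a) = undefined"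
      by (blast intro: extensional_arb)+
    then show ?thesis by (rule trans[OF _ sym])
  qed
  show ?thesis
    unfolding edge_value_def
    by (rule the_equality) (use W_sym in \<open>auto simp: doubleton_eq_iff\<close>)
qed

text \<open>The completed product measure is Lebesgue measure on \<open>[0,1]\<^sup>V\<close>. Completion is needed:
  for a Lebesgue measurable \<open>W\<close> the integrand need not be measurable for the product
  sigma-algebra, and the integral would then be \<open>0\<close> by convention.\<close>

definition hom_density :: "'a graph \<Rightarrow> (real \<times> real \<Rightarrow> real) \<Rightarrow> real" where
  "hom_density H W =
    (\<integral>x. (\<Prod>e\<in>snd H. edge_value W x e)
       \<partial>completion (\<Pi>\<^sub>M v\<in>fst H. restrict_space lborel {0..1}))"

definition necklace_x :: "nat \<Rightarrow> (real \<times> real \<Rightarrow> real) \<Rightarrow> real" where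
  "necklace_x q W = hom_density (necklace 8 q) W / hom_density (necklace 4 q) W ^ 2"

definition necklace_y :: "nat \<Rightarrow> (real \<times> real \<Rightarrow> real) \<Rightarrow> real" where
  "necklace_y q W = hom_density (necklace 12 q) W / hom_density (necklace 4 q) W ^ 3"

definition R_region :: "(real \<times> real) set" where
  "R_region = convex hull (insert (0, 0) {(1 / real n, 1 / (real n)^2) | n. n \<ge> 1})"

text \<open>For \<open>CARD('n) = 2 * l - 2\<close>, an enumeration \<open>ix\<close> of \<open>'n\<close> by \<open>{1..2 * l - 2}\<close> fixes the
  order of the coordinates of \<open>real ^ 'n\<close>: in \<open>(x\<^sub>2, y\<^sub>2, \<dots>, x\<^sub>l, y\<^sub>l)\<close> the entry \<open>x\<^sub>q\<close> is at
  position \<open>2 * q - 3\<close> and \<open>y\<^sub>q\<close> at position \<open>2 * q - 2\<close>.\<close>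

definition D_region ::
    "(nat \<Rightarrow> 'n::finite) \<Rightarrow> nat \<Rightarrow> (real \<times> real \<Rightarrow> real) set \<Rightarrow> (real ^ 'n) set" where
  "D_region ix l \<W> = closure {p. \<exists>W\<in>\<W>.
     (\<forall>q\<in>{2..l}. hom_density (necklace 4 q) W \<noteq> 0) \<and>
     (\<forall>q\<in>{2..l}. p $ ix (2 * q - 3) = necklace_x q W \<and> p $ ix (2 * q - 2) = necklace_y q W)}"

definition R_power :: "(nat \<Rightarrow> 'n::finite) \<Rightarrow> nat \<Rightarrow> (real ^ 'n) set" where
  "R_power ix l = {p. \<forall>q\<in>{2..l}. (p $ ix (2 * q - 3), p $ ix (2 * q - 2)) \<in> R_region}"

end

theory Submission
  imports Defs "HOL-Probability.Infinite_Product_Measure" "Jordan_Normal_Form.Schur_Decomposition"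
begin

text \<open>Gluing a \<open>q\<close>-clique on every edge turns \<open>t(N\<^bsub>c,q\<^esub>, W)\<close> into the trace of the \<open>c\<close>-th power of a
  symmetric operator. With \<open>\<mu>\<^sub>i\<close> the fourth powers of its eigenvalues, normalized to sum \<open>1\<close>, the point
  \<open>(x\<^sub>q, y\<^sub>q)\<close> is \<open>(\<Sum>\<mu>\<^sub>i\<^sup>2, \<Sum>\<mu>\<^sub>i\<^sup>3)\<close>, and every linear functional of these two power sums is minimized on
  the simplex at a uniform vector \<open>(1/n, \<dots>, 1/n)\<close>; so the point lies in \<open>\<R>\<close>. Only finite matrices need
  to be diagonalized, because a kernel is the limit, in all necklace densities, of matrices
  \<open>W(x\<^sub>a, x\<^sub>b)\<close> at suitable sample points.

  Conversely, take \<open>n\<^sub>r\<close> disjoint quasirandom blocks of size \<open>\<epsilon>\<^bsup>r\<^sup>2\<^esup>\<close> and density \<open>\<epsilon>\<^bsup>4(l - r)\<^esup>\<close> for each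
  \<open>r\<close>. As \<open>\<epsilon> \<rightarrow> 0\<close> the \<open>q\<close>-clique operator is dominated, for all \<open>q\<close> simultaneously, by \<open>n\<^sub>q\<close> equal
  eigenvalues coming from the blocks with \<open>r = q\<close>, which gives the vertices of the product.
  Rounding the weights randomly to \<open>0\<close> or \<open>1\<close> changes the densities arbitrarily little.\<close>

section \<open>Power sums on the simplex\<close>

text \<open>The lengths 4, 8 and 12 are multiples of four so that, the eigenvalues being real, the
  numbers entering the power sums are nonnegative and the density for 4 is their total.

  The exponents of the blocks come from tangent lines. Up to a common factor, a block of relative
  size \<epsilon>^a and density \<epsilon>^b has the \<open>q\<close>-clique eigenvalue
  \<epsilon>^((q - 1) (a + b q / 2)), and a + b q / 2 is linear in q. A different family of blocks
  must win for each q; the tangents of the concave parabola q (2 l - q) do this, the tangent at q =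
  r being a = r^2, b = 4 (l - r), with excess (q - r)^2. As r \<le> l, the densities stay at most 1.

  The order of limits matters: rounding is done for fixed \<epsilon>, with the number of vertices
  growing, and only then \<epsilon> tends to 0. The vertex (0, 0) belongs to no uniform vector and
  is reached only for growing multiplicity. Closedness of the set of points absorbs all three
  limits.\<close>

lemma compact_standard_simplex: "compact {\<mu>::nat \<Rightarrow> real. (\<forall>i. 0 \<le> \<mu> i) \<and> (\<forall>i\<ge>N. \<mu> i = 0) \<and> (\<Sum>i<N. \<mu> i) = 1}"
  (is "compact ?K")
proof -
  let ?B = "Pi\<^sub>E UNIV (\<lambda>i. if i < N then {0..1} else {0::real})"
  \<comment> \<open>Tychonoff in the space of all real sequences: pinning the coordinates from
    \<open>N\<close> on to \<open>{0}\<close> represents the simplex without a type depending on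
    \<open>N\<close>.\<close>
  have "compactin (product_topology (\<lambda>i. euclidean) UNIV) ?B"
    unfolding compactin_PiE by auto
  then have "compact ?B"
    by (simp add: euclidean_product_topology)
  moreover have "closed {\<mu>::nat \<Rightarrow> real. (\<Sum>i<N. \<mu> i) = 1}"
    by (intro closed_Collect_eq continuous_intros)
      (auto intro!: continuous_on_subset[OF continuous_on_product_coordinates])
  moreover have "?K = ?B \<inter> {\<mu>. (\<Sum>i<N. \<mu> i) = 1}"
  proof (intro equalityI subsetI)
    fix \<mu> assume m: "\<mu> \<in> ?K"
    have "\<mu> i \<le> 1" if "i < N" for i
      using member_le_sum[of i "{..<N}" \<mu>] m that by auto
    with m show "\<mu> \<in> ?B \<inter> {\<mu>. (\<Sum>i<N. \<mu> i) = 1}" by auto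
  next
    fix \<mu> assume m: "\<mu> \<in> ?B \<inter> {\<mu>. (\<Sum>i<N. \<mu> i) = 1}"
    then have a: "\<mu> i \<in> (if i < N then {0..1} else {0})" for i by (auto simp: PiE_iff)
    have "0 \<le> \<mu> i" for i using a[of i] by (auto split: if_splits)
    moreover have "\<mu> i = 0" if "i \<ge> N" for i using a[of i] that by auto
    ultimately show "\<mu> \<in> ?K" using m by auto
  qed
  ultimately show ?thesis by (simp add: compact_Int_closed)
qed

lemma sum_update_two:
  fixes g :: "'b \<Rightarrow> real"
  assumes "finite A" "i \<in> A" "j \<in> A" "i \<noteq> j"
  shows "(\<Sum>k\<in>A. g ((f(i := u, j := v)) k)) = (\<Sum>k\<in>A. g (f k)) - g (f i) - g (f j) + g u + g v"
proof -
  have "sum h A = h i + h j + sum h (A - {i, j})" for h :: "_ \<Rightarrow> real"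
  proof -
    have "sum h A = sum h {i, j} + sum h (A - {i, j})"
      using assms by (intro sum.subset_diff[THEN trans[OF _ add.commute]]) auto
    with assms show ?thesis by simp
  qed
  note s = this
  have "(\<Sum>k\<in>A - {i, j}. g ((f(i := u, j := v)) k)) = (\<Sum>k\<in>A - {i, j}. g (f k))"
    by (intro sum.cong) auto
  then show ?thesis
    unfolding s[of "\<lambda>k. g ((f(i := u, j := v)) k)"] s[of "\<lambda>k. g (f k)"] using assms by simp
qed

text \<open>Among the minimizers of \<open>a p\<^sub>2 + b p\<^sub>3\<close> on the simplex choose one of least support. For two
  coordinates with fixed sum \<open>s\<close> the functional is affine in their product, with slope
  \<open>- (2 a + 3 b s)\<close>; so either merging two unequal coordinates or averaging them would contradict
  the choice.\<close>

lemma simplex_functional_ge_uniform: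
  fixes \<mu> :: "nat \<Rightarrow> real"
  assumes "\<And>i. i < N \<Longrightarrow> 0 \<le> \<mu> i" "(\<Sum>i<N. \<mu> i) = 1"
  shows "\<exists>k\<ge>1. a * (1 / real k) + b * (1 / (real k)\<^sup>2) \<le> a * (\<Sum>i<N. (\<mu> i)\<^sup>2) + b * (\<Sum>i<N. \<mu> i ^ 3)"
proof -
  define K where "K = {\<mu>::nat \<Rightarrow> real. (\<forall>i. 0 \<le> \<mu> i) \<and> (\<forall>i\<ge>N. \<mu> i = 0) \<and> (\<Sum>i<N. \<mu> i) = 1}"
  define P where "P \<mu> = (\<Sum>i<N. a * (\<mu> i)\<^sup>2 + b * \<mu> i ^ 3)" for \<mu> :: "nat \<Rightarrow> real"
  define S where "S \<mu> = {i. i < N \<and> \<mu> i \<noteq> 0}" for \<mu> :: "nat \<Rightarrow> real"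
  define \<mu>' where "\<mu>' i = (if i < N then \<mu> i else 0)" for i
  have \<mu>': "\<mu>' \<in> K" "P \<mu>' = P \<mu>" using assms by (auto simp: K_def \<mu>'_def P_def)
  have "compact K" unfolding K_def by (rule compact_standard_simplex)
  moreover have "continuous_on K P"
    unfolding P_def
    by (intro continuous_intros) (auto intro!: continuous_on_subset[OF continuous_on_product_coordinates])
  ultimately obtain m where m: "m \<in> K" "\<And>\<nu>. \<nu> \<in> K \<Longrightarrow> P m \<le> P \<nu>"
    using continuous_attains_inf[of K P] \<mu>'(1) by blast
  obtain \<nu> where \<nu>: "\<nu> \<in> K" "P \<nu> = P m"
    and least: "\<And>\<xi>. \<xi> \<in> K \<Longrightarrow> P \<xi> = P m \<Longrightarrow> card (S \<nu>) \<le> card (S \<xi>)"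
    using ex_has_least_nat[of "\<lambda>\<xi>. \<xi> \<in> K \<and> P \<xi> = P m" m "\<lambda>\<xi>. card (S \<xi>)"] m(1) by blast
  have fin: "finite (S \<xi>)" for \<xi> unfolding S_def by auto
  have eq: "\<nu> i = \<nu> j" if ij: "i \<in> S \<nu>" "j \<in> S \<nu>" for i j
  proof (rule ccontr)
    assume neq: "\<nu> i \<noteq> \<nu> j"
    then have "i \<noteq> j" by auto
    have lt: "i < N" "j < N" using ij by (auto simp: S_def)
    have pos: "\<nu> i > 0" "\<nu> j > 0" using ij \<nu>(1) by (auto simp: S_def K_def less_le)
    note upd = sum_update_two[OF finite_lessThan lt[THEN lessThan_iff[THEN iffD2]] \<open>i \<noteq> j\<close>]
    have inK: "\<nu>(i := u, j := v) \<in> K" if "u \<ge> 0" "v \<ge> 0" "u + v = \<nu> i + \<nu> j" for u v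
      using that \<nu>(1) lt upd[where g = "\<lambda>x. x" and f = \<nu> and u = u and v = v] unfolding K_def by auto
    have Pd: "P (\<nu>(i := u, j := v)) - P \<nu> = (\<nu> i * \<nu> j - u * v) * (2 * a + 3 * b * (\<nu> i + \<nu> j))"
      if "u + v = \<nu> i + \<nu> j" for u v
    proof -
      have v: "v = \<nu> i + \<nu> j - u" using that by simp
      show ?thesis
        using upd[where g = "\<lambda>x. a * x\<^sup>2 + b * x ^ 3" and f = \<nu> and u = u and v = v]
        unfolding P_def v by (simp add: algebra_simps power2_eq_square power3_eq_cube)
    qed
    let ?m = "\<nu>(i := \<nu> i + \<nu> j, j := 0)"
    have mK: "?m \<in> K" using inK[of "\<nu> i + \<nu> j" 0] pos by auto
    have "S ?m \<subseteq> S \<nu> - {j}"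
    proof
      fix k assume "k \<in> S ?m"
      then have "k < N" "?m k \<noteq> 0" by (auto simp: S_def)
      then show "k \<in> S \<nu> - {j}" using pos by (cases "k = j"; cases "k = i") (auto simp: S_def)
    qed
    then have "S ?m \<subset> S \<nu>" using ij(2) by blast
    then have "card (S ?m) < card (S \<nu>)" by (rule psubset_card_mono[OF fin])
    then have "P ?m \<noteq> P m" using least[OF mK] by auto
    \<comment> \<open>Strictness comes from the least support, since merging removes
      \<open>j\<close> from it. With a positive slope, averaging, which raises the product of the
      two coordinates, then lowers \<open>P\<close> below its minimum.\<close>
    then have "P ?m - P \<nu> > 0" using m(2)[OF mK] \<nu>(2) by auto
    also have "P ?m - P \<nu> = (\<nu> i * \<nu> j) * (2 * a + 3 * b * (\<nu> i + \<nu> j))"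
      by (subst Pd) simp_all
    finally have slope: "2 * a + 3 * b * (\<nu> i + \<nu> j) > 0"
      by (rule zero_less_mult_pos) (use pos in simp)
    let ?h = "(\<nu> i + \<nu> j) / 2"
    have "\<nu> i * \<nu> j - ?h * ?h = - ((\<nu> i - \<nu> j)\<^sup>2 / 4)"
      by (simp add: field_simps power2_eq_square)
    also have "\<dots> < 0" using neq by simp
    finally have "P (\<nu>(i := ?h, j := ?h)) - P \<nu> < 0"
      unfolding Pd[of ?h ?h, OF field_sum_of_halves] using slope by (rule mult_neg_pos)
    moreover have "P m \<le> P (\<nu>(i := ?h, j := ?h))"
      by (rule m(2), rule inK) (use pos in auto)
    ultimately show False using \<nu>(2) by simp
  qed
  define k where "k = card (S \<nu>)"
  have sumS: "(\<Sum>i<N. g (\<nu> i)) = (\<Sum>i\<in>S \<nu>. g (\<nu> i))" if "g 0 = 0" for g :: "real \<Rightarrow> real"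
    using that by (intro sum.mono_neutral_right) (auto simp: S_def)
  have "(\<Sum>i\<in>S \<nu>. \<nu> i) = 1" using sumS[of "\<lambda>x. x"] \<nu>(1) by (auto simp: K_def)
  then have "S \<nu> \<noteq> {}" by auto
  then obtain i0 where i0: "i0 \<in> S \<nu>" by blast
  have c: "(\<Sum>i\<in>S \<nu>. g (\<nu> i)) = real k * g (\<nu> i0)" for g :: "real \<Rightarrow> real"
  proof -
    have "(\<Sum>i\<in>S \<nu>. g (\<nu> i)) = (\<Sum>i\<in>S \<nu>. g (\<nu> i0))" by (intro sum.cong refl arg_cong[where f = g] eq i0)
    then show ?thesis by (simp add: k_def)
  qed
  have k1: "k \<ge> 1" unfolding k_def using \<open>S \<nu> \<noteq> {}\<close> fin by (simp add: Suc_le_eq card_gt_0_iff)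
  have "real k * \<nu> i0 = 1" using c[of "\<lambda>x. x"] \<open>(\<Sum>i\<in>S \<nu>. \<nu> i) = 1\<close> by simp
  then have v: "\<nu> i0 = 1 / real k" using k1 by (simp add: field_simps)
  have "P \<nu> = (\<Sum>i\<in>S \<nu>. a * (\<nu> i)\<^sup>2 + b * \<nu> i ^ 3)"
    unfolding P_def by (rule sumS[of "\<lambda>x. a * x\<^sup>2 + b * x ^ 3"]) simp
  also have "\<dots> = real k * (a * (\<nu> i0)\<^sup>2 + b * \<nu> i0 ^ 3)"
    by (rule c[of "\<lambda>x. a * x\<^sup>2 + b * x ^ 3"])
  also have "\<dots> = a * (1 / real k) + b * (1 / (real k)\<^sup>2)"
    unfolding v using k1 by (simp add: field_simps power2_eq_square power3_eq_cube)
  finally have "a * (1 / real k) + b * (1 / (real k)\<^sup>2) \<le> P \<mu>"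
    using m(2)[OF \<mu>'(1)] \<mu>'(2) \<nu>(2) by simp
  then show ?thesis
    using k1 by (intro exI[of _ k]) (simp add: P_def sum.distrib sum_distrib_left)
qed

section \<open>The planar region generated by the uniform vectors\<close>

lemma convex_R_region: "convex R_region"
  unfolding R_region_def by (rule convex_convex_hull)

text \<open>The other generators converge to \<open>(0, 0)\<close>, so the generating set is
  compact, and so is its hull in the plane. Closedness serves both the separation argument and the
  passage from matrices to kernels.\<close>

lemma closed_R_region: "closed R_region"
proof -
  let ?f = "\<lambda>n. (1 / real (Suc n), 1 / (real (Suc n))\<^sup>2)"
  have "(\<lambda>n. 1 / real (Suc n)) \<longlonglongrightarrow> 0" by (rule lim_1_over_n[THEN LIMSEQ_Suc])
  from tendsto_Pair[OF this tendsto_power[OF this, of 2]] have "?f \<longlonglongrightarrow> (0, 0)"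
    by (simp add: power_one_over)
  then have "compact (insert (0, 0) (range ?f))" by (rule compact_sequence_with_limit)
  moreover have "{(1 / real n, 1 / (real n)\<^sup>2) | n. n \<ge> 1} = range ?f"
  proof (intro equalityI subsetI)
    fix z assume "z \<in> {(1 / real n, 1 / (real n)\<^sup>2) | n. n \<ge> 1}"
    then obtain n where "n \<ge> 1" "z = (1 / real n, 1 / (real n)\<^sup>2)" by blast
    then show "z \<in> range ?f" by (intro image_eqI[of _ _ "n - 1"]) auto
  next
    fix z assume "z \<in> range ?f"
    then obtain n where "z = ?f n" by blast
    then show "z \<in> {(1 / real n, 1 / (real n)\<^sup>2) | n. n \<ge> 1}"
      by (intro CollectI exI[of _ "Suc n"]) auto
  qed
  ultimately have "compact (insert (0, 0) {(1 / real n, 1 / (real n)\<^sup>2) | n. n \<ge> 1})"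
    by simp
  then show ?thesis
    unfolding R_region_def by (intro compact_imp_closed compact_convex_hull)
qed

lemma R_region_generator: "n \<ge> 1 \<Longrightarrow> (1 / real n, 1 / (real n)\<^sup>2) \<in> R_region"
  unfolding R_region_def by (intro hull_inc insertI2 CollectI exI[of _ n] conjI refl)

text \<open>A point outside would be strictly separated from the region by a linear functional, yet
  some uniform vector, whose power sums are a generator, gives that functional a value at most as
  large.\<close>

lemma power_sums_in_R_region:
  fixes \<mu> :: "nat \<Rightarrow> real"
  assumes "\<And>i. i < N \<Longrightarrow> 0 \<le> \<mu> i" "(\<Sum>i<N. \<mu> i) = 1"
  shows "(\<Sum>i<N. (\<mu> i)\<^sup>2, \<Sum>i<N. \<mu> i ^ 3) \<in> R_region"
proof (rule ccontr)
  assume "(\<Sum>i<N. (\<mu> i)\<^sup>2, \<Sum>i<N. \<mu> i ^ 3) \<notin> R_region"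
  then obtain w c where
    w: "w \<bullet> (\<Sum>i<N. (\<mu> i)\<^sup>2, \<Sum>i<N. \<mu> i ^ 3) < c" "\<And>r. r \<in> R_region \<Longrightarrow> w \<bullet> r > c"
    using separating_hyperplane_closed_point[OF convex_R_region closed_R_region] by metis
  obtain a b where ab: "w = (a, b)" by (cases w)
  obtain k where k: "k \<ge> 1"
    "a * (1 / real k) + b * (1 / (real k)\<^sup>2) \<le> a * (\<Sum>i<N. (\<mu> i)\<^sup>2) + b * (\<Sum>i<N. \<mu> i ^ 3)"
    using simplex_functional_ge_uniform[OF assms] by blast
  show False
    using w(1) w(2)[OF R_region_generator[OF k(1)]] k(2) by (simp add: ab inner_prod_def)
qed

lemma homogeneous_power_sums_in_R_region:
  fixes \<mu> :: "nat \<Rightarrow> real"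
  assumes "\<And>i. i < N \<Longrightarrow> 0 \<le> \<mu> i" "(\<Sum>i<N. \<mu> i) \<noteq> 0"
  shows "((\<Sum>i<N. (\<mu> i)\<^sup>2) / (\<Sum>i<N. \<mu> i)\<^sup>2, (\<Sum>i<N. \<mu> i ^ 3) / (\<Sum>i<N. \<mu> i) ^ 3) \<in> R_region"
proof -
  define s where "s = (\<Sum>i<N. \<mu> i)"
  have "s \<ge> 0" unfolding s_def by (intro sum_nonneg assms) simp
  then have "(\<Sum>i<N. (\<mu> i / s)\<^sup>2, \<Sum>i<N. (\<mu> i / s) ^ 3) \<in> R_region"
    using assms by (intro power_sums_in_R_region) (auto simp: s_def sum_divide_distrib[symmetric])
  then show ?thesis by (simp add: s_def power_divide sum_divide_distrib)
qed

section \<open>Traces of powers of symmetric matrices\<close>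

text \<open>Entry \<open>(i, j)\<close> of the \<open>c\<close>-th power of the matrix
  \<open>A\<close>, for an arbitrary index set \<open>X\<close>: the block matrices below are
  indexed by pairs rather than by numbers.\<close>

fun walk_weight :: "'b set \<Rightarrow> ('b \<Rightarrow> 'b \<Rightarrow> 'c) \<Rightarrow> nat \<Rightarrow> 'b \<Rightarrow> 'b \<Rightarrow> 'c::comm_semiring_1" where
  "walk_weight X A 0 i j = (if i = j then 1 else 0)"
| "walk_weight X A (Suc c) i j = (\<Sum>k\<in>X. walk_weight X A c i k * A k j)"

lemma sum_PiE_lessThan_Suc:
  assumes "finite X"
  shows "(\<Sum>\<kappa>\<in>{..<Suc c} \<rightarrow>\<^sub>E X. f \<kappa>) = (\<Sum>\<kappa>\<in>{..<c} \<rightarrow>\<^sub>E X. \<Sum>b\<in>X. f (\<kappa>(c := b)))"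
proof -
  have "{..<Suc c} \<rightarrow>\<^sub>E X = (\<lambda>(b, \<kappa>). \<kappa>(c := b)) ` (X \<times> ({..<c} \<rightarrow>\<^sub>E X))"
    by (simp add: lessThan_Suc PiE_insert_eq)
  moreover have "inj_on (\<lambda>(b, \<kappa>). \<kappa>(c := b)) (X \<times> ({..<c} \<rightarrow>\<^sub>E X))"
    by (rule inj_combinator) simp
  ultimately have "(\<Sum>\<kappa>\<in>{..<Suc c} \<rightarrow>\<^sub>E X. f \<kappa>)
      = (\<Sum>z\<in>X \<times> ({..<c} \<rightarrow>\<^sub>E X). f ((\<lambda>(b, \<kappa>). \<kappa>(c := b)) z))"
    by (simp only: sum.reindex o_def)
  also have "\<dots> = (\<Sum>b\<in>X. \<Sum>\<kappa>\<in>{..<c} \<rightarrow>\<^sub>E X. f (\<kappa>(c := b)))"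
    by (simp add: sum.cartesian_product split_beta)
  also have "\<dots> = (\<Sum>\<kappa>\<in>{..<c} \<rightarrow>\<^sub>E X. \<Sum>b\<in>X. f (\<kappa>(c := b)))"
    by (rule sum.swap)
  finally show ?thesis .
qed

text \<open>The endpoint weight \<open>g\<close> makes the induction work, because the last edge of
  a walk can be absorbed into it; later \<open>g a b = A b a\<close> closes the walk.\<close>

lemma sum_walks:
  fixes A :: "'b \<Rightarrow> 'b \<Rightarrow> 'c::comm_semiring_1"
  assumes X: "finite X"
  shows "(\<Sum>\<kappa>\<in>{..<Suc c} \<rightarrow>\<^sub>E X. (\<Prod>i<c. A (\<kappa> i) (\<kappa> (Suc i))) * g (\<kappa> 0) (\<kappa> c))
    = (\<Sum>a\<in>X. \<Sum>b\<in>X. walk_weight X A c a b * g a b)"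
proof (induction c arbitrary: g)
  case 0
  show ?case
    by (simp add: sum_PiE_lessThan_Suc[OF X] X if_distrib[of "\<lambda>x. x * _"] cong: if_cong)
next
  case (Suc c)
  have "(\<Sum>\<kappa>\<in>{..<Suc (Suc c)} \<rightarrow>\<^sub>E X. (\<Prod>i<Suc c. A (\<kappa> i) (\<kappa> (Suc i))) * g (\<kappa> 0) (\<kappa> (Suc c)))
     = (\<Sum>\<kappa>\<in>{..<Suc c} \<rightarrow>\<^sub>E X. (\<Prod>i<c. A (\<kappa> i) (\<kappa> (Suc i))) * (\<Sum>b\<in>X. A (\<kappa> c) b * g (\<kappa> 0) b))"
    unfolding sum_PiE_lessThan_Suc[OF X, of _ "Suc c"] sum_distrib_left
    by (intro sum.cong refl) (simp add: mult.assoc)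
  also have "\<dots> = (\<Sum>a\<in>X. \<Sum>k\<in>X. walk_weight X A c a k * (\<Sum>b\<in>X. A k b * g a b))"
    by (rule Suc.IH)
  also have "\<dots> = (\<Sum>a\<in>X. \<Sum>b\<in>X. walk_weight X A (Suc c) a b * g a b)"
  proof (rule sum.cong[OF refl])
    fix a
    have "(\<Sum>k\<in>X. walk_weight X A c a k * (\<Sum>b\<in>X. A k b * g a b))
        = (\<Sum>k\<in>X. \<Sum>b\<in>X. walk_weight X A c a k * A k b * g a b)"
      by (simp add: sum_distrib_left mult.assoc)
    also have "\<dots> = (\<Sum>b\<in>X. \<Sum>k\<in>X. walk_weight X A c a k * A k b * g a b)"
      by (rule sum.swap)
    also have "\<dots> = (\<Sum>b\<in>X. walk_weight X A (Suc c) a b * g a b)"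
      by (simp add: sum_distrib_right)
    finally show "(\<Sum>k\<in>X. walk_weight X A c a k * (\<Sum>b\<in>X. A k b * g a b))
        = (\<Sum>b\<in>X. walk_weight X A (Suc c) a b * g a b)" .
  qed
  finally show ?case .
qed

lemma sum_closed_walks:
  fixes A :: "'b \<Rightarrow> 'b \<Rightarrow> 'c::comm_semiring_1"
  assumes X: "finite X" and c: "c \<ge> 1"
  shows "(\<Sum>\<kappa>\<in>{..<c} \<rightarrow>\<^sub>E X. \<Prod>i<c. A (\<kappa> i) (\<kappa> ((i + 1) mod c))) = (\<Sum>a\<in>X. walk_weight X A c a a)"
proof -
  obtain d where d: "c = Suc d" using c by (cases c) auto
  have "(\<Prod>i<Suc d. A (\<kappa> i) (\<kappa> ((i + 1) mod Suc d)))
      = (\<Prod>i<d. A (\<kappa> i) (\<kappa> (Suc i))) * A (\<kappa> d) (\<kappa> 0)" for \<kappa> :: "nat \<Rightarrow> 'b"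
    by (auto intro!: arg_cong2[where f = "(*)"] prod.cong)
  then show ?thesis
    unfolding d by (simp add: sum_walks[OF X, where c = d and A = A and g = "\<lambda>a b. A b a"])
qed

section \<open>Spectra of real symmetric matrices by complex triangularization\<close>

definition mat_trace :: "complex mat \<Rightarrow> complex" where
  "mat_trace M = (\<Sum>i<dim_row M. M $$ (i, i))"

lemma mat_trace_commute:
  assumes "A \<in> carrier_mat n m" "B \<in> carrier_mat m n"
  shows "mat_trace (A * B) = mat_trace (B * A)"
proof -
  have "mat_trace (A * B) = (\<Sum>i<n. \<Sum>k<m. A $$ (i, k) * B $$ (k, i))"
    using assms by (auto simp: mat_trace_def scalar_prod_def lessThan_atLeast0 intro!: sum.cong)
  also have "\<dots> = (\<Sum>k<m. \<Sum>i<n. B $$ (k, i) * A $$ (i, k))"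
    by (subst sum.swap) (simp add: mult.commute)
  also have "\<dots> = mat_trace (B * A)"
    using assms by (auto simp: mat_trace_def scalar_prod_def lessThan_atLeast0 intro!: sum.cong)
  finally show ?thesis .
qed

text \<open>The two claims need a joint induction: in a diagonal entry of the next power, the terms
  with \<open>k < i\<close> vanish by the second claim and those with \<open>k > i\<close> by
  triangularity of \<open>B\<close>.\<close>

lemma upper_triangular_pow:
  fixes B :: "complex mat"
  assumes B: "B \<in> carrier_mat n n" "upper_triangular B"
  shows "(\<forall>i<n. (B ^\<^sub>m c) $$ (i, i) = B $$ (i, i) ^ c) \<and> (\<forall>i<n. \<forall>j<i. (B ^\<^sub>m c) $$ (i, j) = 0)"
proof (induction c)
  case 0
  then show ?case using B by auto
next
  case (Suc c)
  have P: "B ^\<^sub>m c \<in> carrier_mat n n" using B by simp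
  have e: "(B ^\<^sub>m Suc c) $$ (i, j) = (\<Sum>k<n. (B ^\<^sub>m c) $$ (i, k) * B $$ (k, j))" if "i < n" "j < n" for i j
    using that B P by (auto simp: scalar_prod_def lessThan_atLeast0 intro!: sum.cong)
  have z: "(B ^\<^sub>m c) $$ (i, k) * B $$ (k, j) = 0" if "i < n" "k < n" "j \<le> i" "k \<noteq> i \<or> j < i" for i j k
  proof (cases "k < i")
    case True
    then show ?thesis using Suc that by auto
  next
    case False
    then have "j < k" using that by auto
    then show ?thesis using B that by (simp add: upper_triangularD)
  qed
  have "(B ^\<^sub>m Suc c) $$ (i, i) = B $$ (i, i) ^ Suc c" if "i < n" for i
  proof -
    have "(\<Sum>k<n. (B ^\<^sub>m c) $$ (i, k) * B $$ (k, i)) = (\<Sum>k\<in>{i}. (B ^\<^sub>m c) $$ (i, k) * B $$ (k, i))"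
      using that z[of i _ i] by (intro sum.mono_neutral_right) auto
    then show ?thesis using e[OF that that] Suc that by simp
  qed
  moreover have "(B ^\<^sub>m Suc c) $$ (i, j) = 0" if "i < n" "j < i" for i j
    using e[of i j] z[of i _ j] that by simp
  ultimately show ?case by blast
qed

lemma eigenvalue_symmetric_real:
  fixes A :: "nat \<Rightarrow> nat \<Rightarrow> real"
  assumes sym: "\<And>i j. i < n \<Longrightarrow> j < n \<Longrightarrow> A i j = A j i"
    and e: "eigenvalue (mat n n (\<lambda>(i, j). complex_of_real (A i j))) e"
  shows "Im e = 0"
proof -
  let ?M = "mat n n (\<lambda>(i, j). complex_of_real (A i j))"
  obtain v where "eigenvector ?M v e" using e by (auto simp: eigenvalue_def)
  then have v: "v \<in> carrier_vec n" "v \<noteq> 0\<^sub>v n" "?M *\<^sub>v v = e \<cdot>\<^sub>v v"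
    by (auto simp: eigenvector_def)
  have ev: "(\<Sum>j<n. complex_of_real (A i j) * v $ j) = e * v $ i" if "i < n" for i
  proof -
    have "(?M *\<^sub>v v) $ i = (\<Sum>j<n. complex_of_real (A i j) * v $ j)"
      using that v(1) by (auto simp: scalar_prod_def lessThan_atLeast0 intro!: sum.cong)
    then show ?thesis using v that by simp
  qed
  \<comment> \<open>The Hermitian form of the matrix at \<open>v\<close>: symmetry makes it equal to
    its own conjugate, and it is \<open>e\<close> times the squared norm of
    \<open>v\<close>.\<close>
  define s where "s = (\<Sum>i<n. cnj (v $ i) * (\<Sum>j<n. complex_of_real (A i j) * v $ j))"
  have "cnj s = (\<Sum>i<n. \<Sum>j<n. complex_of_real (A i j) * v $ i * cnj (v $ j))"
    by (simp add: s_def sum_distrib_left mult_ac)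
  also have "\<dots> = (\<Sum>i<n. \<Sum>j<n. complex_of_real (A j i) * v $ i * cnj (v $ j))"
    by (intro sum.cong refl) (simp add: sym)
  also have "\<dots> = s"
    unfolding s_def sum_distrib_left by (subst sum.swap) (simp add: mult_ac)
  finally have "Im s = 0" by (simp add: complex_eq_iff)
  moreover have "s = e * complex_of_real (\<Sum>i<n. (cmod (v $ i))\<^sup>2)"
  proof -
    have "s = (\<Sum>i<n. cnj (v $ i) * (e * v $ i))"
      unfolding s_def by (intro sum.cong refl) (simp add: ev)
    also have "\<dots> = (\<Sum>i<n. e * complex_of_real ((cmod (v $ i))\<^sup>2))"
      unfolding complex_norm_square by (intro sum.cong refl) (simp only: mult_ac)
    finally show ?thesis by (simp add: sum_distrib_left)
  qed
  moreover have "(\<Sum>i<n. (cmod (v $ i))\<^sup>2) \<noteq> 0"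
  proof
    assume "(\<Sum>i<n. (cmod (v $ i))\<^sup>2) = 0"
    then have "\<forall>i<n. v $ i = 0" by (simp add: sum_nonneg_eq_0_iff)
    then have "v = 0\<^sub>v n" using v(1) by auto
    with v(2) show False by simp
  qed
  ultimately show ?thesis by simp
qed

text \<open>One list of eigenvalues serves all powers at once, which is what relates the traces for
  4, 8 and 12. The characteristic polynomial splits over the complex numbers, Schur decomposition
  gives a triangular matrix with the same traces, and symmetry makes its diagonal real.\<close>

lemma trace_powers_symmetric:
  fixes A :: "nat \<Rightarrow> nat \<Rightarrow> real"
  assumes sym: "\<And>i j. i < n \<Longrightarrow> j < n \<Longrightarrow> A i j = A j i"
  shows "\<exists>ev. \<forall>c. (\<Sum>a<n. walk_weight {..<n} A c a a) = (\<Sum>i<n. ev i ^ c)"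
proof -
  let ?M = "mat n n (\<lambda>(i, j). complex_of_real (A i j))"
  have M: "?M \<in> carrier_mat n n" by simp
  obtain es where es: "char_poly ?M = (\<Prod>a\<leftarrow>es. [:- a, 1:])" "length es = n"
    using char_poly_factorized[OF M] by blast
  obtain B P Q where BPQ: "similar_mat_wit ?M B P Q" "upper_triangular B" "diag_mat B = es"
    using schur_decomposition[OF M es(1)] by (cases "schur_decomposition ?M es") blast
  note w = similar_mat_witD2[OF M BPQ(1)]
  have pw: "(?M ^\<^sub>m c) $$ (i, j) = complex_of_real (walk_weight {..<n} A c i j)" if "i < n" "j < n" for c i j
    using that
  proof (induction c arbitrary: i j)
    case (Suc c)
    have "(?M ^\<^sub>m Suc c) $$ (i, j) = (\<Sum>k<n. (?M ^\<^sub>m c) $$ (i, k) * complex_of_real (A k j))"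
      using Suc.prems by (auto simp: scalar_prod_def lessThan_atLeast0 intro!: sum.cong)
    also have "\<dots> = (\<Sum>k<n. complex_of_real (walk_weight {..<n} A c i k) * complex_of_real (A k j))"
      using Suc.prems Suc.IH by (intro sum.cong refl) simp
    finally show ?case by simp
  qed auto
  have "(\<Sum>a<n. walk_weight {..<n} A c a a) = (\<Sum>i<n. Re (es ! i) ^ c)" for c
  proof -
    have Bc: "B ^\<^sub>m c \<in> carrier_mat n n" using w by simp
    have "complex_of_real (\<Sum>a<n. walk_weight {..<n} A c a a) = mat_trace (?M ^\<^sub>m c)"
      using pw by (simp add: mat_trace_def)
    also have "?M ^\<^sub>m c = P * (B ^\<^sub>m c * Q)"
      using similar_mat_wit_pow_id[OF BPQ(1), of c] w Bc by simp
    also have "mat_trace \<dots> = mat_trace ((B ^\<^sub>m c * Q) * P)"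
      using w Bc by (intro mat_trace_commute[of _ n n]) auto
    also have "(B ^\<^sub>m c * Q) * P = B ^\<^sub>m c * (Q * P)"
      using w Bc by (intro assoc_mult_mat) auto
    also have "\<dots> = B ^\<^sub>m c" using w Bc by simp
    also have "mat_trace (B ^\<^sub>m c) = (\<Sum>i<n. B $$ (i, i) ^ c)"
      using Bc upper_triangular_pow[of B n c] w BPQ(2) by (auto simp: mat_trace_def)
    also have "\<dots> = (\<Sum>i<n. (es ! i) ^ c)"
      using w by (auto simp: BPQ(3)[symmetric] diag_mat_def intro!: sum.cong)
    also have "\<dots> = (\<Sum>i<n. complex_of_real (Re (es ! i)) ^ c)"
    proof (intro sum.cong refl)
      fix i assume "i \<in> {..<n}"
      then have "es ! i \<in> set es" using es(2) by auto
      then have "poly (char_poly ?M) (es ! i) = 0"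
        unfolding es(1) poly_prod_list by (auto simp: prod_list_zero_iff)
      then have "eigenvalue ?M (es ! i)" using eigenvalue_root_char_poly[OF M] by simp
      with sym have "Im (es ! i) = 0" by (rule eigenvalue_symmetric_real)
      then have "es ! i = complex_of_real (Re (es ! i))" by (simp add: complex_eq_iff)
      then show "es ! i ^ c = complex_of_real (Re (es ! i)) ^ c"
        by (rule arg_cong)
    qed
    finally have "complex_of_real (\<Sum>a<n. walk_weight {..<n} A c a a) = complex_of_real (\<Sum>i<n. Re (es ! i) ^ c)"
      by simp
    then show ?thesis by (simp only: of_real_eq_iff)
  qed
  then show ?thesis by (intro exI[of _ "\<lambda>i. Re (es ! i)"] allI)
qed

section \<open>Homomorphism sums of necklaces\<close>

text \<open>The counterpart of \<open>edge_value\<close> for two-argument weights on any type, so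
  that matrices and Borel kernels are treated alike. Symmetry of \<open>M\<close> makes the
  described value unique.\<close>

definition edge_ev :: "('b \<Rightarrow> 'b \<Rightarrow> real) \<Rightarrow> ('a \<Rightarrow> 'b) \<Rightarrow> 'a set \<Rightarrow> real" where
  "edge_ev M \<phi> e = (THE r. \<exists>i j. e = {i, j} \<and> r = M (\<phi> i) (\<phi> j))"

definition hom_weight :: "'a graph \<Rightarrow> ('b \<Rightarrow> 'b \<Rightarrow> real) \<Rightarrow> ('a \<Rightarrow> 'b) \<Rightarrow> real" where
  "hom_weight H M \<phi> = (\<Prod>e\<in>snd H. edge_ev M \<phi> e)"

definition hom_sum :: "'a graph \<Rightarrow> 'b set \<Rightarrow> ('b \<Rightarrow> 'b \<Rightarrow> real) \<Rightarrow> real" where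
  "hom_sum H X M = (\<Sum>\<phi>\<in>fst H \<rightarrow>\<^sub>E X. hom_weight H M \<phi>)"

lemma edge_ev_doubleton:
  assumes "\<forall>a b. M a b = M b a"
  shows "edge_ev M \<phi> {i, j} = M (\<phi> i) (\<phi> j)"
  unfolding edge_ev_def
  by (rule the_equality) (use assms in \<open>auto simp: doubleton_eq_iff\<close>)

lemma edge_ev_comp: "edge_ev M (\<lambda>v. h (\<phi> v)) e = edge_ev (\<lambda>a b. M (h a) (h b)) \<phi> e"
  by (simp add: edge_ev_def)

lemma edge_ev_image:
  assumes sym: "\<forall>a b. M a b = M b a" and e: "card e = 2"
  shows "edge_ev M \<phi> (h ` e) = edge_ev M (\<lambda>v. \<phi> (h v)) e"
proof -
  obtain i j where "e = {i, j}" using e by (auto simp: card_2_iff)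
  then show ?thesis by (simp add: edge_ev_doubleton[OF sym])
qed

lemma edge_ev_cong:
  assumes sym: "\<forall>a b. M a b = M b a" and e: "card e = 2" and eq: "\<And>v. v \<in> e \<Longrightarrow> \<phi> v = \<psi> v"
  shows "edge_ev M \<phi> e = edge_ev M \<psi> e"
proof -
  obtain i j where "e = {i, j}" using e by (auto simp: card_2_iff)
  then show ?thesis using eq by (simp add: edge_ev_doubleton[OF sym])
qed

lemma hom_weight_cong:
  assumes sym: "\<forall>a b. M a b = M b a" and H: "finite_simple_graph H"
    and eq: "\<And>v. v \<in> fst H \<Longrightarrow> \<phi> v = \<psi> v"
  shows "hom_weight H M \<phi> = hom_weight H M \<psi>"
  unfolding hom_weight_def
  by (intro prod.cong refl edge_ev_cong[OF sym])
    (use H eq in \<open>auto simp: finite_simple_graph_def\<close>)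

definition pairs_below :: "nat \<Rightarrow> nat set set" where
  "pairs_below k = {p. p \<subseteq> {..<k} \<and> card p = 2}"

lemma finite_pairs_below: "finite (pairs_below k)"
  unfolding pairs_below_def by (rule finite_subset[of _ "Pow {..<k}"]) auto

lemma card_pairs_below: "card (pairs_below k) = k choose 2"
  unfolding pairs_below_def using n_subsets[of "{..<k}" 2] by simp

lemma finite_snd_simple_graph: "finite_simple_graph G \<Longrightarrow> finite (snd G)"
  unfolding finite_simple_graph_def by (meson PowI finite_Pow_iff finite_subset subsetI)

text \<open>Contribution of the new vertices of one edge \<open>f\<close>, placed by
  \<open>\<psi>\<close>, when the original vertices are placed by \<open>\<kappa>\<close>; the
  factor of \<open>f\<close> itself is left out.\<close>

definition gadget_weight ::
    "nat \<Rightarrow> ('b \<Rightarrow> 'b \<Rightarrow> real) \<Rightarrow> ('a \<Rightarrow> 'b) \<Rightarrow> 'a set \<Rightarrow> (nat \<Rightarrow> 'b) \<Rightarrow> real" where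
  "gadget_weight k M \<kappa> f \<psi> =
    (\<Prod>p\<in>pairs_below k. edge_ev M \<psi> p) * (\<Prod>a<k. \<Prod>u\<in>f. M (\<psi> a) (\<kappa> u))"

text \<open>Every edge of the qification belongs to exactly one edge of \<open>G\<close>, so the
  weight factors over \<open>snd G\<close>.\<close>

lemma hom_weight_qification:
  fixes G :: "'a graph" and M :: "'b \<Rightarrow> 'b \<Rightarrow> real"
  assumes sym: "\<forall>a b. M a b = M b a" and G: "finite_simple_graph G"
  shows "hom_weight (qification q G) M \<phi> = (\<Prod>f\<in>snd G.
    edge_ev M (\<lambda>u. \<phi> (Inl u)) f * gadget_weight (q - 2) M (\<lambda>u. \<phi> (Inl u)) f (\<lambda>a. \<phi> (Inr (f, a))))"
proof -
  define k where "k = q - 2"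
  have card2: "card f = 2" if "f \<in> snd G" for f using G that by (simp add: finite_simple_graph_def)
  have finE: "finite (snd G)" by (rule finite_snd_simple_graph[OF G])
  have finf: "finite f" if "f \<in> snd G" for f using card2[OF that] by (simp add: card_2_iff) auto
  \<comment> \<open>The three kinds of edges are parametrized injectively and with disjoint ranges,
    so that no two factors are identified when the product over the set of edges is
    reindexed.\<close>
  let ?g1 = "\<lambda>f::'a set. (Inl :: 'a \<Rightarrow> 'a + 'a set \<times> nat) ` f"
  let ?g2 = "\<lambda>z::'a set \<times> nat set. (\<lambda>a. Inr (fst z, a) :: 'a + 'a set \<times> nat) ` snd z"
  let ?g3 = "\<lambda>z::'a set \<times> nat \<times> 'a. {Inr (fst z, fst (snd z)), Inl (snd (snd z)) :: 'a + 'a set \<times> nat}"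
  let ?S2 = "snd G \<times> pairs_below k"
  let ?S3 = "Sigma (snd G) (\<lambda>f. {..<k} \<times> f)"
  have E: "snd (qification q G) = ?g1 ` snd G \<union> (?g2 ` ?S2 \<union> ?g3 ` ?S3)"
  proof -
    have 1: "{Inl ` e | e. e \<in> snd G} = ?g1 ` snd G" by blast
    have 2: "{{Inr (e, k), Inr (e, m)} | e k m. e \<in> snd G \<and> k < q - 2 \<and> m < q - 2 \<and> k \<noteq> m} = ?g2 ` ?S2"
    proof (intro equalityI subsetI)
      fix x :: "('a + 'a set \<times> nat) set"
      assume "x \<in> {{Inr (e, k), Inr (e, m)} | e k m. e \<in> snd G \<and> k < q - 2 \<and> m < q - 2 \<and> k \<noteq> m}"
      then obtain e a m where "e \<in> snd G" "a < k" "m < k" "a \<noteq> m" "x = {Inr (e, a), Inr (e, m)}"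
        unfolding k_def by blast
      then show "x \<in> ?g2 ` ?S2"
        by (intro image_eqI[of _ _ "(e, {a, m})"]) (auto simp: pairs_below_def)
    next
      fix x assume "x \<in> ?g2 ` ?S2"
      then obtain e p where "e \<in> snd G" "p \<in> pairs_below k" "x = ?g2 (e, p)" by auto
      then show "x \<in> {{Inr (e, k), Inr (e, m)} | e k m. e \<in> snd G \<and> k < q - 2 \<and> m < q - 2 \<and> k \<noteq> m}"
        unfolding pairs_below_def k_def by (fastforce simp: card_2_iff)
    qed
    have 3: "{{Inr (e, k), Inl u} | e k u. e \<in> snd G \<and> k < q - 2 \<and> u \<in> e} = ?g3 ` ?S3"
      unfolding k_def by (force simp: image_iff)
    show ?thesis unfolding qification_def snd_conv 1 2 3 by (simp add: Un_assoc)
  qed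
  have fin: "finite (?g1 ` snd G)" "finite (?g2 ` ?S2)" "finite (?g3 ` ?S3)"
    using finE finf by (auto simp: finite_pairs_below)
  have Inl_in: "\<exists>u. Inl u \<in> ?g1 f" if "f \<in> snd G" for f using card2[OF that] by (auto simp: card_2_iff)
  have disj: "?g1 ` snd G \<inter> (?g2 ` ?S2 \<union> ?g3 ` ?S3) = {}" "?g2 ` ?S2 \<inter> ?g3 ` ?S3 = {}"
  proof -
    have "?g1 f \<noteq> ?g2 z" if "f \<in> snd G" for f z using Inl_in[OF that] by blast
    moreover have "?g1 f \<noteq> ?g3 z" for f z by blast
    ultimately show "?g1 ` snd G \<inter> (?g2 ` ?S2 \<union> ?g3 ` ?S3) = {}" by blast
    have "?g2 z \<noteq> ?g3 z'" for z z' by blast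
    then show "?g2 ` ?S2 \<inter> ?g3 ` ?S3 = {}" by blast
  qed
  have inj: "inj_on ?g1 (snd G)" "inj_on ?g2 ?S2" "inj_on ?g3 ?S3"
  proof -
    show "inj_on ?g1 (snd G)" by (intro inj_onI) (simp add: inj_image_eq_iff)
    show "inj_on ?g2 ?S2"
    proof (rule inj_onI)
      fix z z' assume a: "z \<in> ?S2" "z' \<in> ?S2" "?g2 z = ?g2 z'"
      obtain e p e' p' where z: "z = (e, p)" "z' = (e', p')" by (cases z, cases z')
      have eq: "Pair e ` p = Pair e' ` p'"
      proof -
        have "Inr ` (Pair e ` p) = (Inr ` (Pair e' ` p') :: ('a + 'a set \<times> nat) set)"
          using a(3) unfolding z by (simp add: image_image)
        then show ?thesis by (simp add: inj_image_eq_iff)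
      qed
      \<comment> \<open>An empty \<open>p\<close> would have the same image under every
        \<open>Pair e\<close>; a nonempty one lets \<open>e\<close> be read off.\<close>
      have "p \<noteq> {}" using a(1) z by (auto simp: pairs_below_def)
      then have "e = e'" using eq by blast
      moreover have "p = p'" using eq calculation by (auto simp: inj_image_eq_iff inj_on_def)
      ultimately show "z = z'" using z by simp
    qed
    show "inj_on ?g3 ?S3"
    proof (rule inj_onI)
      fix z z' assume "?g3 z = ?g3 z'"
      then show "z = z'" by (cases z; cases z') (auto simp: doubleton_eq_iff)
    qed
  qed
  have "hom_weight (qification q G) M \<phi>
      = prod (edge_ev M \<phi>) (?g1 ` snd G) * (prod (edge_ev M \<phi>) (?g2 ` ?S2) * prod (edge_ev M \<phi>) (?g3 ` ?S3))"
    unfolding hom_weight_def E using fin disj by (simp add: prod.union_disjoint)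
  also have "prod (edge_ev M \<phi>) (?g1 ` snd G) = (\<Prod>f\<in>snd G. edge_ev M (\<lambda>u. \<phi> (Inl u)) f)"
    by (subst prod.reindex[OF inj(1)]) (simp add: edge_ev_image[OF sym card2])
  also have "prod (edge_ev M \<phi>) (?g2 ` ?S2)
      = (\<Prod>f\<in>snd G. \<Prod>p\<in>pairs_below k. edge_ev M (\<lambda>a. \<phi> (Inr (f, a))) p)"
  proof (subst prod.reindex[OF inj(2)], subst prod.cartesian_product, intro prod.cong refl)
    fix z assume "z \<in> ?S2"
    then show "(edge_ev M \<phi> \<circ> ?g2) z = (case z of (f, p) \<Rightarrow> edge_ev M (\<lambda>a. \<phi> (Inr (f, a))) p)"
      by (auto simp: pairs_below_def edge_ev_image[OF sym])
  qed
  also have "prod (edge_ev M \<phi>) (?g3 ` ?S3)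
      = (\<Prod>f\<in>snd G. \<Prod>a<k. \<Prod>u\<in>f. M (\<phi> (Inr (f, a))) (\<phi> (Inl u)))"
  proof -
    have "prod (edge_ev M \<phi>) (?g3 ` ?S3)
        = (\<Prod>z\<in>?S3. M (\<phi> (Inr (fst z, fst (snd z)))) (\<phi> (Inl (snd (snd z)))))"
      by (subst prod.reindex[OF inj(3)]) (simp add: edge_ev_doubleton[OF sym])
    also have "\<dots> = (\<Prod>f\<in>snd G. \<Prod>w\<in>{..<k} \<times> f. M (\<phi> (Inr (f, fst w))) (\<phi> (Inl (snd w))))"
      by (subst prod.Sigma) (use finE finf in \<open>auto simp: split_beta\<close>)
    also have "\<dots> = (\<Prod>f\<in>snd G. \<Prod>a<k. \<Prod>u\<in>f. M (\<phi> (Inr (f, a))) (\<phi> (Inl u)))"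
      by (simp add: prod.cartesian_product split_beta)
    finally show ?thesis .
  qed
  finally show ?thesis
    by (simp add: gadget_weight_def k_def prod.distrib)
qed

text \<open>A map on the qification consists of a map on \<open>G\<close> and, independently for
  each edge, a map of its new vertices (\<open>?split\<close>, with inverse \<open>?join\<close>).
  Hence sum and product can be exchanged, and each group of new vertices is summed out
  separately.\<close>

lemma hom_sum_qification:
  fixes G :: "'a graph" and M :: "'b \<Rightarrow> 'b \<Rightarrow> real"
  assumes sym: "\<forall>a b. M a b = M b a" and G: "finite_simple_graph G" and X: "finite X"
  shows "hom_sum (qification q G) X M = (\<Sum>\<kappa>\<in>fst G \<rightarrow>\<^sub>E X. \<Prod>f\<in>snd G.
    edge_ev M \<kappa> f * (\<Sum>\<psi>\<in>{..<q - 2} \<rightarrow>\<^sub>E X. gadget_weight (q - 2) M \<kappa> f \<psi>))"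
proof -
  define k where "k = q - 2"
  let ?V = "fst (qification q G)"
  let ?P = "fst G \<rightarrow>\<^sub>E X" and ?Q = "snd G \<rightarrow>\<^sub>E ({..<k} \<rightarrow>\<^sub>E X)"
  let ?w = "\<lambda>\<kappa> f \<psi>. edge_ev M \<kappa> f * gadget_weight k M \<kappa> f \<psi>"
  let ?join = "\<lambda>z v. case v of Inl u \<Rightarrow> if u \<in> fst G then fst z u else undefined
    | Inr (f, a) \<Rightarrow> if f \<in> snd G \<and> a < k then snd z f a else undefined"
  let ?split = "\<lambda>\<phi>. (\<lambda>u\<in>fst G. \<phi> (Inl u), \<lambda>f\<in>snd G. \<lambda>a\<in>{..<k}. \<phi> (Inr (f, a)))"
  have V: "?V = Inl ` fst G \<union> {Inr (e, a) | e a. e \<in> snd G \<and> a < k}"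
    by (simp add: qification_def k_def)
  have finE: "finite (snd G)" by (rule finite_snd_simple_graph[OF G])
  have sub: "f \<subseteq> fst G" if "f \<in> snd G" for f using G that by (simp add: finite_simple_graph_def)
  have card2: "card f = 2" if "f \<in> snd G" for f using G that by (simp add: finite_simple_graph_def)
  have "hom_sum (qification q G) X M
      = (\<Sum>z\<in>?P \<times> ?Q. \<Prod>f\<in>snd G. ?w (fst z) f (snd z f))"
    unfolding hom_sum_def
  proof (rule sum.reindex_bij_witness[where i = ?join and j = ?split])
    fix \<phi> assume \<phi>: "\<phi> \<in> ?V \<rightarrow>\<^sub>E X"
    show "?join (?split \<phi>) = \<phi>"
    proof
      fix v show "?join (?split \<phi>) v = \<phi> v"
        using PiE_arb[OF \<phi>, of v] by (cases v) (auto simp: V image_iff)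
    qed
    show "?split \<phi> \<in> ?P \<times> ?Q" using \<phi> by (auto simp: V PiE_iff)
    show "(\<Prod>f\<in>snd G. ?w (fst (?split \<phi>)) f (snd (?split \<phi>) f)) = hom_weight (qification q G) M \<phi>"
      unfolding hom_weight_qification[OF sym G] k_def[symmetric]
    proof (intro prod.cong refl arg_cong2[where f = "(*)"])
      fix f assume f: "f \<in> snd G"
      show "edge_ev M (fst (?split \<phi>)) f = edge_ev M (\<lambda>u. \<phi> (Inl u)) f"
        by (intro edge_ev_cong[OF sym card2[OF f]]) (use sub[OF f] in auto)
      show "gadget_weight k M (fst (?split \<phi>)) f (snd (?split \<phi>) f)
          = gadget_weight k M (\<lambda>u. \<phi> (Inl u)) f (\<lambda>a. \<phi> (Inr (f, a)))"
        unfolding gadget_weight_def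
        by (intro arg_cong2[where f = "(*)"] prod.cong refl edge_ev_cong[OF sym])
          (use f sub[OF f] in \<open>auto simp: pairs_below_def\<close>)
    qed
  next
    fix z assume z: "z \<in> ?P \<times> ?Q"
    then obtain \<kappa> \<Psi> where zz: "z = (\<kappa>, \<Psi>)" "\<kappa> \<in> ?P" "\<Psi> \<in> ?Q" by auto
    have "(\<lambda>u\<in>fst G. ?join z (Inl u)) = \<kappa>"
      using PiE_arb[OF zz(2)] by (auto simp: zz(1) fun_eq_iff)
    moreover have "(\<lambda>f\<in>snd G. \<lambda>a\<in>{..<k}. ?join z (Inr (f, a))) = \<Psi>"
    proof
      fix f
      show "(\<lambda>f\<in>snd G. \<lambda>a\<in>{..<k}. ?join z (Inr (f, a))) f = \<Psi> f"
      proof (cases "f \<in> snd G")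
        case True
        then have "\<Psi> f \<in> {..<k} \<rightarrow>\<^sub>E X" using zz(3) by auto
        with True show ?thesis using PiE_arb[of "\<Psi> f"] by (auto simp: zz(1) fun_eq_iff)
      qed (use PiE_arb[OF zz(3)] in auto)
    qed
    ultimately show "?split (?join z) = z" by (simp add: zz(1))
    show "?join z \<in> ?V \<rightarrow>\<^sub>E X"
      using zz(2,3) by (auto simp: zz(1) V PiE_iff extensional_def split: sum.splits)
  qed
  also have "\<dots> = (\<Sum>\<kappa>\<in>?P. \<Sum>\<Psi>\<in>?Q. \<Prod>f\<in>snd G. ?w \<kappa> f (\<Psi> f))"
    by (simp add: sum.cartesian_product split_beta)
  also have "\<dots> = (\<Sum>\<kappa>\<in>?P. \<Prod>f\<in>snd G. \<Sum>\<psi>\<in>{..<k} \<rightarrow>\<^sub>E X. ?w \<kappa> f \<psi>)"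
    by (intro sum.cong refl prod_sum_PiE[symmetric]) (auto intro!: finE finite_PiE X)
  finally show ?thesis by (simp add: k_def sum_distrib_left)
qed

text \<open>The kernel of the \<open>q\<close>-clique operator: two vertices fixed at
  \<open>x\<close> and \<open>y\<close>, the \<open>q - 2\<close> others summed out. For
  \<open>q = 2\<close> it reduces to \<open>M\<close>.\<close>

definition clique_kernel :: "nat \<Rightarrow> 'b set \<Rightarrow> ('b \<Rightarrow> 'b \<Rightarrow> real) \<Rightarrow> 'b \<Rightarrow> 'b \<Rightarrow> real" where
  "clique_kernel q X M x y = M x y * (\<Sum>\<psi>\<in>{..<q - 2} \<rightarrow>\<^sub>E X.
    (\<Prod>p\<in>pairs_below (q - 2). edge_ev M \<psi> p) * (\<Prod>a<q - 2. M (\<psi> a) x * M (\<psi> a) y))"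

lemma clique_kernel_sym:
  assumes "\<forall>a b. M a b = M b a"
  shows "clique_kernel q X M x y = clique_kernel q X M y x"
proof -
  have "(\<Prod>a<q - 2. M (\<psi> a) x * M (\<psi> a) y) = (\<Prod>a<q - 2. M (\<psi> a) y * M (\<psi> a) x)" for \<psi>
    by (simp add: mult.commute)
  moreover have "M x y = M y x" using assms by blast
  ultimately show ?thesis
    unfolding clique_kernel_def by (intro arg_cong2[where f = "(*)"] sum.cong refl)
qed

text \<open>Equal edges with different starting points would make \<open>i\<close> and
  \<open>j\<close> successors of each other modulo \<open>c\<close>, which happens only for
  \<open>c = 2\<close>.\<close>

lemma cycle_edge_inj:
  assumes "c \<ge> (3::nat)"
  shows "inj_on (\<lambda>i. {i, (i + 1) mod c}) {..<c}"
proof (rule inj_onI)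
  fix i j assume a: "i \<in> {..<c}" "j \<in> {..<c}" "{i, (i + 1) mod c} = {j, (j + 1) mod c}"
  show "i = j"
  proof (rule ccontr)
    assume "i \<noteq> j"
    then have "i = (j + 1) mod c" "j = (i + 1) mod c" using a(3) by (auto simp: doubleton_eq_iff)
    moreover have "(k + 1) mod c = (if k + 1 = c then 0 else k + 1)" if "k < c" for k :: nat
      using that by auto
    ultimately show False using a(1,2) assms by (auto split: if_splits)
  qed
qed

lemma snd_cycle_graph: "snd (cycle_graph c) = (\<lambda>i. {i, (i + 1) mod c}) ` {..<c}"
  by (auto simp: cycle_graph_def)

text \<open>With the new vertices summed out, only a cycle weighted by the clique kernel is left; by
  \<open>sum_closed_walks\<close> this is the trace of a \<open>c\<close>-th power.\<close>

lemma hom_sum_necklace: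
  assumes sym: "\<forall>a b. M a b = M b a" and c: "c \<ge> 3" and X: "finite X"
  shows "hom_sum (necklace c q) X M
    = (\<Sum>\<kappa>\<in>{..<c} \<rightarrow>\<^sub>E X. \<Prod>i<c. clique_kernel q X M (\<kappa> i) (\<kappa> ((i + 1) mod c)))"
proof -
  \<comment> \<open>Distinct endpoints turn the product over the vertices of an edge into the two
    factors of \<open>clique_kernel\<close>.\<close>
  have neq: "i \<noteq> (i + 1) mod c" if "i < c" for i using that c by (auto simp: mod_Suc)
  have "fst (cycle_graph c) = {..<c}" by (simp add: cycle_graph_def)
  then have "hom_sum (necklace c q) X M = (\<Sum>\<kappa>\<in>{..<c} \<rightarrow>\<^sub>E X. \<Prod>f\<in>snd (cycle_graph c).
    edge_ev M \<kappa> f * (\<Sum>\<psi>\<in>{..<q - 2} \<rightarrow>\<^sub>E X. gadget_weight (q - 2) M \<kappa> f \<psi>))"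
    unfolding necklace_def hom_sum_qification[OF sym finite_simple_graph_cycle[OF c] X] by simp
  also have "\<dots> = (\<Sum>\<kappa>\<in>{..<c} \<rightarrow>\<^sub>E X. \<Prod>i<c. clique_kernel q X M (\<kappa> i) (\<kappa> ((i + 1) mod c)))"
    unfolding snd_cycle_graph prod.reindex[OF cycle_edge_inj[OF c]] o_def
    by (intro sum.cong prod.cong refl)
      (use neq in \<open>simp add: clique_kernel_def gadget_weight_def edge_ev_doubleton[OF sym]\<close>)
  finally show ?thesis .
qed

text \<open>For fixed \<open>q\<close> the count is proportional to \<open>c\<close>, so the
  normalizing factors cancel in the ratios that define \<open>necklace_x\<close> and
  \<open>necklace_y\<close>.\<close>

lemma card_necklace:
  assumes "c \<ge> 3" "q \<ge> 2"
  shows "card (fst (necklace c q)) = c * (q - 1)"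
proof -
  have "fst (necklace c q) = Inl ` {..<c} \<union> Inr ` (snd (cycle_graph c) \<times> {..<q - 2})"
    by (auto simp: necklace_def qification_def cycle_graph_def)
  moreover have "card (snd (cycle_graph c)) = c" "finite (snd (cycle_graph c))"
    unfolding snd_cycle_graph card_image[OF cycle_edge_inj[OF assms(1)]] by simp_all
  moreover have "Inl ` {..<c} \<inter> Inr ` (snd (cycle_graph c) \<times> {..<q - 2}) = {}" by blast
  ultimately have "card (fst (necklace c q)) = c + c * (q - 2)"
    by (simp add: card_Un_disjoint card_image card_cartesian_product)
  also have "\<dots> = c * (q - 1)" using assms(2) by (cases q rule: nat.exhaust; cases "q - 1") (auto simp: algebra_simps)
  finally show ?thesis .
qed

text \<open>The clique kernel is symmetric and so has real eigenvalues \<open>ev i\<close>; the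
  power sums of degree 1, 2 and 3 of the nonnegative numbers \<open>ev i ^ 4\<close> are the three
  homomorphism sums.\<close>

lemma hom_sum_ratios_in_R_region:
  fixes M :: "nat \<Rightarrow> nat \<Rightarrow> real"
  assumes sym: "\<forall>a b. M a b = M b a" and nz: "hom_sum (necklace 4 q) {..<N} M \<noteq> 0"
  shows "(hom_sum (necklace 8 q) {..<N} M / (hom_sum (necklace 4 q) {..<N} M)\<^sup>2,
          hom_sum (necklace 12 q) {..<N} M / hom_sum (necklace 4 q) {..<N} M ^ 3) \<in> R_region"
proof -
  obtain ev where ev: "\<And>c. (\<Sum>a<N. walk_weight {..<N} (clique_kernel q {..<N} M) c a a) = (\<Sum>i<N. ev i ^ c)"
    using trace_powers_symmetric[of N "clique_kernel q {..<N} M", OF clique_kernel_sym[OF sym]]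
    by blast
  have s: "hom_sum (necklace c q) {..<N} M = (\<Sum>i<N. ev i ^ c)" if "c \<ge> 3" for c
    using that unfolding hom_sum_necklace[OF sym that finite_lessThan] ev[symmetric]
    by (intro sum_closed_walks) auto
  have s4: "hom_sum (necklace 4 q) {..<N} M = (\<Sum>i<N. ev i ^ 4)"
    and s8: "hom_sum (necklace 8 q) {..<N} M = (\<Sum>i<N. (ev i ^ 4)\<^sup>2)"
    and s12: "hom_sum (necklace 12 q) {..<N} M = (\<Sum>i<N. (ev i ^ 4) ^ 3)"
    by (simp_all add: s flip: power_mult)
  show ?thesis
    using nz unfolding s4 s8 s12 by (intro homogeneous_power_sums_in_R_region) simp_all
qed

section \<open>Second moments and random rounding\<close>

text \<open>For such a pair the two homomorphism weights depend on disjoint sets of independent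
  random data, and injectivity gives each of them the right mean.\<close>

definition separated_pair :: "'a set \<Rightarrow> ('a \<Rightarrow> 'b) \<Rightarrow> ('a \<Rightarrow> 'b) \<Rightarrow> bool" where
  "separated_pair V \<phi> \<psi> \<longleftrightarrow> inj_on \<phi> V \<and> inj_on \<psi> V \<and> \<phi> ` V \<inter> \<psi> ` V = {}"

text \<open>Overwriting the value at \<open>a\<close> loses no information, since it can be
  recovered from the value at \<open>b\<close>; so collisions times \<open>X\<close> embed into all
  maps.\<close>

lemma card_collision_le:
  assumes V: "finite V" and X: "finite X" and ab: "a \<in> V" "b \<in> V" "a \<noteq> b"
  shows "card {\<phi> \<in> V \<rightarrow>\<^sub>E X. \<phi> a = \<phi> b} * card X \<le> card (V \<rightarrow>\<^sub>E X)"
proof -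
  let ?S = "{\<phi> \<in> V \<rightarrow>\<^sub>E X. \<phi> a = \<phi> b}"
  let ?f = "\<lambda>(\<phi>, x). \<phi>(a := x)"
  have "inj_on ?f (?S \<times> X)"
  proof (rule inj_onI)
    fix z z' assume z: "z \<in> ?S \<times> X" "z' \<in> ?S \<times> X" "?f z = ?f z'"
    obtain \<phi> x \<psi> y where e: "z = (\<phi>, x)" "z' = (\<psi>, y)" by (cases z, cases z')
    have eq: "(\<phi>(a := x)) v = (\<psi>(a := y)) v" for v
      using z(3) unfolding e case_prod_conv by (rule fun_cong)
    have "x = y" using eq[of a] by simp
    moreover have "\<phi> v = \<psi> v" for v
      using eq[of v] eq[of b] z(1,2) ab by (cases "v = a") (auto simp: e)
    ultimately show "z = z'" by (auto simp: e)
  qed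
  then have "card (?S \<times> X) = card (?f ` (?S \<times> X))" by (simp add: card_image)
  also have "\<dots> \<le> card (V \<rightarrow>\<^sub>E X)"
    by (rule card_mono) (use V X ab in \<open>auto intro!: finite_PiE PiE_I split: if_splits simp: PiE_iff extensional_def\<close>)
  finally show ?thesis by (simp add: card_cartesian_product)
qed

lemma card_cross_collision_le:
  assumes V: "finite V" and X: "finite X" and ab: "a \<in> V" "b \<in> V"
  shows "card {z \<in> (V \<rightarrow>\<^sub>E X) \<times> (V \<rightarrow>\<^sub>E X). fst z a = snd z b} * card X
    \<le> card (V \<rightarrow>\<^sub>E X) * card (V \<rightarrow>\<^sub>E X)"
proof -
  let ?S = "{z \<in> (V \<rightarrow>\<^sub>E X) \<times> (V \<rightarrow>\<^sub>E X). fst z a = snd z b}"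
  let ?f = "\<lambda>(z, x). ((fst z)(a := x), snd z)"
  have "inj_on ?f (?S \<times> X)"
  proof (rule inj_onI)
    fix w w' assume w: "w \<in> ?S \<times> X" "w' \<in> ?S \<times> X" "?f w = ?f w'"
    obtain z x z' y where e: "w = (z, x)" "w' = (z', y)" by (cases w, cases w')
    have "((fst z)(a := x), snd z) = ((fst z')(a := y), snd z')"
      using w(3) unfolding e case_prod_conv .
    then have eq1: "(fst z)(a := x) = (fst z')(a := y)" and eq2: "snd z = snd z'"
      unfolding prod.inject by (rule conjunct1, rule conjunct2)
    have eq: "((fst z)(a := x)) v = ((fst z')(a := y)) v" for v
      using eq1 by (rule fun_cong)
    have "x = y" using eq[of a] by simp
    moreover have "fst z v = fst z' v" for v
      using eq[of v] eq2 w(1,2) by (cases "v = a") (auto simp: e)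
    ultimately show "w = w'" using eq2 by (auto simp: e prod_eq_iff)
  qed
  then have "card (?S \<times> X) = card (?f ` (?S \<times> X))" by (simp add: card_image)
  also have "\<dots> \<le> card ((V \<rightarrow>\<^sub>E X) \<times> (V \<rightarrow>\<^sub>E X))"
    by (rule card_mono) (use V X ab in \<open>auto intro!: finite_PiE split: if_splits simp: PiE_iff extensional_def\<close>)
  finally show ?thesis by (simp add: card_cartesian_product)
qed

text \<open>Union bound: each pair \<open>(a, b)\<close> accounts for a collision within the first
  map, within the second, or between the two.\<close>

lemma card_non_separated_le:
  assumes V: "finite V" and X: "finite X"
  shows "card {z \<in> (V \<rightarrow>\<^sub>E X) \<times> (V \<rightarrow>\<^sub>E X). \<not> separated_pair V (fst z) (snd z)} * card X
    \<le> 3 * (card V)\<^sup>2 * (card X ^ card V)\<^sup>2"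
proof -
  let ?F = "V \<rightarrow>\<^sub>E X"
  let ?A = "\<lambda>(a, b). if a = b then {} else {\<phi> \<in> ?F. \<phi> a = \<phi> b} \<times> ?F"
  let ?B = "\<lambda>(a, b). if a = b then {} else ?F \<times> {\<phi> \<in> ?F. \<phi> a = \<phi> b}"
  let ?C = "\<lambda>(a, b). {z \<in> ?F \<times> ?F. fst z a = snd z b}"
  let ?D = "\<lambda>p. ?A p \<union> ?B p \<union> ?C p"
  have F: "finite ?F" "card ?F = card X ^ card V" using V X by (auto intro: finite_PiE simp: card_PiE)
  have sub: "{z \<in> ?F \<times> ?F. \<not> separated_pair V (fst z) (snd z)} \<subseteq> (\<Union>p\<in>V \<times> V. ?D p)"
  proof
    fix z assume z: "z \<in> {z \<in> ?F \<times> ?F. \<not> separated_pair V (fst z) (snd z)}"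
    then consider "\<not> inj_on (fst z) V" | "\<not> inj_on (snd z) V" | "fst z ` V \<inter> snd z ` V \<noteq> {}"
      unfolding separated_pair_def by blast
    then have "\<exists>p\<in>V \<times> V. z \<in> ?D p"
    proof cases
      case 1
      then obtain a b where "a \<in> V" "b \<in> V" "fst z a = fst z b" "a \<noteq> b" by (auto simp: inj_on_def)
      then show ?thesis using z by (intro bexI[of _ "(a, b)"]) auto
    next
      case 2
      then obtain a b where "a \<in> V" "b \<in> V" "snd z a = snd z b" "a \<noteq> b" by (auto simp: inj_on_def)
      then show ?thesis using z by (intro bexI[of _ "(a, b)"]) auto
    next
      case 3
      then obtain a b where "a \<in> V" "b \<in> V" "fst z a = snd z b" by auto
      then show ?thesis using z by (intro bexI[of _ "(a, b)"]) auto
    qed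
    then show "z \<in> (\<Union>p\<in>V \<times> V. ?D p)" by blast
  qed
  have Dfin: "finite (?D p)" for p using F by (cases p) auto
  have D: "card (?D p) * card X \<le> 3 * (card X ^ card V)\<^sup>2" if "p \<in> V \<times> V" for p
  proof -
    from that obtain a b where p: "p = (a, b)" "a \<in> V" "b \<in> V" by auto
    have "card (?A p) * card X \<le> card ?F * card ?F"
      using mult_right_mono[OF card_collision_le[OF V X p(2,3)], of "card ?F"]
      by (cases "a = b") (auto simp: p card_cartesian_product mult_ac)
    moreover have "card (?B p) * card X \<le> card ?F * card ?F"
      using mult_right_mono[OF card_collision_le[OF V X p(2,3)], of "card ?F"]
      by (cases "a = b") (auto simp: p card_cartesian_product mult_ac)
    moreover have "card (?C p) * card X \<le> card ?F * card ?F"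
      using card_cross_collision_le[OF V X p(2,3)] by (simp add: p)
    moreover have "card (?D p) \<le> card (?A p) + card (?B p) + card (?C p)"
      using card_Un_le[of "?A p \<union> ?B p" "?C p"] card_Un_le[of "?A p" "?B p"] by linarith
    then have "card (?D p) * card X \<le> card (?A p) * card X + card (?B p) * card X + card (?C p) * card X"
      unfolding add_mult_distrib[symmetric] by (rule mult_le_mono1)
    ultimately show ?thesis by (simp add: F(2) power2_eq_square)
  qed
  have "card {z \<in> ?F \<times> ?F. \<not> separated_pair V (fst z) (snd z)} \<le> card (\<Union>p\<in>V \<times> V. ?D p)"
    by (rule card_mono[OF _ sub]) (use V Dfin in auto)
  also have "\<dots> \<le> (\<Sum>p\<in>V \<times> V. card (?D p))"
    by (rule card_UN_le) (use V in auto)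
  finally have "card {z \<in> ?F \<times> ?F. \<not> separated_pair V (fst z) (snd z)} * card X
      \<le> (\<Sum>p\<in>V \<times> V. card (?D p)) * card X" by (rule mult_le_mono1)
  also have "\<dots> \<le> (\<Sum>p\<in>V \<times> V. 3 * (card X ^ card V)\<^sup>2)"
    unfolding sum_distrib_right by (rule sum_mono) (rule D)
  also have "\<dots> = 3 * (card V)\<^sup>2 * (card X ^ card V)\<^sup>2"
    by (simp add: card_cartesian_product power2_eq_square)
  finally show ?thesis .
qed

text \<open>This is the common second moment estimate for sampling and for random rounding: \<open>c \<phi> \<psi>\<close>
  is a covariance, which vanishes for separated pairs.\<close>

lemma sum_covariance_le:
  fixes c :: "('a \<Rightarrow> 'b) \<Rightarrow> ('a \<Rightarrow> 'b) \<Rightarrow> real"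
  assumes V: "finite V" and X: "finite X" "X \<noteq> {}" and "K \<ge> 0"
    and zero: "\<And>\<phi> \<psi>. \<phi> \<in> V \<rightarrow>\<^sub>E X \<Longrightarrow> \<psi> \<in> V \<rightarrow>\<^sub>E X \<Longrightarrow> separated_pair V \<phi> \<psi> \<Longrightarrow> c \<phi> \<psi> = 0"
    and bound: "\<And>\<phi> \<psi>. \<phi> \<in> V \<rightarrow>\<^sub>E X \<Longrightarrow> \<psi> \<in> V \<rightarrow>\<^sub>E X \<Longrightarrow> c \<phi> \<psi> \<le> K"
  shows "(\<Sum>\<phi>\<in>V \<rightarrow>\<^sub>E X. \<Sum>\<psi>\<in>V \<rightarrow>\<^sub>E X. c \<phi> \<psi>) / (real (card X) ^ card V)\<^sup>2
    \<le> 3 * K * (real (card V))\<^sup>2 / real (card X)"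
proof -
  let ?F = "V \<rightarrow>\<^sub>E X"
  let ?B = "{z \<in> ?F \<times> ?F. \<not> separated_pair V (fst z) (snd z)}"
  have F: "finite ?F" using V X by (auto intro: finite_PiE)
  have N: "real (card X) > 0" using X by (simp add: card_gt_0_iff)
  have "(\<Sum>\<phi>\<in>?F. \<Sum>\<psi>\<in>?F. c \<phi> \<psi>) = (\<Sum>z\<in>?F \<times> ?F. c (fst z) (snd z))"
    by (simp add: sum.cartesian_product split_beta)
  also have "\<dots> = (\<Sum>z\<in>?B. c (fst z) (snd z))"
    by (rule sum.mono_neutral_right) (use F zero in auto)
  also have "\<dots> \<le> (\<Sum>z\<in>?B. K)" by (rule sum_mono) (use bound in auto)
  finally have "(\<Sum>\<phi>\<in>?F. \<Sum>\<psi>\<in>?F. c \<phi> \<psi>) * real (card X) \<le> K * (real (card ?B) * real (card X))"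
    using N by (simp add: mult_ac)
  also have "real (card ?B) * real (card X) = real (card ?B * card X)" by simp
  also have "K * \<dots> \<le> K * real (3 * (card V)\<^sup>2 * (card X ^ card V)\<^sup>2)"
    by (intro mult_left_mono \<open>K \<ge> 0\<close>) (simp only: of_nat_le_iff card_non_separated_le[OF V X(1)])
  finally have "(\<Sum>\<phi>\<in>?F. \<Sum>\<psi>\<in>?F. c \<phi> \<psi>) * real (card X)
      \<le> 3 * K * (real (card V))\<^sup>2 * (real (card X) ^ card V)\<^sup>2" by simp
  then show ?thesis using N by (simp add: divide_le_eq le_divide_eq mult_ac)
qed

section \<open>Independent random sets of pairs\<close>

text \<open>For \<open>u\<close> with values in \<open>[0, 1]\<close> the weights are the law of a
  random subset of \<open>P\<close> containing each \<open>p\<close> independently with probability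
  \<open>u p\<close>, and the sum is the probability of containing \<open>A\<close>. Replacing
  \<open>1 - u p\<close> by 0 on \<open>A\<close> removes exactly the sets that miss a point of
  \<open>A\<close>.\<close>

lemma sum_Pow_product_weight:
  fixes u :: "'p \<Rightarrow> real"
  assumes P: "finite P" and A: "A \<subseteq> P"
  shows "(\<Sum>S\<in>Pow P. (\<Prod>p\<in>S. u p) * (\<Prod>p\<in>P - S. 1 - u p) * of_bool (A \<subseteq> S)) = (\<Prod>p\<in>A. u p)"
proof -
  let ?g = "\<lambda>p. if p \<in> A then 0 else 1 - u p"
  have "(\<Prod>p\<in>A. u p) = (\<Prod>p\<in>P. u p + ?g p)"
    by (rule prod.mono_neutral_cong_left) (use P A in auto)
  also have "\<dots> = (\<Sum>S\<in>Pow P. (\<Prod>p\<in>S. u p) * (\<Prod>p\<in>P - S. ?g p))"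
    by (rule prod_add[OF P])
  also have "\<dots> = (\<Sum>S\<in>Pow P. (\<Prod>p\<in>S. u p) * (\<Prod>p\<in>P - S. 1 - u p) * of_bool (A \<subseteq> S))"
  proof (intro sum.cong refl)
    fix S assume "S \<in> Pow P"
    show "(\<Prod>p\<in>S. u p) * (\<Prod>p\<in>P - S. ?g p) = (\<Prod>p\<in>S. u p) * (\<Prod>p\<in>P - S. 1 - u p) * of_bool (A \<subseteq> S)"
    proof (cases "A \<subseteq> S")
      case True
      then have "(\<Prod>p\<in>P - S. ?g p) = (\<Prod>p\<in>P - S. 1 - u p)" by (intro prod.cong) auto
      then show ?thesis using True by simp
    next
      case False
      then obtain p where "p \<in> P - S" "p \<in> A" using A by auto
      then have "(\<Prod>p\<in>P - S. ?g p) = 0" using P by (intro prod_zero) auto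
      then show ?thesis using False by simp
    qed
  qed
  finally show ?thesis by simp
qed

lemma of_bool_prod: "finite A \<Longrightarrow> (\<Prod>x\<in>A. of_bool (P x) :: real) = of_bool (\<forall>x\<in>A. P x)"
  by (induction A rule: finite_induct) auto

lemma hom_weight_unit_interval:
  assumes sym: "\<forall>a b. U a b = U b a" and H: "finite_simple_graph H"
    and "\<And>a b. 0 \<le> U a b" "\<And>a b. U a b \<le> (1::real)"
  shows "0 \<le> hom_weight H U \<phi>" "hom_weight H U \<phi> \<le> 1"
proof -
  have e: "0 \<le> edge_ev U \<phi> e \<and> edge_ev U \<phi> e \<le> 1" if "e \<in> snd H" for e
  proof -
    have "card e = 2" using H that by (simp add: finite_simple_graph_def)
    then obtain i j where "e = {i, j}" by (auto simp: card_2_iff)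
    then show ?thesis using assms by (simp add: edge_ev_doubleton[OF sym])
  qed
  show "0 \<le> hom_weight H U \<phi>" unfolding hom_weight_def using e by (intro prod_nonneg) auto
  show "hom_weight H U \<phi> \<le> 1" unfolding hom_weight_def using e by (intro prod_le_1) auto
qed

text \<open>Each pair becomes an edge independently with the probability given by \<open>U\<close>.
  The mean of the total squared deviation obeys the bound, hence some outcome does; summing over
  \<open>J\<close> first yields one matrix that is good for all graphs at once.\<close>

lemma random_rounding:
  fixes U :: "'b \<Rightarrow> 'b \<Rightarrow> real" and H :: "'j \<Rightarrow> 'a graph"
  assumes J: "finite J" and H: "\<And>j. j \<in> J \<Longrightarrow> finite_simple_graph (H j)"
    and sym: "\<forall>a b. U a b = U b a" and U: "\<And>a b. 0 \<le> U a b" "\<And>a b. U a b \<le> 1"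
    and X: "finite X" "X \<noteq> {}"
  shows "\<exists>M :: 'b \<Rightarrow> 'b \<Rightarrow> real. (\<forall>a b. M a b = M b a) \<and> (\<forall>a b. M a b \<in> {0, 1}) \<and> (\<forall>a. M a a = 0) \<and>
    (\<Sum>j\<in>J. ((hom_sum (H j) X M - hom_sum (H j) X U) / real (card X) ^ card (fst (H j)))\<^sup>2)
      \<le> (\<Sum>j\<in>J. 3 * (real (card (fst (H j))))\<^sup>2) / real (card X)"
proof -
  define P where "P = {p. p \<subseteq> X \<and> card p = 2}"
  define u where "u p = edge_ev U id p" for p
  define w where "w S = (\<Prod>p\<in>S. u p) * (\<Prod>p\<in>P - S. 1 - u p)" for S
  define M where "M S a b = (of_bool ({a, b} \<in> S) :: real)" for S :: "'b set set" and a b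
  define Y where "Y j \<phi> S = hom_weight (H j) (M S) \<phi> - hom_weight (H j) U \<phi>" for j \<phi> S
  define D where "D j S = (hom_sum (H j) X (M S) - hom_sum (H j) X U) / real (card X) ^ card (fst (H j))" for j S
  have P: "finite P" unfolding P_def using X by auto
  have Msym: "\<forall>a b. M S a b = M S b a" for S by (simp add: M_def insert_commute)
  have M01: "M S a b \<in> {0, 1}" for S a b by (simp add: M_def)
  have M01': "0 \<le> M S a b" "M S a b \<le> 1" for S a b by (simp_all add: M_def)
  have Mdiag: "M S a a = 0" if "S \<in> Pow P" for S a
    using that by (auto simp: M_def P_def)
  have u: "0 \<le> u p" "u p \<le> 1" if "p \<in> P" for p
  proof -
    from that obtain a b where "p = {a, b}" by (auto simp: P_def card_2_iff)
    then show "0 \<le> u p" "u p \<le> 1" using U by (auto simp: u_def edge_ev_doubleton[OF sym])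
  qed
  have w0: "w S \<ge> 0" if "S \<in> Pow P" for S
    unfolding w_def using that u by (intro mult_nonneg_nonneg prod_nonneg) auto
  have w1: "(\<Sum>S\<in>Pow P. w S) = 1"
    using sum_Pow_product_weight[OF P, of "{}" u] by (simp add: w_def)
  have card2: "card e = 2" and sub: "e \<subseteq> fst (H j)" if "e \<in> snd (H j)" "j \<in> J" for e j
    using H[OF that(2)] that by (auto simp: finite_simple_graph_def)
  have finE: "finite (snd (H j))" and finV: "finite (fst (H j))" if "j \<in> J" for j
    using H[OF that] by (auto simp: finite_simple_graph_def intro: finite_snd_simple_graph)
  let ?A = "\<lambda>j \<phi>. (\<lambda>e. \<phi> ` e) ` snd (H j)"
  have G: "hom_weight (H j) (M S) \<phi> = of_bool (?A j \<phi> \<subseteq> S)" if j: "j \<in> J" for j S \<phi>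
  proof -
    have "edge_ev (M S) \<phi> e = of_bool (\<phi> ` e \<in> S)" if "e \<in> snd (H j)" for e
    proof -
      from card2[OF that j] obtain a b where "e = {a, b}" by (auto simp: card_2_iff)
      then show ?thesis by (simp add: edge_ev_doubleton[OF Msym] M_def)
    qed
    then have "hom_weight (H j) (M S) \<phi> = (\<Prod>e\<in>snd (H j). of_bool (\<phi> ` e \<in> S))"
      unfolding hom_weight_def by (intro prod.cong) auto
    also have "\<dots> = of_bool (?A j \<phi> \<subseteq> S)"
      unfolding of_bool_prod[OF finE[OF j]] by (simp add: image_subset_iff)
    finally show ?thesis .
  qed
  \<comment> \<open>Only injective maps are sure to have the exact mean: otherwise two edges could
    share a pair or collapse to the diagonal, where \<open>M S\<close> is zero. The other maps are
    left to the collision count.\<close>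
  have AP: "?A j \<phi> \<subseteq> P" and Au: "(\<Prod>p\<in>?A j \<phi>. u p) = hom_weight (H j) U \<phi>"
    if j: "j \<in> J" and \<phi>: "\<phi> \<in> fst (H j) \<rightarrow>\<^sub>E X" and inj: "inj_on \<phi> (fst (H j))" for j \<phi>
  proof -
    show "?A j \<phi> \<subseteq> P"
    proof
      fix p assume "p \<in> ?A j \<phi>"
      then obtain e where e: "e \<in> snd (H j)" "p = \<phi> ` e" by auto
      have "inj_on \<phi> e" using inj sub[OF e(1) j] by (rule inj_on_subset)
      then show "p \<in> P" using e card2[OF e(1) j] sub[OF e(1) j] \<phi> by (auto simp: P_def card_image)
    qed
    have "inj_on ((`) \<phi>) (snd (H j))"
      by (rule inj_on_subset[OF inj_on_image_Pow[OF inj]]) (use sub[OF _ j] in blast)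
    then show "(\<Prod>p\<in>?A j \<phi>. u p) = hom_weight (H j) U \<phi>"
      unfolding hom_weight_def u_def
      by (subst prod.reindex) (auto intro!: prod.cong simp: edge_ev_image[OF sym card2[OF _ j]])
  qed
  have E1: "(\<Sum>S\<in>Pow P. w S * hom_weight (H j) (M S) \<phi>) = hom_weight (H j) U \<phi>"
    if "j \<in> J" "\<phi> \<in> fst (H j) \<rightarrow>\<^sub>E X" "inj_on \<phi> (fst (H j))" for j \<phi>
    using sum_Pow_product_weight[OF P AP[OF that]] by (simp add: G[OF that(1)] w_def Au[OF that])
  have E2: "(\<Sum>S\<in>Pow P. w S * (hom_weight (H j) (M S) \<phi> * hom_weight (H j) (M S) \<psi>))
      = hom_weight (H j) U \<phi> * hom_weight (H j) U \<psi>"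
    if j: "j \<in> J" and \<phi>: "\<phi> \<in> fst (H j) \<rightarrow>\<^sub>E X" "\<psi> \<in> fst (H j) \<rightarrow>\<^sub>E X"
      and sep: "separated_pair (fst (H j)) \<phi> \<psi>" for j \<phi> \<psi>
  proof -
    have inj: "inj_on \<phi> (fst (H j))" "inj_on \<psi> (fst (H j))" "\<phi> ` fst (H j) \<inter> \<psi> ` fst (H j) = {}"
      using sep by (auto simp: separated_pair_def)
    have disj: "?A j \<phi> \<inter> ?A j \<psi> = {}"
    proof (rule ccontr)
      assume "?A j \<phi> \<inter> ?A j \<psi> \<noteq> {}"
      then obtain e f where ef: "e \<in> snd (H j)" "f \<in> snd (H j)" "\<phi> ` e = \<psi> ` f" by auto
      have "e \<noteq> {}" using card2[OF ef(1) j] by auto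
      then show False using ef(3) sub[OF ef(1) j] sub[OF ef(2) j] inj(3) by blast
    qed
    have "(\<Sum>S\<in>Pow P. w S * (hom_weight (H j) (M S) \<phi> * hom_weight (H j) (M S) \<psi>))
        = (\<Sum>S\<in>Pow P. w S * of_bool (?A j \<phi> \<union> ?A j \<psi> \<subseteq> S))"
      by (intro sum.cong refl) (simp add: G[OF j])
    also have "\<dots> = (\<Prod>p\<in>?A j \<phi> \<union> ?A j \<psi>. u p)"
      unfolding w_def by (rule sum_Pow_product_weight[OF P]) (use AP[OF j \<phi>(1) inj(1)] AP[OF j \<phi>(2) inj(2)] in auto)
    also have "\<dots> = (\<Prod>p\<in>?A j \<phi>. u p) * (\<Prod>p\<in>?A j \<psi>. u p)"
      using disj finE[OF j] by (intro prod.union_disjoint) auto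
    finally show ?thesis using Au[OF j \<phi>(1) inj(1)] Au[OF j \<phi>(2) inj(2)] by simp
  qed
  have cov0: "(\<Sum>S\<in>Pow P. w S * (Y j \<phi> S * Y j \<psi> S)) = 0"
    if j: "j \<in> J" and \<phi>: "\<phi> \<in> fst (H j) \<rightarrow>\<^sub>E X" "\<psi> \<in> fst (H j) \<rightarrow>\<^sub>E X"
      and sep: "separated_pair (fst (H j)) \<phi> \<psi>" for j \<phi> \<psi>
  proof -
    let ?f = "\<lambda>S. hom_weight (H j) (M S) \<phi>" and ?g = "\<lambda>S. hom_weight (H j) (M S) \<psi>"
    let ?a = "hom_weight (H j) U \<phi>" and ?b = "hom_weight (H j) U \<psi>"
    have inj: "inj_on \<phi> (fst (H j))" "inj_on \<psi> (fst (H j))" using sep by (auto simp: separated_pair_def)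
    have "(\<Sum>S\<in>Pow P. w S * (Y j \<phi> S * Y j \<psi> S))
        = (\<Sum>S\<in>Pow P. w S * (?f S * ?g S)) - (\<Sum>S\<in>Pow P. w S * ?f S) * ?b
          - (\<Sum>S\<in>Pow P. w S * ?g S) * ?a + (\<Sum>S\<in>Pow P. w S) * (?a * ?b)"
      unfolding Y_def sum_distrib_right sum_subtractf[symmetric] sum.distrib[symmetric]
      by (intro sum.cong refl) (simp add: algebra_simps)
    then show ?thesis
      using E2[OF j \<phi> sep] E1[OF j \<phi>(1) inj(1)] E1[OF j \<phi>(2) inj(2)] w1 by simp
  qed
  have cov1: "(\<Sum>S\<in>Pow P. w S * (Y j \<phi> S * Y j \<psi> S)) \<le> 1" if j: "j \<in> J" for j \<phi> \<psi>
  proof -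
    have "\<bar>Y j \<xi> S\<bar> \<le> 1" for \<xi> S
      using hom_weight_unit_interval[OF sym H[OF j] U, of \<xi>]
        hom_weight_unit_interval[OF Msym H[OF j] M01', of S \<xi>] by (simp add: Y_def abs_le_iff)
    then have "\<bar>Y j \<phi> S * Y j \<psi> S\<bar> \<le> 1" for S
      unfolding abs_mult by (intro mult_le_one) auto
    then have "Y j \<phi> S * Y j \<psi> S \<le> 1" for S by (simp add: abs_le_iff)
    then have "(\<Sum>S\<in>Pow P. w S * (Y j \<phi> S * Y j \<psi> S)) \<le> (\<Sum>S\<in>Pow P. w S * 1)"
      by (intro sum_mono mult_left_mono w0)
    then show ?thesis using w1 by simp
  qed
  have moment: "(\<Sum>S\<in>Pow P. w S * (D j S)\<^sup>2) \<le> 3 * (real (card (fst (H j))))\<^sup>2 / real (card X)"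
    if j: "j \<in> J" for j
  proof -
    let ?F = "fst (H j) \<rightarrow>\<^sub>E X" and ?N = "real (card X) ^ card (fst (H j))"
    have "D j S = (\<Sum>\<phi>\<in>?F. Y j \<phi> S) / ?N" for S
      by (simp add: D_def Y_def hom_sum_def sum_subtractf)
    then have D2: "(D j S)\<^sup>2 = (\<Sum>\<phi>\<in>?F. \<Sum>\<psi>\<in>?F. Y j \<phi> S * Y j \<psi> S) / ?N\<^sup>2" for S
      by (simp add: power2_eq_square sum_product)
    have "(\<Sum>S\<in>Pow P. w S * (D j S)\<^sup>2)
        = (\<Sum>S\<in>Pow P. \<Sum>\<phi>\<in>?F. \<Sum>\<psi>\<in>?F. w S * (Y j \<phi> S * Y j \<psi> S)) / ?N\<^sup>2"
      by (simp add: D2 sum_distrib_left sum_divide_distrib)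
    also have "(\<Sum>S\<in>Pow P. \<Sum>\<phi>\<in>?F. \<Sum>\<psi>\<in>?F. w S * (Y j \<phi> S * Y j \<psi> S))
        = (\<Sum>\<phi>\<in>?F. \<Sum>S\<in>Pow P. \<Sum>\<psi>\<in>?F. w S * (Y j \<phi> S * Y j \<psi> S))" by (rule sum.swap)
    also have "\<dots> = (\<Sum>\<phi>\<in>?F. \<Sum>\<psi>\<in>?F. \<Sum>S\<in>Pow P. w S * (Y j \<phi> S * Y j \<psi> S))"
      by (intro sum.cong refl sum.swap)
    also have "\<dots> / ?N\<^sup>2 \<le> 3 * 1 * (real (card (fst (H j))))\<^sup>2 / real (card X)"
      by (rule sum_covariance_le[OF finV[OF j] X]) (use cov0[OF j] cov1[OF j] in auto)
    finally show ?thesis by simp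
  qed
  define C where "C = (\<Sum>j\<in>J. 3 * (real (card (fst (H j))))\<^sup>2) / real (card X)"
  have "\<exists>S\<in>Pow P. (\<Sum>j\<in>J. (D j S)\<^sup>2) \<le> C"
  proof (rule ccontr)
    assume neg: "\<not> (\<exists>S\<in>Pow P. (\<Sum>j\<in>J. (D j S)\<^sup>2) \<le> C)"
    have gt: "(\<Sum>j\<in>J. (D j S)\<^sup>2) > C" if "S \<in> Pow P" for S
      by (rule ccontr, rule notE[OF neg], rule bexI[OF _ that], simp only: not_less)
    have "(\<Sum>S\<in>Pow P. w S) \<noteq> 0" using w1 by simp
    then obtain S0 where S0: "S0 \<in> Pow P" "w S0 \<noteq> 0"
      by (rule sum.not_neutral_contains_not_neutral)
    then have S0': "w S0 > 0" using w0[OF S0(1)] by simp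
    have "C = (\<Sum>S\<in>Pow P. w S * C)" using w1 by (simp flip: sum_distrib_right)
    also have "\<dots> < (\<Sum>S\<in>Pow P. w S * (\<Sum>j\<in>J. (D j S)\<^sup>2))"
    proof (rule sum_strict_mono_ex1)
      show "\<forall>S\<in>Pow P. w S * C \<le> w S * (\<Sum>j\<in>J. (D j S)\<^sup>2)"
        by (intro ballI mult_left_mono w0 less_imp_le gt)
      show "\<exists>S\<in>Pow P. w S * C < w S * (\<Sum>j\<in>J. (D j S)\<^sup>2)"
        by (intro bexI[OF _ S0(1)] mult_strict_left_mono gt S0(1) S0')
    qed (use P in simp)
    also have "\<dots> = (\<Sum>j\<in>J. \<Sum>S\<in>Pow P. w S * (D j S)\<^sup>2)"
      unfolding sum_distrib_left by (rule sum.swap)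
    also have "\<dots> \<le> C"
      unfolding C_def sum_divide_distrib by (rule sum_mono) (rule moment)
    finally show False by simp
  qed
  then obtain S where S: "S \<in> Pow P" "(\<Sum>j\<in>J. (D j S)\<^sup>2) \<le> C" by blast
  show ?thesis
  proof (intro exI[of _ "M S"] conjI)
    show "(\<Sum>j\<in>J. ((hom_sum (H j) X (M S) - hom_sum (H j) X U) / real (card X) ^ card (fst (H j)))\<^sup>2)
      \<le> (\<Sum>j\<in>J. 3 * (real (card (fst (H j))))\<^sup>2) / real (card X)"
      using S(2) unfolding D_def C_def .
    show "\<forall>a b. M S a b = M S b a" by (rule Msym)
    show "\<forall>a b. M S a b \<in> {0, 1}" by (intro allI M01)
    show "\<forall>a. M S a a = 0" by (intro allI Mdiag S(1))
  qed
qed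

section \<open>Sampling from a kernel\<close>

abbreviation unit_lborel :: "real measure" where
  "unit_lborel \<equiv> restrict_space lborel {0..1}"

lemma prob_space_unit_lborel: "prob_space unit_lborel"
  by (rule prob_spaceI) (simp add: space_restrict_space emeasure_restrict_space)

interpretation unit_product: product_prob_space "\<lambda>_. unit_lborel" I for I :: "'i set"
proof -
  interpret prob_space unit_lborel by (rule prob_space_unit_lborel)
  show "product_prob_space (\<lambda>_::'i. unit_lborel)"
    by unfold_locales
qed

text \<open>Agreement almost everywhere with the measurable \<open>g\<close> already makes
  \<open>f\<close> measurable for the completion. This replaces Lebesgue measurable kernels by Borel
  functions.\<close>

lemma integral_completion_cong_AE:
  fixes f g :: "'a \<Rightarrow> real"
  assumes g: "g \<in> borel_measurable M" and ae: "AE x in M. f x = g x"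
  shows "integral\<^sup>L (completion M) f = integral\<^sup>L M g"
proof -
  have gc: "g \<in> borel_measurable (completion M)" using g by (rule measurable_completion)
  have aec: "AE x in completion M. f x = g x" using ae by (rule AE_completion)
  have "f \<in> borel_measurable (completion M)"
  proof (rule measurableI)
    fix A :: "real set" assume "A \<in> sets borel"
    then have "g -` A \<inter> space (completion M) \<in> sets (completion M)" using gc by (rule measurable_sets[rotated])
    then show "f -` A \<inter> space (completion M) \<in> sets (completion M)"
      by (rule completion.in_sets_AE[rotated]) (use aec in auto)
  qed simp
  then have "integral\<^sup>L (completion M) f = integral\<^sup>L (completion M) g"
    by (intro integral_cong_AE gc aec)
  then show ?thesis by (simp add: integral_completion[OF g])
qed

text \<open>Two distinct coordinates are jointly distributed as Lebesgue measure on the square, so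
  null sets pull back to null sets. For \<open>i = j\<close> the diagonal would be a counterexample;
  edges of a simple graph avoid it.\<close>

lemma AE_pair_coordinates:
  assumes V: "finite V" and ij: "i \<in> V" "j \<in> V" "i \<noteq> j"
    and N: "N \<in> null_sets (unit_lborel \<Otimes>\<^sub>M unit_lborel)"
  shows "AE x in Pi\<^sub>M V (\<lambda>_. unit_lborel). (x i, x j) \<notin> N"
proof -
  let ?Q = "unit_lborel" and ?I = "{i, j}"
  have Nm[measurable]: "N \<in> sets (?Q \<Otimes>\<^sub>M ?Q)" using N by auto
  have [measurable]: "(\<lambda>\<sigma>. (\<sigma> i, \<sigma> j)) \<in> Pi\<^sub>M ?I (\<lambda>_. ?Q) \<rightarrow>\<^sub>M ?Q \<Otimes>\<^sub>M ?Q"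
    by (intro measurable_Pair measurable_component_singleton) auto
  have "(\<integral>\<^sup>+\<sigma>. indicator N (\<sigma> i, \<sigma> j) \<partial>Pi\<^sub>M ?I (\<lambda>_. ?Q)) = (\<integral>\<^sup>+z. indicator N (fst z, snd z) \<partial>(?Q \<Otimes>\<^sub>M ?Q))"
    using unit_product.product_nn_integral_pair[of "\<lambda>a b. indicator N (a, b)" i j] ij by simp
  also have "\<dots> = 0" using N by auto
  finally have "AE \<sigma> in Pi\<^sub>M ?I (\<lambda>_. ?Q). indicator N (\<sigma> i, \<sigma> j) = (0::ennreal)"
    by (subst (asm) nn_integral_0_iff_AE) auto
  then have ae: "AE \<sigma> in Pi\<^sub>M ?I (\<lambda>_. ?Q). (\<sigma> i, \<sigma> j) \<notin> N"
    by eventually_elim (auto simp: indicator_def split: if_splits)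
  have de: "distr (Pi\<^sub>M V (\<lambda>_. ?Q)) (Pi\<^sub>M ?I (\<lambda>_. ?Q)) (\<lambda>\<omega>. \<lambda>n\<in>?I. \<omega> n) = Pi\<^sub>M ?I (\<lambda>_. ?Q)"
    using distr_PiM_reindex[of V "\<lambda>_. ?Q" "\<lambda>n. n" ?I] ij prob_space_unit_lborel by auto
  have "AE \<sigma> in distr (Pi\<^sub>M V (\<lambda>_. ?Q)) (Pi\<^sub>M ?I (\<lambda>_. ?Q)) (\<lambda>\<omega>. \<lambda>n\<in>?I. \<omega> n). (\<sigma> i, \<sigma> j) \<notin> N"
    unfolding de by (rule ae)
  then show ?thesis
  proof (subst (asm) AE_distr_iff)
    show "(\<lambda>\<omega>. \<lambda>n\<in>?I. \<omega> n) \<in> Pi\<^sub>M V (\<lambda>_. ?Q) \<rightarrow>\<^sub>M Pi\<^sub>M ?I (\<lambda>_. ?Q)"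
      using ij by (intro measurable_restrict measurable_component_singleton) auto
  qed auto
qed

lemma AE_unit_lborel: "AE x in lborel. P x \<Longrightarrow> AE x in unit_lborel. P x"
  by (subst AE_restrict_space_iff) (auto elim: eventually_mono)

lemma null_sets_unit_square:
  assumes N: "N \<in> null_sets (lborel :: (real \<times> real) measure)"
  shows "AE x in unit_lborel. AE y in unit_lborel. (x, y) \<notin> N \<and> (y, x) \<notin> N"
proof -
  have Nm: "N \<in> sets (lborel \<Otimes>\<^sub>M lborel)" and N0: "AE z in lborel \<Otimes>\<^sub>M lborel. z \<notin> N"
    unfolding lborel_prod using N by (auto intro: AE_not_in)
  have 1: "AE x in lborel. AE y in lborel. (x, y) \<notin> N"
    using lborel_pair.AE_pair[OF N0] by simp
  have "{z \<in> space (lborel \<Otimes>\<^sub>M lborel). (fst z, snd z) \<notin> N} \<in> sets (lborel \<Otimes>\<^sub>M lborel)"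
    using sets.compl_sets[OF Nm] by (simp add: set_diff_eq)
  from lborel_pair.AE_commute[OF this] 1 have 2: "AE y in lborel. AE x in lborel. (x, y) \<notin> N" by simp
  have "AE x in lborel. AE y in lborel. (x, y) \<notin> N \<and> (y, x) \<notin> N"
    using 1 2 by eventually_elim (rule AE_conjI)
  then have "AE x in lborel. AE y in unit_lborel. (x, y) \<notin> N \<and> (y, x) \<notin> N"
    by (rule eventually_mono) (rule AE_unit_lborel)
  then show ?thesis by (rule AE_unit_lborel)
qed

text \<open>A Borel function equal to the kernel almost everywhere need be neither bounded nor
  symmetric. Truncation, followed by averaging with the transpose, restores both properties and
  changes nothing off a null set, which for this purpose is enlarged by its mirror image.\<close>

lemma borel_version_of_kernel:
  assumes W: "graph_kernel W"
  obtains W' B where "W' \<in> borel_measurable borel" "\<forall>a b. W' (a, b) = W' (b, a)" "\<And>z. \<bar>W' z\<bar> \<le> B"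
    "\<exists>N\<in>null_sets (unit_lborel \<Otimes>\<^sub>M unit_lborel). \<forall>x\<in>{0..1}. \<forall>y\<in>{0..1}. (x, y) \<notin> N \<longrightarrow> W (x, y) = W' (x, y)"
proof -
  let ?S = "{0..1::real} \<times> {0..1::real}"
  define g where "g z = (if z \<in> ?S then W z else 0)" for z
  have "?S \<in> sets lebesgue"
    by (intro sets_completionI_sets) (auto intro!: borel_closed closed_Times)
  then have "(\<lambda>z. indicator ?S z *\<^sub>R W z) \<in> borel_measurable lebesgue"
    using W by (subst borel_measurable_restrict_space_iff[symmetric]) (auto simp: graph_kernel_def)
  also have "(\<lambda>z. indicator ?S z *\<^sub>R W z) = g" by (auto simp: g_def indicator_def)
  finally obtain g' where g': "g' \<in> borel_measurable lborel" "AE z in lborel. g z = g' z"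
    using completion_ex_borel_measurable_real by blast
  have [measurable]: "g' \<in> borel_measurable borel" using g'(1) by simp
  obtain N where N: "N \<in> null_sets lborel" "{z. g z \<noteq> g' z} \<subseteq> N"
    using g'(2) by (auto elim!: AE_E intro: null_setsI simp: null_sets_def)
  obtain B where "\<And>z. z \<in> ?S \<Longrightarrow> norm (W z) \<le> B"
    using W by (auto simp: graph_kernel_def bounded_iff)
  then have B: "\<bar>g z\<bar> \<le> \<bar>B\<bar>" for z by (auto simp: g_def intro: order_trans[OF _ abs_ge_self])
  define h where "h z = max (- \<bar>B\<bar>) (min \<bar>B\<bar> (g' z))" for z
  define W' where "W' z = (h z + h (snd z, fst z)) / 2" for z :: "real \<times> real"
  have [measurable]: "h \<in> borel_measurable borel" unfolding h_def by measurable
  have "(\<lambda>z::real \<times> real. (snd z, fst z)) \<in> borel \<rightarrow>\<^sub>M borel"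
    unfolding borel_prod[symmetric] by measurable
  then have [measurable]: "(\<lambda>z. h (snd z, fst z)) \<in> borel_measurable borel" by measurable
  have hb: "\<bar>h z\<bar> \<le> \<bar>B\<bar>" for z unfolding h_def by auto
  define N' where "N' = {z \<in> ?S. z \<in> N \<or> (snd z, fst z) \<in> N}"
  have N'_null: "N' \<in> null_sets (unit_lborel \<Otimes>\<^sub>M unit_lborel)"
  proof -
    interpret pair_sigma_finite unit_lborel unit_lborel
      by (intro pair_sigma_finite.intro unit_product.sigma_finite_measures)
    have m: "(\<lambda>z. z) \<in> unit_lborel \<Otimes>\<^sub>M unit_lborel \<rightarrow>\<^sub>M lborel"
      "(\<lambda>z. (snd z, fst z)) \<in> unit_lborel \<Otimes>\<^sub>M unit_lborel \<rightarrow>\<^sub>M lborel"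
    proof -
      have [measurable]: "fst \<in> unit_lborel \<Otimes>\<^sub>M unit_lborel \<rightarrow>\<^sub>M lborel" "snd \<in> unit_lborel \<Otimes>\<^sub>M unit_lborel \<rightarrow>\<^sub>M lborel"
        using measurable_compose[OF measurable_fst, of id unit_lborel lborel]
          measurable_compose[OF measurable_snd, of id unit_lborel lborel]
        by (simp_all add: id_def measurable_restrict_space1)
      have "(\<lambda>z. (fst z, snd z)) \<in> unit_lborel \<Otimes>\<^sub>M unit_lborel \<rightarrow>\<^sub>M lborel \<Otimes>\<^sub>M lborel"
        "(\<lambda>z. (snd z, fst z)) \<in> unit_lborel \<Otimes>\<^sub>M unit_lborel \<rightarrow>\<^sub>M lborel \<Otimes>\<^sub>M lborel" by measurable
      then show "(\<lambda>z. z) \<in> unit_lborel \<Otimes>\<^sub>M unit_lborel \<rightarrow>\<^sub>M lborel"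
        "(\<lambda>z. (snd z, fst z)) \<in> unit_lborel \<Otimes>\<^sub>M unit_lborel \<rightarrow>\<^sub>M lborel" by (simp_all add: lborel_prod)
    qed
    have sp: "space (unit_lborel \<Otimes>\<^sub>M unit_lborel) = ?S"
      by (simp add: space_pair_measure space_restrict_space)
    have "N \<in> sets lborel" using N by auto
    from measurable_sets[OF m(1) this] measurable_sets[OF m(2) this]
    have "N' \<in> sets (unit_lborel \<Otimes>\<^sub>M unit_lborel)"
    proof -
      have "N' = ((\<lambda>z. z) -` N \<inter> space (unit_lborel \<Otimes>\<^sub>M unit_lborel)) \<union>
          ((\<lambda>z. (snd z, fst z)) -` N \<inter> space (unit_lborel \<Otimes>\<^sub>M unit_lborel))"
        unfolding sp N'_def by auto
      with \<open>(\<lambda>z. z) -` N \<inter> _ \<in> _\<close> \<open>(\<lambda>z. (snd z, fst z)) -` N \<inter> _ \<in> _\<close> show ?thesis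
        by (simp only: sets.Un)
    qed
    moreover have "AE z in unit_lborel \<Otimes>\<^sub>M unit_lborel. z \<notin> N'"
    proof (rule AE_pair_measure)
      show "{z \<in> space (unit_lborel \<Otimes>\<^sub>M unit_lborel). z \<notin> N'} \<in> sets (unit_lborel \<Otimes>\<^sub>M unit_lborel)"
        using sets.compl_sets[OF calculation] by (simp add: set_diff_eq)
      show "AE x in unit_lborel. AE y in unit_lborel. (x, y) \<notin> N'"
        by (rule eventually_mono[OF null_sets_unit_square[OF N(1)]], erule eventually_mono)
          (simp add: N'_def)
    qed
    ultimately show ?thesis by (simp add: AE_iff_null_sets)
  qed
  have eq: "W (x, y) = W' (x, y)" if "x \<in> {0..1}" "y \<in> {0..1}" "(x, y) \<notin> N'" for x y
  proof -
    have "g (x, y) = g' (x, y)" "g (y, x) = g' (y, x)" using that N(2) by (auto simp: N'_def)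
    moreover have "g (x, y) = W (x, y)" "g (y, x) = W (x, y)"
      using that W by (auto simp: g_def graph_kernel_def)
    ultimately have "h (x, y) = W (x, y)" "h (y, x) = W (x, y)"
      using B[of "(x, y)"] B[of "(y, x)"] by (auto simp: h_def abs_le_iff)
    then show ?thesis by (simp add: W'_def)
  qed
  show thesis
  proof (rule that)
    show "W' \<in> borel_measurable borel" unfolding W'_def by measurable
    show "\<forall>a b. W' (a, b) = W' (b, a)" by (simp add: W'_def add.commute)
    show "\<bar>W' z\<bar> \<le> \<bar>B\<bar>" for z using hb[of z] hb[of "(snd z, fst z)"] by (simp add: W'_def abs_le_iff)
    show "\<exists>N\<in>null_sets (unit_lborel \<Otimes>\<^sub>M unit_lborel).
      \<forall>x\<in>{0..1}. \<forall>y\<in>{0..1}. (x, y) \<notin> N \<longrightarrow> W (x, y) = W' (x, y)"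
      using N'_null eq by blast
  qed
qed

lemma measurable_hom_weight:
  assumes W: "W \<in> borel_measurable borel" and sym: "\<forall>a b. W (a, b) = W (b, a)"
    and H: "finite_simple_graph H"
  shows "hom_weight H (\<lambda>a b. W (a, b)) \<in> borel_measurable (Pi\<^sub>M (fst H) (\<lambda>_. unit_lborel))"
  unfolding hom_weight_def
proof (rule borel_measurable_prod)
  fix e assume "e \<in> snd H"
  then obtain i j where e: "e = {i, j}" "i \<in> fst H" "j \<in> fst H"
    using H by (auto simp: finite_simple_graph_def card_2_iff)
  have id: "(\<lambda>x. x) \<in> unit_lborel \<rightarrow>\<^sub>M borel" by (simp add: measurable_restrict_space1)
  have "(\<lambda>x. x i) \<in> Pi\<^sub>M (fst H) (\<lambda>_. unit_lborel) \<rightarrow>\<^sub>M borel" "(\<lambda>x. x j) \<in> Pi\<^sub>M (fst H) (\<lambda>_. unit_lborel) \<rightarrow>\<^sub>M borel"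
    using e(2,3) by (auto intro!: measurable_compose[where N = unit_lborel, OF _ id] measurable_component_singleton)
  then have "(\<lambda>x. (x i, x j)) \<in> Pi\<^sub>M (fst H) (\<lambda>_. unit_lborel) \<rightarrow>\<^sub>M borel"
    unfolding borel_prod[symmetric] by (rule measurable_Pair)
  from measurable_compose[OF this W]
  show "(\<lambda>x. edge_ev (\<lambda>a b. W (a, b)) x e) \<in> borel_measurable (Pi\<^sub>M (fst H) (\<lambda>_. unit_lborel))"
    by (simp add: e(1) edge_ev_doubleton[OF sym])
qed

lemma abs_hom_weight_le:
  assumes sym: "\<forall>a b. M a b = M b a" and H: "finite_simple_graph H" and B: "\<And>a b. \<bar>M a b\<bar> \<le> B"
  shows "\<bar>hom_weight H M \<phi>\<bar> \<le> B ^ card (snd H)"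
proof -
  have "\<bar>edge_ev M \<phi> e\<bar> \<le> B" if "e \<in> snd H" for e
  proof -
    from H that obtain i j where "e = {i, j}" by (auto simp: finite_simple_graph_def card_2_iff)
    then show ?thesis by (simp add: edge_ev_doubleton[OF sym] B)
  qed
  then have "(\<Prod>e\<in>snd H. \<bar>edge_ev M \<phi> e\<bar>) \<le> (\<Prod>e\<in>snd H. B)" by (intro prod_mono) auto
  then show ?thesis by (simp add: hom_weight_def abs_prod)
qed

definition hom_int :: "'a graph \<Rightarrow> (real \<times> real \<Rightarrow> real) \<Rightarrow> real" where
  "hom_int H W = (\<integral>x. hom_weight H (\<lambda>a b. W (a, b)) x \<partial>Pi\<^sub>M (fst H) (\<lambda>_. unit_lborel))"

lemma hom_density_eq_hom_int:
  assumes W: "graph_kernel W" and H: "finite_simple_graph H"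
    and W': "W' \<in> borel_measurable borel" and sym: "\<forall>a b. W' (a, b) = W' (b, a)"
    and N: "N \<in> null_sets (unit_lborel \<Otimes>\<^sub>M unit_lborel)"
    and eq: "\<forall>x\<in>{0..1}. \<forall>y\<in>{0..1}. (x, y) \<notin> N \<longrightarrow> W (x, y) = W' (x, y)"
  shows "hom_density H W = hom_int H W'"
proof -
  let ?P = "Pi\<^sub>M (fst H) (\<lambda>_. unit_lborel)"
  have V: "finite (fst H)" and E: "finite (snd H)"
    using H by (auto simp: finite_simple_graph_def intro: finite_snd_simple_graph)
  have "AE x in ?P. \<forall>e\<in>snd H. edge_value W x e = edge_ev (\<lambda>a b. W' (a, b)) x e"
  proof (rule AE_finite_allI[OF E])
    fix e assume "e \<in> snd H"
    then obtain i j where e: "e = {i, j}" "i \<in> fst H" "j \<in> fst H" "i \<noteq> j"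
      using H by (auto simp: finite_simple_graph_def card_2_iff)
    have "AE x in ?P. (x i, x j) \<notin> N" by (rule AE_pair_coordinates[OF V e(2-4) N])
    moreover have "AE x in ?P. x \<in> space ?P" by (rule AE_space)
    ultimately show "AE x in ?P. edge_value W x e = edge_ev (\<lambda>a b. W' (a, b)) x e"
    proof eventually_elim
      case (elim x)
      have "x i \<in> {0..1}" "x j \<in> {0..1}"
        using elim(2) e by (auto simp: space_PiM space_restrict_space PiE_iff)
      then show ?case
        using eq elim(1) by (simp add: e(1) edge_value_eq[OF W] edge_ev_doubleton[OF sym])
    qed
  qed
  then have "AE x in ?P. (\<Prod>e\<in>snd H. edge_value W x e) = hom_weight H (\<lambda>a b. W' (a, b)) x"
    by eventually_elim (auto simp: hom_weight_def intro!: prod.cong)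
  with measurable_hom_weight[OF W' sym H] show ?thesis
    unfolding hom_density_def hom_int_def by (rule integral_completion_cong_AE)
qed

text \<open>The points \<open>x a\<close> with \<open>a < N\<close> are independent and uniform. The
  centred contributions \<open>Y \<phi>\<close> and \<open>Y \<psi>\<close> of separated maps are
  uncorrelated; non-injective maps may bias the sampled density, but they are few.\<close>

lemma sampling_second_moment:
  fixes W :: "real \<times> real \<Rightarrow> real" and H :: "'a graph"
  assumes W: "W \<in> borel_measurable borel" and sym: "\<forall>a b. W (a, b) = W (b, a)" and B: "\<And>z. \<bar>W z\<bar> \<le> B"
    and H: "finite_simple_graph H" and N: "N \<ge> 1"
  defines "D \<equiv> \<lambda>x. hom_sum H {..<N} (\<lambda>a b. W (x a, x b)) / real N ^ card (fst H) - hom_int H W"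
  shows "integrable (Pi\<^sub>M {..<N} (\<lambda>_. unit_lborel)) (\<lambda>x. (D x)\<^sup>2)"
    and "(\<integral>x. (D x)\<^sup>2 \<partial>Pi\<^sub>M {..<N} (\<lambda>_. unit_lborel))
      \<le> 3 * (B ^ card (snd H) + \<bar>hom_int H W\<bar>)\<^sup>2 * (real (card (fst H)))\<^sup>2 / real N"
proof -
  let ?V = "fst H" and ?Wc = "\<lambda>a b. W (a, b)"
  let ?F = "?V \<rightarrow>\<^sub>E {..<N}"
  let ?P = "\<lambda>I :: nat set. Pi\<^sub>M I (\<lambda>_. unit_lborel)" and ?PV = "Pi\<^sub>M ?V (\<lambda>_. unit_lborel)"
  define t where "t = hom_int H W"
  define K where "K = B ^ card (snd H) + \<bar>t\<bar>"
  define g where "g y = hom_weight H ?Wc y - t" for y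
  define Y where "Y \<phi> x = g (\<lambda>v\<in>?V. x (\<phi> v))" for \<phi> :: "'a \<Rightarrow> nat" and x :: "nat \<Rightarrow> real"
  have V: "finite ?V" using H by (simp add: finite_simple_graph_def)
  have meas_g: "g \<in> borel_measurable ?PV"
    unfolding g_def using measurable_hom_weight[OF W sym H] by measurable
  have gK: "\<bar>g y\<bar> \<le> K" for y
    using abs_hom_weight_le[of ?Wc, OF sym H B, of y] unfolding g_def K_def by linarith
  have K0: "K \<ge> 0" using gK[of undefined] by linarith
  have int_g: "(\<integral>y. g y \<partial>?PV) = 0"
  proof -
    have "integrable ?PV (hom_weight H ?Wc)"
      using abs_hom_weight_le[of ?Wc, OF sym H B] measurable_hom_weight[OF W sym H]
      by (intro unit_product.P.integrable_const_bound[where B = "B ^ card (snd H)"]) auto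
    then show ?thesis
      unfolding g_def t_def hom_int_def by (simp add: unit_product.P.prob_space)
  qed
  have meas_sel: "(\<lambda>x. \<lambda>v\<in>?V. x (\<phi> v)) \<in> ?P I \<rightarrow>\<^sub>M ?PV" if "\<phi> ` ?V \<subseteq> I" for \<phi> I
    using that by (intro measurable_restrict measurable_component_singleton) auto
  have meas_Y: "Y \<phi> \<in> borel_measurable (?P I)" if "\<phi> ` ?V \<subseteq> I" for \<phi> I
    unfolding Y_def by (rule measurable_compose[OF meas_sel[OF that] meas_g])
  have YK: "\<bar>Y \<phi> x\<bar> \<le> K" for \<phi> x unfolding Y_def by (rule gK)
  have YYK: "\<bar>Y \<phi> x * Y \<psi> x\<bar> \<le> K\<^sup>2" for \<phi> \<psi> x
    unfolding abs_mult power2_eq_square by (intro mult_mono YK) (auto simp: K0)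
  have FV: "\<phi> ` ?V \<subseteq> {..<N}" if "\<phi> \<in> ?F" for \<phi> using that by auto
  have int_YY: "integrable (?P {..<N}) (\<lambda>x. Y \<phi> x * Y \<psi> x)" if "\<phi> \<in> ?F" "\<psi> \<in> ?F" for \<phi> \<psi>
    using YYK meas_Y[OF FV[OF that(1)]] meas_Y[OF FV[OF that(2)]]
    by (intro unit_product.P.integrable_const_bound[where B = "K\<^sup>2"]) auto
  have cov0: "(\<integral>x. Y \<phi> x * Y \<psi> x \<partial>?P {..<N}) = 0"
    if F: "\<phi> \<in> ?F" "\<psi> \<in> ?F" and sep: "separated_pair ?V \<phi> \<psi>" for \<phi> \<psi>
  proof -
    \<comment> \<open>\<open>I\<close> holds the indices of the sample points seen by
      \<open>\<phi>\<close>, and \<open>J\<close> all others, among them those seen by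
      \<open>\<psi>\<close>. Integrating over \<open>J\<close> first leaves the mean of
      \<open>Y \<psi>\<close>, which is zero because \<open>\<psi>\<close> is injective.\<close>
    define I where "I = \<phi> ` ?V"
    define J where "J = {..<N} - I"
    have IJ: "I \<inter> J = {}" "finite I" "finite J" "{..<N} = I \<union> J"
      using V FV[OF F(1)] by (auto simp: I_def J_def)
    have \<psi>: "inj_on \<psi> ?V" "\<psi> ` ?V \<subseteq> J"
      using sep FV[OF F(2)] by (auto simp: separated_pair_def J_def I_def)
    have int0: "(\<integral>y. Y \<psi> y \<partial>?P J) = 0"
    proof -
      have "distr (?P J) ?PV (\<lambda>\<omega>. \<lambda>v\<in>?V. \<omega> (\<psi> v)) = ?PV"
        using distr_PiM_reindex[of J "\<lambda>_. unit_lborel" \<psi> ?V] \<psi> prob_space_unit_lborel by auto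
      then have "(\<integral>y. g y \<partial>?PV) = (\<integral>y. g y \<partial>distr (?P J) ?PV (\<lambda>\<omega>. \<lambda>v\<in>?V. \<omega> (\<psi> v)))"
        by simp
      also have "\<dots> = (\<integral>y. Y \<psi> y \<partial>?P J)"
        unfolding Y_def by (rule integral_distr[OF meas_sel[OF \<psi>(2)] meas_g])
      finally show ?thesis using int_g by simp
    qed
    have split: "Y \<phi> (merge I J (x, y)) = Y \<phi> x" "Y \<psi> (merge I J (x, y)) = Y \<psi> y" for x y
    proof -
      have "\<phi> v \<in> I" "\<psi> v \<in> J" "\<psi> v \<notin> I" if "v \<in> ?V" for v
        using that \<psi>(2) IJ(1) by (auto simp: I_def)
      then show "Y \<phi> (merge I J (x, y)) = Y \<phi> x" "Y \<psi> (merge I J (x, y)) = Y \<psi> y"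
        unfolding Y_def by (auto intro!: arg_cong[where f = g] restrict_ext simp: merge_def)
    qed
    have "(\<integral>x. Y \<phi> x * Y \<psi> x \<partial>?P {..<N})
        = (\<integral>x. (\<integral>y. Y \<phi> (merge I J (x, y)) * Y \<psi> (merge I J (x, y)) \<partial>?P J) \<partial>?P I)"
      unfolding IJ(4)
      by (rule unit_product.product_integral_fold[OF IJ(1-3)]) (use int_YY[OF F] IJ(4) in simp)
    then show ?thesis by (simp add: split int0)
  qed
  have cov1: "(\<integral>x. Y \<phi> x * Y \<psi> x \<partial>?P {..<N}) \<le> K\<^sup>2" if F: "\<phi> \<in> ?F" "\<psi> \<in> ?F" for \<phi> \<psi>
  proof -
    have "(\<integral>x. Y \<phi> x * Y \<psi> x \<partial>?P {..<N}) \<le> (\<integral>x. K\<^sup>2 \<partial>?P {..<N})"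
      using YYK by (intro integral_mono int_YY F) (auto simp: abs_le_iff)
    then show ?thesis by (simp add: unit_product.P.prob_space)
  qed
  have D: "D x = (\<Sum>\<phi>\<in>?F. Y \<phi> x) / real N ^ card ?V" for x
  proof -
    have "Y \<phi> x = hom_weight H (\<lambda>a b. W (x a, x b)) \<phi> - t" for \<phi>
    proof -
      have "hom_weight H ?Wc (\<lambda>v\<in>?V. x (\<phi> v)) = hom_weight H ?Wc (\<lambda>v. x (\<phi> v))"
        by (rule hom_weight_cong[OF sym H]) simp
      then show ?thesis by (simp add: Y_def g_def hom_weight_def edge_ev_comp)
    qed
    then have "(\<Sum>\<phi>\<in>?F. Y \<phi> x) = hom_sum H {..<N} (\<lambda>a b. W (x a, x b)) - real N ^ card ?V * t"
      using V by (simp add: hom_sum_def sum_subtractf card_PiE)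
    then show ?thesis using N by (simp add: D_def t_def diff_divide_distrib)
  qed
  have D2: "(D x)\<^sup>2 = (\<Sum>\<phi>\<in>?F. \<Sum>\<psi>\<in>?F. Y \<phi> x * Y \<psi> x) / (real N ^ card ?V)\<^sup>2" for x
    unfolding D by (simp add: power2_eq_square sum_product)
  show "integrable (?P {..<N}) (\<lambda>x. (D x)\<^sup>2)"
    unfolding D2 by (intro integrable_divide Bochner_Integration.integrable_sum int_YY)
  have "(\<integral>x. (D x)\<^sup>2 \<partial>?P {..<N})
      = (\<Sum>\<phi>\<in>?F. \<Sum>\<psi>\<in>?F. \<integral>x. Y \<phi> x * Y \<psi> x \<partial>?P {..<N}) / (real N ^ card ?V)\<^sup>2"
    unfolding D2 using int_YY by (simp add: Bochner_Integration.integral_sum Bochner_Integration.integrable_sum)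
  also have "\<dots> \<le> 3 * K\<^sup>2 * (real (card ?V))\<^sup>2 / real N"
    using sum_covariance_le[of ?V "{..<N}" "K\<^sup>2" "\<lambda>\<phi> \<psi>. \<integral>x. Y \<phi> x * Y \<psi> x \<partial>?P {..<N}"]
      V N cov0 cov1 by (simp add: lessThan_empty_iff)
  finally show "(\<integral>x. (D x)\<^sup>2 \<partial>?P {..<N})
      \<le> 3 * (B ^ card (snd H) + \<bar>hom_int H W\<bar>)\<^sup>2 * (real (card ?V))\<^sup>2 / real N"
    by (simp add: K_def t_def)
qed

text \<open>The bound in mean provides, for each \<open>N\<close>, one sample that is good for all
  graphs in \<open>J\<close> simultaneously. Choosing such samples already gives convergence,
  without any almost sure statement.\<close>

lemma sampled_matrices:
  fixes H :: "'j \<Rightarrow> 'a graph"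
  assumes W: "graph_kernel W" and J: "finite J" and H: "\<And>j. j \<in> J \<Longrightarrow> finite_simple_graph (H j)"
  shows "\<exists>M :: nat \<Rightarrow> nat \<Rightarrow> nat \<Rightarrow> real. (\<forall>N a b. M N a b = M N b a) \<and>
    (\<forall>j\<in>J. (\<lambda>N. hom_sum (H j) {..<N} (M N) / real N ^ card (fst (H j))) \<longlonglongrightarrow> hom_density (H j) W)"
proof -
  obtain W' B where W': "W' \<in> borel_measurable borel" "\<forall>a b. W' (a, b) = W' (b, a)" "\<And>z. \<bar>W' z\<bar> \<le> B"
    and "\<exists>N\<in>null_sets (unit_lborel \<Otimes>\<^sub>M unit_lborel). \<forall>x\<in>{0..1}. \<forall>y\<in>{0..1}. (x, y) \<notin> N \<longrightarrow> W (x, y) = W' (x, y)"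
    using borel_version_of_kernel[OF W] by blast
  then have dens: "hom_density (H j) W = hom_int (H j) W'" if "j \<in> J" for j
    using hom_density_eq_hom_int[OF W H[OF that]] by blast
  define D where "D j N x = hom_sum (H j) {..<N} (\<lambda>a b. W' (x a, x b)) / real N ^ card (fst (H j)) - hom_int (H j) W'"
    for j N and x :: "nat \<Rightarrow> real"
  define c where "c j = 3 * (B ^ card (snd (H j)) + \<bar>hom_int (H j) W'\<bar>)\<^sup>2 * (real (card (fst (H j))))\<^sup>2" for j
  have ex: "\<exists>x. N \<ge> 1 \<longrightarrow> (\<Sum>j\<in>J. (D j N x)\<^sup>2) \<le> (\<Sum>j\<in>J. c j) / real N" for N
  proof (cases "N \<ge> 1")
    case True
    let ?P = "Pi\<^sub>M {..<N} (\<lambda>_. unit_lborel)"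
    note m = sampling_second_moment[OF W' H True, folded D_def c_def]
    have int: "integrable ?P (\<lambda>x. \<Sum>j\<in>J. (D j N x)\<^sup>2)"
      by (intro Bochner_Integration.integrable_sum m(1))
    have "(\<integral>x. (\<Sum>j\<in>J. (D j N x)\<^sup>2) \<partial>?P) = (\<Sum>j\<in>J. \<integral>x. (D j N x)\<^sup>2 \<partial>?P)"
      by (intro Bochner_Integration.integral_sum m(1))
    also have "\<dots> \<le> (\<Sum>j\<in>J. c j) / real N"
      unfolding sum_divide_distrib by (intro sum_mono m(2))
    finally have le: "(\<integral>x. (\<Sum>j\<in>J. (D j N x)\<^sup>2) \<partial>?P) \<le> (\<Sum>j\<in>J. c j) / real N" .
    have "\<not> (\<forall>x. (\<Sum>j\<in>J. (D j N x)\<^sup>2) > (\<Sum>j\<in>J. c j) / real N)"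
      using unit_product.P.expectation_greater[OF int, of "(\<Sum>j\<in>J. c j) / real N"] le by auto
    then show ?thesis by (auto simp: not_less)
  qed auto
  then obtain x where x: "\<And>N. N \<ge> 1 \<Longrightarrow> (\<Sum>j\<in>J. (D j N (x N))\<^sup>2) \<le> (\<Sum>j\<in>J. c j) / real N"
    by metis
  have lim: "(\<lambda>N. D j N (x N)) \<longlonglongrightarrow> 0" if j: "j \<in> J" for j
  proof -
    have "(\<lambda>N. (D j N (x N))\<^sup>2) \<longlonglongrightarrow> 0"
    proof (rule tendsto_sandwich[OF _ _ tendsto_const])
      show "\<forall>\<^sub>F N in sequentially. 0 \<le> (D j N (x N))\<^sup>2" by simp
      show "\<forall>\<^sub>F N in sequentially. (D j N (x N))\<^sup>2 \<le> (\<Sum>j\<in>J. c j) / real N"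
      proof (rule eventually_sequentiallyI[of 1])
        fix N :: nat assume "1 \<le> N"
        have "(D j N (x N))\<^sup>2 \<le> (\<Sum>j\<in>J. (D j N (x N))\<^sup>2)"
          by (rule member_le_sum[OF j]) (use J in auto)
        then show "(D j N (x N))\<^sup>2 \<le> (\<Sum>j\<in>J. c j) / real N" using x[OF \<open>1 \<le> N\<close>] by simp
      qed
      show "(\<lambda>N. (\<Sum>j\<in>J. c j) / real N) \<longlonglongrightarrow> 0" by (rule lim_const_over_n)
    qed
    then have "(\<lambda>N. sqrt ((D j N (x N))\<^sup>2)) \<longlonglongrightarrow> sqrt 0" by (rule tendsto_real_sqrt)
    then show ?thesis by (simp add: tendsto_rabs_zero_iff)
  qed
  show ?thesis
  proof (intro exI[of _ "\<lambda>N a b. W' (x N a, x N b)"] conjI ballI)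
    show "\<forall>N a b. W' (x N a, x N b) = W' (x N b, x N a)" by (intro allI W'(2)[rule_format])
    fix j assume "j \<in> J"
    from tendsto_add[OF lim[OF this] tendsto_const[of "hom_int (H j) W'"]]
    show "(\<lambda>N. hom_sum (H j) {..<N} (\<lambda>a b. W' (x N a, x N b)) / real N ^ card (fst (H j)))
        \<longlonglongrightarrow> hom_density (H j) W"
      using dens[OF \<open>j \<in> J\<close>] by (simp add: D_def)
  qed
qed

text \<open>The matrix version passes to the limit because \<open>R_region\<close> is closed and the
  limit of the denominators is nonzero.\<close>

lemma necklace_ratios_in_R_region:
  assumes W: "graph_kernel W" and q: "q \<ge> 2" and nz: "hom_density (necklace 4 q) W \<noteq> 0"
  shows "(necklace_x q W, necklace_y q W) \<in> R_region"
proof -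
  have "\<exists>M :: nat \<Rightarrow> nat \<Rightarrow> nat \<Rightarrow> real. (\<forall>N a b. M N a b = M N b a) \<and>
    (\<forall>c\<in>{4, 8, 12}. (\<lambda>N. hom_sum (necklace c q) {..<N} (M N) / real N ^ card (fst (necklace c q)))
      \<longlonglongrightarrow> hom_density (necklace c q) W)"
    by (rule sampled_matrices[OF W]) (auto intro: finite_simple_graph_necklace)
  then obtain M :: "nat \<Rightarrow> nat \<Rightarrow> nat \<Rightarrow> real" where sym: "\<forall>N a b. M N a b = M N b a"
    and lim: "\<forall>c\<in>{4, 8, 12}. (\<lambda>N. hom_sum (necklace c q) {..<N} (M N) / real N ^ card (fst (necklace c q)))
      \<longlonglongrightarrow> hom_density (necklace c q) W"
    by (elim exE conjE)
  let ?h = "\<lambda>c N. hom_sum (necklace c q) {..<N} (M N)"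
  let ?t = "\<lambda>c N. ?h c N / real N ^ (c * (q - 1))"
  have t: "?t c \<longlonglongrightarrow> hom_density (necklace c q) W" if "c \<in> {4, 8, 12}" for c
    using lim that q by (auto simp: card_necklace)
  have lim_xy: "(\<lambda>N. (?t 8 N / (?t 4 N)\<^sup>2, ?t 12 N / ?t 4 N ^ 3)) \<longlonglongrightarrow> (necklace_x q W, necklace_y q W)"
    unfolding necklace_x_def necklace_y_def using nz by (intro tendsto_intros t) auto
  have "\<forall>\<^sub>F N in sequentially. ?t 4 N \<noteq> 0"
    using t[of 4] nz by (intro tendsto_imp_eventually_ne) auto
  then have "\<forall>\<^sub>F N in sequentially. (?t 8 N / (?t 4 N)\<^sup>2, ?t 12 N / ?t 4 N ^ 3) \<in> R_region"
  proof eventually_elim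
    case (elim N)
    \<comment> \<open>The vertex counts for 4, 8 and 12 are in the ratio 1 : 2 : 3, so the
      normalizers are \<open>d\<close>, \<open>d\<^sup>2\<close> and \<open>d ^ 3\<close>.\<close>
    define d where "d = real N ^ (4 * (q - 1))"
    have d: "real N ^ (8 * (q - 1)) = d\<^sup>2" "real N ^ (12 * (q - 1)) = d ^ 3"
      by (simp_all add: d_def mult.commute[of _ "q - 1"] mult.assoc flip: power_mult)
    have "d \<noteq> 0" and h4: "?h 4 N \<noteq> 0" using elim by (auto simp: d_def)
    then have eq: "?t 8 N / (?t 4 N)\<^sup>2 = ?h 8 N / (?h 4 N)\<^sup>2" "?t 12 N / ?t 4 N ^ 3 = ?h 12 N / ?h 4 N ^ 3"
      unfolding d d_def[symmetric] by (simp_all add: power_divide)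
    have "\<forall>a b. M N a b = M N b a" using sym by (rule spec)
    then show ?case unfolding eq by (rule hom_sum_ratios_in_R_region) (rule h4)
  qed
  then show ?thesis
    by (rule Lim_in_closed_set[OF closed_R_region _ sequentially_bot lim_xy])
qed

section \<open>Step kernels\<close>

text \<open>The cell of \<open>a\<close> when \<open>[0, 1]\<close> is cut into \<open>N\<close>
  equal cells. The minimum puts \<open>a = 1\<close> into the last cell and, for
  \<open>N \<ge> 1\<close>, keeps the index below \<open>N\<close> for every real
  \<open>a\<close>.\<close>

definition step_index :: "nat \<Rightarrow> real \<Rightarrow> nat" where
  "step_index N a = min (N - 1) (nat \<lfloor>real N * a\<rfloor>)"

lemma measurable_step_index: "step_index N \<in> borel \<rightarrow>\<^sub>M count_space UNIV"
  unfolding step_index_def by measurable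

text \<open>A cell lies between an open and a closed interval of length \<open>1 / N\<close>, so it
  is irrelevant which endpoints it contains.\<close>

lemma integral_step_index:
  assumes i: "i < N"
  shows "(\<integral>a. of_bool (step_index N a = i) \<partial>unit_lborel) = 1 / real N"
    and "integrable unit_lborel (\<lambda>a. of_bool (step_index N a = i) :: real)"
proof -
  have N: "real N > 0" using i by simp
  have [measurable]: "step_index N \<in> unit_lborel \<rightarrow>\<^sub>M count_space UNIV"
    using measurable_step_index by (intro measurable_restrict_space1) simp
  have m: "(\<lambda>a. of_bool (step_index N a = i) :: real) \<in> borel_measurable unit_lborel" by measurable
  show "integrable unit_lborel (\<lambda>a. of_bool (step_index N a = i) :: real)"
    by (rule unit_product.M.integrable_const_bound[where B = 1]) (use m in auto)
  let ?A = "{a \<in> {0..1}. step_index N a = i}"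
  let ?l = "real i / real N" and ?u = "(real i + 1) / real N"
  have "{a \<in> space unit_lborel. step_index N a = i} \<in> sets unit_lborel" by measurable
  then have A: "?A \<in> sets lborel"
    by (auto simp: sets_restrict_space_iff space_restrict_space)
  have lu: "0 \<le> ?l" "?u \<le> 1" "?l \<le> ?u" "?u - ?l = 1 / real N"
    using i N by (auto simp: field_simps)
  have sub1: "{?l<..<?u} \<subseteq> ?A"
  proof
    fix a assume a: "a \<in> {?l<..<?u}"
    then have "real i \<le> real N * a" "real N * a < real i + 1" using N by (auto simp: field_simps)
    then have "\<lfloor>real N * a\<rfloor> = int i" by (intro floor_unique) auto
    moreover have "0 \<le> a" "a \<le> 1" using a lu unfolding greaterThanLessThan_iff by linarith+
    ultimately show "a \<in> ?A" using i by (auto simp: step_index_def)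
  qed
  have sub2: "?A \<subseteq> {?l..?u}"
  proof
    fix a assume a: "a \<in> ?A"
    have "real i \<le> real N * a \<and> real N * a \<le> real i + 1"
    proof (cases "a = 1")
      case True
      then have "i = N - 1" using a i by (auto simp: step_index_def)
      then show ?thesis using True i by auto
    next
      case False
      then have "0 \<le> real N * a" "real N * a < real N" using a N by auto
      then have f: "0 \<le> \<lfloor>real N * a\<rfloor>" "\<lfloor>real N * a\<rfloor> < int N" by (auto simp: floor_less_iff)
      then have "nat \<lfloor>real N * a\<rfloor> \<le> N - 1" by linarith
      then have "nat \<lfloor>real N * a\<rfloor> = i" using a by (simp add: step_index_def)
      then have "\<lfloor>real N * a\<rfloor> = int i" using f(1) by linarith
      then show ?thesis by linarith
    qed
    then show "a \<in> {?l..?u}" using N by (auto simp: field_simps)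
  qed
  have Icc: "{?l..?u} \<in> fmeasurable lborel"
    using fmeasurable_cbox[of ?l ?u] by simp
  have Af: "?A \<in> fmeasurable lborel" by (rule fmeasurableI2[OF Icc sub2 A])
  have "measure lborel {?l<..<?u} \<le> measure lborel ?A"
    by (rule measure_mono_fmeasurable[OF sub1 _ Af]) simp
  moreover have "measure lborel ?A \<le> measure lborel {?l..?u}"
    by (rule measure_mono_fmeasurable[OF sub2 A Icc])
  ultimately have "measure lborel ?A = 1 / real N" using lu by simp
  moreover have "(\<integral>a. of_bool (step_index N a = i) \<partial>unit_lborel) = measure unit_lborel ?A"
  proof -
    have "(\<integral>a. of_bool (step_index N a = i) \<partial>unit_lborel) = (\<integral>a. indicator ?A a \<partial>unit_lborel)"
      by (intro Bochner_Integration.integral_cong) (auto simp: space_restrict_space indicator_def)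
    also have "\<dots> = measure unit_lborel (?A \<inter> space unit_lborel)" by simp
    finally show ?thesis by (simp add: space_restrict_space Int_absorb2 subset_eq)
  qed
  moreover have "measure unit_lborel ?A = measure lborel ?A"
    by (rule measure_restrict_space) auto
  ultimately show "(\<integral>a. of_bool (step_index N a = i) \<partial>unit_lborel) = 1 / real N" by simp
qed

definition step_kernel :: "nat \<Rightarrow> (nat \<Rightarrow> 'b) \<Rightarrow> ('b \<Rightarrow> 'b \<Rightarrow> real) \<Rightarrow> real \<times> real \<Rightarrow> real" where
  "step_kernel N h M = (\<lambda>z\<in>{0..1} \<times> {0..1}. M (h (step_index N (fst z))) (h (step_index N (snd z))))"

lemma borel_measurable_step:
  "(\<lambda>z. M (h (step_index N (fst z))) (h (step_index N (snd z))) :: real) \<in> borel_measurable (borel :: (real \<times> real) measure)"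
proof -
  have "(\<lambda>z. (step_index N (fst z), step_index N (snd z))) \<in> (borel \<Otimes>\<^sub>M borel) \<rightarrow>\<^sub>M (count_space UNIV \<Otimes>\<^sub>M count_space UNIV)"
    by (intro measurable_Pair measurable_compose[OF measurable_fst measurable_step_index]
        measurable_compose[OF measurable_snd measurable_step_index])
  then have "(\<lambda>z. (step_index N (fst z), step_index N (snd z))) \<in> (borel :: (real \<times> real) measure) \<rightarrow>\<^sub>M count_space UNIV"
    by (simp add: borel_prod pair_measure_countable)
  from measurable_compose[OF this, of "\<lambda>(i, j). M (h i) (h j)" borel] show ?thesis by simp
qed

lemma graph_kernel_step_kernel:
  assumes sym: "\<forall>a b. M a b = M b a" and B: "\<And>a b. \<bar>M a b\<bar> \<le> B"
  shows "graph_kernel (step_kernel N h M)"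
  unfolding graph_kernel_def
proof (intro conjI ballI)
  let ?S = "{0..1::real} \<times> {0..1::real}"
  show "step_kernel N h M \<in> extensional ?S" by (simp add: step_kernel_def)
  show "bounded (step_kernel N h M ` ?S)"
    using B by (auto simp: bounded_iff step_kernel_def intro!: exI[of _ B])
  show "step_kernel N h M (x, y) = step_kernel N h M (y, x)" if "x \<in> {0..1}" "y \<in> {0..1}" for x y
    using that sym[rule_format, of "h (step_index N x)" "h (step_index N y)"] by (simp add: step_kernel_def)
  have "(\<lambda>z. M (h (step_index N (fst z))) (h (step_index N (snd z)))) \<in> borel_measurable (lebesgue_on ?S)"
    by (intro measurable_restrict_space1 measurable_completion) (simp add: borel_measurable_step)
  then show "step_kernel N h M \<in> borel_measurable (lebesgue_on ?S)"
    by (rule measurable_cong[THEN iffD1, rotated]) (auto simp: step_kernel_def space_restrict_space)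
qed

text \<open>The cells cut the cube into boxes of equal volume, one for each map
  \<open>\<phi>\<close>. Several vertices may fall into one cell, so non-injective maps and the
  diagonal of \<open>M\<close> count as well.\<close>

lemma hom_density_step_kernel:
  fixes H :: "'a graph" and M :: "'b \<Rightarrow> 'b \<Rightarrow> real"
  assumes sym: "\<forall>a b. M a b = M b a" and B: "\<And>a b. \<bar>M a b\<bar> \<le> B"
    and h: "bij_betw h {..<N} X" and N: "N \<ge> 1" and H: "finite_simple_graph H"
  shows "hom_density H (step_kernel N h M) = hom_sum H X M / real N ^ card (fst H)"
proof -
  let ?V = "fst H" and ?g = "\<lambda>a. h (step_index N a)"
  let ?F = "?V \<rightarrow>\<^sub>E X"
  have V: "finite ?V" using H by (simp add: finite_simple_graph_def)
  have X: "finite X" using h bij_betw_finite by blast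
  have gX: "?g a \<in> X" for a
    using h N by (auto simp: bij_betw_def step_index_def)
  have "hom_density H (step_kernel N h M) = hom_int H (\<lambda>z. M (?g (fst z)) (?g (snd z)))"
    by (rule hom_density_eq_hom_int[OF graph_kernel_step_kernel[OF sym B] H borel_measurable_step, where N = "{}"])
      (use sym in \<open>auto simp: step_kernel_def\<close>)
  also have "\<dots> = (\<integral>x. hom_weight H M (\<lambda>v. ?g (x v)) \<partial>Pi\<^sub>M ?V (\<lambda>_. unit_lborel))"
    by (simp add: hom_int_def hom_weight_def edge_ev_comp[of M "?g", symmetric])
  also have "\<dots> = (\<integral>x. (\<Sum>\<phi>\<in>?F. hom_weight H M \<phi> * (\<Prod>v\<in>?V. of_bool (?g (x v) = \<phi> v))) \<partial>Pi\<^sub>M ?V (\<lambda>_. unit_lborel))"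
  proof (rule Bochner_Integration.integral_cong[OF refl])
    fix x :: "'a \<Rightarrow> real"
    let ?\<phi> = "\<lambda>v\<in>?V. ?g (x v)"
    have "(\<Sum>\<phi>\<in>?F. hom_weight H M \<phi> * (\<Prod>v\<in>?V. of_bool (?g (x v) = \<phi> v)))
        = (\<Sum>\<phi>\<in>{?\<phi>}. hom_weight H M \<phi> * (\<Prod>v\<in>?V. of_bool (?g (x v) = \<phi> v)))"
    proof (rule sum.mono_neutral_right)
      show "finite ?F" using V X by (auto intro: finite_PiE)
      show "{?\<phi>} \<subseteq> ?F" using gX by auto
      show "\<forall>\<phi>\<in>?F - {?\<phi>}. hom_weight H M \<phi> * (\<Prod>v\<in>?V. of_bool (?g (x v) = \<phi> v)) = 0"
      proof
        fix \<phi> assume \<phi>: "\<phi> \<in> ?F - {?\<phi>}"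
        have "\<exists>v\<in>?V. ?g (x v) \<noteq> \<phi> v"
        proof (rule ccontr)
          assume "\<not> ?thesis"
          then have "\<phi> = ?\<phi>" using \<phi> by (intro ext) (auto simp: PiE_def extensional_def)
          then show False using \<phi> by simp
        qed
        then show "hom_weight H M \<phi> * (\<Prod>v\<in>?V. of_bool (?g (x v) = \<phi> v)) = 0"
          unfolding of_bool_prod[OF V] by auto
      qed
    qed
    also have "\<dots> = hom_weight H M (\<lambda>v. ?g (x v))"
      by (simp add: of_bool_prod[OF V]) (rule hom_weight_cong[OF sym H], simp)
    finally show "hom_weight H M (\<lambda>v. ?g (x v))
        = (\<Sum>\<phi>\<in>?F. hom_weight H M \<phi> * (\<Prod>v\<in>?V. of_bool (?g (x v) = \<phi> v)))" by simp
  qed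
  also have "\<dots> = (\<Sum>\<phi>\<in>?F. hom_weight H M \<phi> * (1 / real N) ^ card ?V)"
  proof -
    have one: "(\<integral>a. of_bool (?g a = b) \<partial>unit_lborel) = 1 / real N"
        "integrable unit_lborel (\<lambda>a. of_bool (?g a = b) :: real)" if "b \<in> X" for b
    proof -
      obtain i where i: "i < N" "h i = b" using h \<open>b \<in> X\<close> by (auto simp: bij_betw_def)
      have "?g a = b \<longleftrightarrow> step_index N a = i" for a
        using h i N by (auto simp: bij_betw_def inj_on_def step_index_def)
      then show "(\<integral>a. of_bool (?g a = b) \<partial>unit_lborel) = 1 / real N"
        "integrable unit_lborel (\<lambda>a. of_bool (?g a = b) :: real)"
        using integral_step_index[OF i(1)] by simp_all
    qed
    have fX: "\<phi> v \<in> X" if "\<phi> \<in> ?F" "v \<in> ?V" for \<phi> v using that by auto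
    have int: "integrable (Pi\<^sub>M ?V (\<lambda>_. unit_lborel)) (\<lambda>x. hom_weight H M \<phi> * (\<Prod>v\<in>?V. of_bool (?g (x v) = \<phi> v)))"
      if "\<phi> \<in> ?F" for \<phi>
      by (intro integrable_mult_right unit_product.product_integrable_prod V one fX[OF that])
    have "(\<integral>x. (\<Prod>v\<in>?V. of_bool (?g (x v) = \<phi> v)) \<partial>Pi\<^sub>M ?V (\<lambda>_. unit_lborel)) = (1 / real N) ^ card ?V"
      if "\<phi> \<in> ?F" for \<phi>
      by (subst unit_product.product_integral_prod[OF V]) (use one fX[OF that] in auto)
    then show ?thesis
      by (subst Bochner_Integration.integral_sum[OF int]) simp_all
  qed
  also have "\<dots> = hom_sum H X M / real N ^ card ?V"
    unfolding hom_sum_def sum_divide_distrib by (simp add: power_one_over)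
  finally show ?thesis .
qed

text \<open>Serves to exclude the zero kernel when a kernel with values in \<open>{0, 1}\<close>
  must be shown to take both of them.\<close>

lemma hom_density_zero_kernel:
  fixes H :: "'a graph"
  assumes W: "graph_kernel W" and H: "finite_simple_graph H" and E: "snd H \<noteq> {}"
    and zero: "\<And>x y. x \<in> {0..1} \<Longrightarrow> y \<in> {0..1} \<Longrightarrow> W (x, y) = 0"
  shows "hom_density H W = 0"
proof -
  have "hom_density H W = hom_int H (\<lambda>_. 0)"
    by (rule hom_density_eq_hom_int[OF W H, where N = "{}"]) (use zero in auto)
  moreover have "hom_weight H (\<lambda>_ _. 0) x = 0" for x :: "'a \<Rightarrow> real"
  proof -
    obtain e where e: "e \<in> snd H" using E by blast
    then obtain i j where "e = {i, j}" using H by (auto simp: finite_simple_graph_def card_2_iff)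
    then have "edge_ev (\<lambda>_ _. 0) x e = 0" by (simp add: edge_ev_doubleton)
    then show ?thesis
      unfolding hom_weight_def using e finite_snd_simple_graph[OF H] by (intro prod_zero) auto
  qed
  ultimately show ?thesis by (simp add: hom_int_def)
qed

section \<open>Block matrices\<close>

text \<open>All blocks are padded to a common length: in block \<open>j\<close> only the first
  \<open>s j\<close> indices are in use, the others being isolated vertices. This allows blocks of
  different sizes over a product index set.\<close>

definition block_matrix :: "('j \<Rightarrow> nat) \<Rightarrow> ('j \<Rightarrow> real) \<Rightarrow> 'j \<times> nat \<Rightarrow> 'j \<times> nat \<Rightarrow> real" where
  "block_matrix s p x y =
    (if fst x = fst y \<and> snd x < s (fst x) \<and> snd y < s (fst y) then p (fst x) else 0)"

lemma block_matrix_sym: "\<forall>x y. block_matrix s p x y = block_matrix s p y x"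
  by (auto simp: block_matrix_def)

text \<open>A nonzero term keeps all \<open>q - 2\<close> further vertices in the block of
  \<open>x\<close> and \<open>y\<close>: there are \<open>s j ^ (q - 2)\<close> placements, each
  with a factor \<open>p j\<close> for every edge of the clique.\<close>

lemma clique_kernel_block_matrix:
  assumes J: "finite J" and s: "\<And>j. j \<in> J \<Longrightarrow> s j \<le> L" and q: "q \<ge> 2"
    and x: "x \<in> J \<times> {..<L}" and y: "y \<in> J \<times> {..<L}"
  shows "clique_kernel q (J \<times> {..<L}) (block_matrix s p) x y
    = block_matrix s (\<lambda>j. real (s j) ^ (q - 2) * p j ^ (q choose 2)) x y"
proof (cases "fst x = fst y \<and> snd x < s (fst x) \<and> snd y < s (fst y)")
  case False
  then show ?thesis by (auto simp: clique_kernel_def block_matrix_def)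
next
  case True
  define j where "j = fst x"
  define k where "k = q - 2"
  let ?U = "block_matrix s p" and ?X = "J \<times> {..<L}" and ?B = "{j} \<times> {..<s j}"
  let ?f = "\<lambda>\<psi>. (\<Prod>e\<in>pairs_below k. edge_ev ?U \<psi> e) * (\<Prod>a<k. ?U (\<psi> a) x * ?U (\<psi> a) y)"
  have j: "j \<in> J" using x by (auto simp: j_def)
  have Ux: "?U z x = (if z \<in> ?B then p j else 0)" "?U z y = (if z \<in> ?B then p j else 0)" for z
    using True by (cases z; auto simp: block_matrix_def j_def)+
  have "(\<Sum>\<psi>\<in>{..<k} \<rightarrow>\<^sub>E ?X. ?f \<psi>) = (\<Sum>\<psi>\<in>{..<k} \<rightarrow>\<^sub>E ?B. ?f \<psi>)"
  proof (rule sum.mono_neutral_right)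
    show "finite ({..<k} \<rightarrow>\<^sub>E ?X)" using J by (auto intro: finite_PiE)
    show "{..<k} \<rightarrow>\<^sub>E ?B \<subseteq> {..<k} \<rightarrow>\<^sub>E ?X" using s[OF j] j by (intro PiE_mono) auto
    show "\<forall>\<psi>\<in>({..<k} \<rightarrow>\<^sub>E ?X) - ({..<k} \<rightarrow>\<^sub>E ?B). ?f \<psi> = 0"
    proof
      fix \<psi> assume "\<psi> \<in> ({..<k} \<rightarrow>\<^sub>E ?X) - ({..<k} \<rightarrow>\<^sub>E ?B)"
      then obtain a where a: "a < k" "\<psi> a \<notin> ?B" by (auto simp: PiE_iff)
      then have "(\<Prod>a<k. ?U (\<psi> a) x * ?U (\<psi> a) y) = 0"
        by (intro prod_zero) (auto simp: Ux)
      then show "?f \<psi> = 0" by simp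
    qed
  qed
  also have "\<dots> = (\<Sum>\<psi>\<in>{..<k} \<rightarrow>\<^sub>E ?B. p j ^ (k choose 2) * (p j * p j) ^ k)"
  proof (intro sum.cong refl)
    fix \<psi> assume \<psi>: "\<psi> \<in> {..<k} \<rightarrow>\<^sub>E ?B"
    have B: "\<psi> a \<in> ?B" if "a < k" for a using \<psi> that by auto
    have "edge_ev ?U \<psi> e = p j" if "e \<in> pairs_below k" for e
    proof -
      from that obtain a b where e: "e = {a, b}" "a < k" "b < k" by (auto simp: pairs_below_def card_2_iff)
      have "fst (\<psi> a) = j" "snd (\<psi> a) < s j" "fst (\<psi> b) = j" "snd (\<psi> b) < s j"
        using B[OF e(2)] B[OF e(3)] by auto
      then show ?thesis unfolding e(1) edge_ev_doubleton[OF block_matrix_sym] by (simp add: block_matrix_def)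
    qed
    then have "(\<Prod>e\<in>pairs_below k. edge_ev ?U \<psi> e) = p j ^ (k choose 2)"
      by (simp add: card_pairs_below)
    moreover have "(\<Prod>a<k. ?U (\<psi> a) x * ?U (\<psi> a) y) = (\<Prod>a<k. p j * p j)"
      using B by (intro prod.cong refl) (simp only: Ux lessThan_iff if_True)
    ultimately show "?f \<psi> = p j ^ (k choose 2) * (p j * p j) ^ k" by simp
  qed
  also have "\<dots> = real (s j) ^ k * (p j ^ (k choose 2) * (p j * p j) ^ k)"
    by (simp add: card_PiE card_cartesian_product)
  finally have sum: "(\<Sum>\<psi>\<in>{..<k} \<rightarrow>\<^sub>E ?X. ?f \<psi>) = real (s j) ^ k * (p j ^ (k choose 2) * (p j * p j) ^ k)" .
  have "q = Suc (Suc k)" using q by (simp add: k_def)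
  \<comment> \<open>Edges of the \<open>q\<close>-clique: the one joining \<open>x\<close> and
    \<open>y\<close>, those among the \<open>k\<close> new vertices, and two from each new
    vertex.\<close>
  then have "q choose 2 = Suc ((k choose 2) + 2 * k)" by (simp add: numeral_2_eq_2)
  then have "p j ^ (q choose 2) = p j * (p j ^ (k choose 2) * (p j * p j) ^ k)"
    by (simp add: power_add power_mult power2_eq_square)
  moreover have "block_matrix s f x y = f j" for f
    using True by (cases x; cases y) (simp add: block_matrix_def j_def)
  ultimately show ?thesis
    unfolding clique_kernel_def k_def[symmetric] sum by simp
qed

text \<open>The powers start at \<open>Suc n\<close> since the zeroth one is the identity and not of
  block form; each further step sums over the indices in use.\<close>

lemma walk_weight_block_matrix:
  assumes J: "finite J" and s: "\<And>j. j \<in> J \<Longrightarrow> s j \<le> L"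
    and x: "x \<in> J \<times> {..<L}" and y: "y \<in> J \<times> {..<L}"
    and A: "\<And>x y. x \<in> J \<times> {..<L} \<Longrightarrow> y \<in> J \<times> {..<L} \<Longrightarrow> A x y = block_matrix s c x y"
  shows "walk_weight (J \<times> {..<L}) A (Suc n) x y = block_matrix s (\<lambda>j. c j ^ Suc n * real (s j) ^ n) x y"
  using y
proof (induction n arbitrary: y)
  case 0
  have "walk_weight (J \<times> {..<L}) A (Suc 0) x y = (\<Sum>z\<in>J \<times> {..<L}. if z = x then A z y else 0)"
    by (auto intro!: sum.cong)
  also have "\<dots> = A x y" using x J by simp
  finally show ?case using A[OF x 0] by (simp add: block_matrix_def)
next
  case (Suc n)
  let ?X = "J \<times> {..<L}"
  let ?w = "\<lambda>z. block_matrix s (\<lambda>j. c j ^ Suc n * real (s j) ^ n) x z * block_matrix s c z y"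
  have "walk_weight ?X A (Suc (Suc n)) x y = (\<Sum>z\<in>?X. ?w z)"
    unfolding walk_weight.simps(2)[of ?X A "Suc n"] using Suc.IH A Suc.prems by (intro sum.cong refl) simp
  also have "\<dots> = (\<Sum>z\<in>{fst x} \<times> {..<s (fst x)}. ?w z)"
  proof (rule sum.mono_neutral_right)
    show "finite ?X" using J by simp
    have "s (fst x) \<le> L" using x s by (cases x) auto
    then show "{fst x} \<times> {..<s (fst x)} \<subseteq> ?X" using x by (cases x) auto
    show "\<forall>z\<in>?X - {fst x} \<times> {..<s (fst x)}. ?w z = 0"
    proof
      fix z assume "z \<in> ?X - {fst x} \<times> {..<s (fst x)}"
      then have "\<not> (fst x = fst z \<and> snd z < s (fst z))" by (cases z) auto
      then show "?w z = 0" by (auto simp: block_matrix_def)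
    qed
  qed
  also have "\<dots> = (\<Sum>z\<in>{fst x} \<times> {..<s (fst x)}.
      block_matrix s (\<lambda>j. c j ^ Suc (Suc n) * real (s j) ^ n) x y)"
    by (intro sum.cong refl) (auto simp: block_matrix_def)
  also have "\<dots> = block_matrix s (\<lambda>j. c j ^ Suc (Suc n) * real (s j) ^ Suc n) x y"
    by (cases x; cases y) (auto simp: card_cartesian_product block_matrix_def)
  finally show ?case .
qed

text \<open>Each block of the clique kernel is a constant matrix of rank at most one, whose
  eigenvalue is its size times its entry; the trace adds the \<open>c\<close>-th powers of
  these.\<close>

lemma hom_sum_necklace_block_matrix:
  assumes J: "finite J" and s: "\<And>j. j \<in> J \<Longrightarrow> s j \<le> L" and q: "q \<ge> 2" and c: "c \<ge> 3"
  shows "hom_sum (necklace c q) (J \<times> {..<L}) (block_matrix s p)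
    = (\<Sum>j\<in>J. (real (s j) ^ (q - 1) * p j ^ (q choose 2)) ^ c)"
proof -
  let ?X = "J \<times> {..<L}"
  let ?d = "\<lambda>j. real (s j) ^ (q - 2) * p j ^ (q choose 2)"
  have X: "finite ?X" using J by simp
  obtain n where n: "c = Suc n" using c by (cases c) auto
  have "hom_sum (necklace c q) ?X (block_matrix s p)
      = (\<Sum>x\<in>?X. walk_weight ?X (clique_kernel q ?X (block_matrix s p)) c x x)"
    unfolding hom_sum_necklace[OF block_matrix_sym c X] using c X by (intro sum_closed_walks) auto
  also have "\<dots> = (\<Sum>x\<in>?X. block_matrix s (\<lambda>j. ?d j ^ Suc n * real (s j) ^ n) x x)"
    unfolding n using clique_kernel_block_matrix[OF J s q]
    by (intro sum.cong refl walk_weight_block_matrix[OF J s]) auto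
  also have "\<dots> = (\<Sum>j\<in>J. \<Sum>k<L. if k < s j then ?d j ^ Suc n * real (s j) ^ n else 0)"
    unfolding sum.cartesian_product by (intro sum.cong refl) (simp add: split_beta block_matrix_def)
  also have "\<dots> = (\<Sum>j\<in>J. (real (s j) ^ (q - 1) * p j ^ (q choose 2)) ^ c)"
  proof (intro sum.cong refl)
    fix j assume "j \<in> J"
    have "q - 1 = Suc (q - 2)" using q by simp
    then have d: "real (s j) ^ (q - 1) * p j ^ (q choose 2) = real (s j) * ?d j" by simp
    have "{..<L} \<inter> {k. k < s j} = {..<s j}" using s[OF \<open>j \<in> J\<close>] by auto
    then have "(\<Sum>k<L. if k < s j then ?d j ^ Suc n * real (s j) ^ n else 0)
        = real (s j) * (?d j ^ Suc n * real (s j) ^ n)"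
      by (simp add: sum.If_cases)
    also have "\<dots> = (real (s j) * ?d j) ^ Suc n" by (simp add: power_mult_distrib)
    finally show "(\<Sum>k<L. if k < s j then ?d j ^ Suc n * real (s j) ^ n else 0)
        = (real (s j) ^ (q - 1) * p j ^ (q choose 2)) ^ c" unfolding d n .
  qed
  finally show ?thesis .
qed

section \<open>Block sizes and densities that let one family dominate\<close>

text \<open>Since \<open>2 * (q choose 2) = q * (q - 1)\<close>, the left side is
  \<open>q - 1\<close> times \<open>r\<^sup>2 + 2 * (l - r) * q\<close>; then the square in
  \<open>r\<close> is completed. Under truncated subtraction, \<open>(q - r) + (r - q)\<close> is
  the distance of \<open>q\<close> and \<open>r\<close>.\<close>

lemma power_exponent_identity:
  fixes q r l :: nat
  assumes "q \<ge> 1" "q \<le> l" "r \<le> l"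
  shows "r\<^sup>2 * (q - 1) + 4 * (l - r) * (q choose 2) = (q - 1) * ((q - r) + (r - q))\<^sup>2 + (q - 1) * ((2 * l - q) * q)"
proof -
  define a b D E where "a = l - r" and "b = q - 1" and "D = ((q - r) + (r - q))\<^sup>2" and "E = (2 * l - q) * q"
  have two: "2 * (q choose 2) = q * b"
    unfolding choose_two b_def by (rule dvd_mult_div_cancel) (cases q; simp)
  have D: "int D = (int q - int r)\<^sup>2"
    by (cases "q \<le> r") (auto simp: D_def of_nat_diff power2_commute)
  have "int (r\<^sup>2 + 2 * a * q) = (int r)\<^sup>2 + 2 * (int l - int r) * int q"
    using assms by (simp add: a_def of_nat_diff)
  also have "\<dots> = (int q - int r)\<^sup>2 + (2 * int l - int q) * int q"
    by (simp add: algebra_simps power2_eq_square)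
  also have "\<dots> = int (D + E)"
    using assms by (simp add: D E_def of_nat_diff)
  finally have "r\<^sup>2 + 2 * a * q = D + E" by (simp only: of_nat_eq_iff)
  moreover have "r\<^sup>2 * b + 4 * a * (q choose 2) = r\<^sup>2 * b + 2 * a * (2 * (q choose 2))" by simp
  then have "r\<^sup>2 * b + 4 * a * (q choose 2) = b * (r\<^sup>2 + 2 * a * q)"
    unfolding two by (simp add: algebra_simps)
  ultimately have "r\<^sup>2 * b + 4 * a * (q choose 2) = b * D + b * E" by (simp add: distrib_left)
  then show ?thesis by (simp only: a_def b_def D_def E_def)
qed

text \<open>The block with index \<open>(r, k)\<close> has relative size \<open>\<epsilon>\<^bsup>r\<^sup>2\<^esup>\<close> and edge density \<open>\<epsilon>\<^bsup>4 (l - r)\<^esup>\<close>, \<open>\<epsilon> = 1 / m\<close>.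
  The resulting exponent of \<open>\<epsilon>\<close> in its \<open>q\<close>-clique eigenvalue is, up to a term independent of \<open>r\<close>,
  \<open>(q - 1) (q - r)\<^sup>2\<close>: for every \<open>q\<close> exactly the \<open>n q\<close> blocks with \<open>r = q\<close> dominate.\<close>

definition block_sum :: "(nat \<Rightarrow> nat) \<Rightarrow> nat \<Rightarrow> nat \<Rightarrow> nat \<Rightarrow> real \<Rightarrow> real" where
  "block_sum n l c q e = (\<Sum>r\<in>{2..l}. real (n r) * e ^ (c * ((q - 1) * ((q - r) + (r - q))\<^sup>2)))"

text \<open>Multiplying the relative sizes by \<open>m ^ l\<^sup>2\<close> makes them integers. The
  factor \<open>Suc i\<close> is a blow-up that leaves the densities unchanged while the number of
  vertices grows, as rounding requires.\<close>

lemma block_matrix_density: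
  fixes n :: "nat \<Rightarrow> nat" and l m i :: nat
  assumes m: "m \<ge> 1" and q: "q \<in> {2..l}" and c: "c \<ge> 3"
  defines "J \<equiv> SIGMA r:{2..l}. {..<n r}"
    and "s \<equiv> \<lambda>j :: nat \<times> nat. m ^ (l\<^sup>2 - (fst j)\<^sup>2) * Suc i"
    and "p \<equiv> \<lambda>j :: nat \<times> nat. (1 / real m) ^ (4 * (l - fst j))"
    and "L \<equiv> m ^ l\<^sup>2 * Suc i"
  assumes b: "card J \<ge> 1"
  shows "hom_sum (necklace c q) (J \<times> {..<L}) (block_matrix s p) / real (card J * L) ^ (c * (q - 1))
    = ((1 / real (card J)) ^ (q - 1) * (1 / real m) ^ ((q - 1) * ((2 * l - q) * q))) ^ c * block_sum n l c q (1 / real m)"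
proof -
  define e where "e = 1 / real m"
  define N where "N = real (card J * L)"
  define a where "a = (1 / real (card J)) ^ (q - 1) * e ^ ((q - 1) * ((2 * l - q) * q))"
  have J: "finite J" by (simp add: J_def)
  have mp: "real m > 0" using m by simp
  have N: "N > 0" unfolding N_def of_nat_0_less_iff using b m by (simp add: L_def)
  have sL: "s j \<le> L" if "j \<in> J" for j
    unfolding s_def L_def using m by (intro mult_le_mono1 power_increasing) auto
  have w: "real (s j) ^ (q - 1) * p j ^ (q choose 2) / N ^ (q - 1) = a * e ^ ((q - 1) * ((q - fst j) + (fst j - q))\<^sup>2)"
    if j: "j \<in> J" for j
  proof -
    have r: "fst j \<le> l" using j by (auto simp: J_def)
    have "(fst j)\<^sup>2 \<le> l\<^sup>2" using r by (rule power_mono) simp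
    then have "real m ^ (l\<^sup>2 - (fst j)\<^sup>2) = real m ^ l\<^sup>2 * e ^ (fst j)\<^sup>2"
      using mp by (simp add: e_def power_diff power_one_over)
    then have "real (s j) = e ^ (fst j)\<^sup>2 * (real m ^ l\<^sup>2 * real (Suc i))"
      unfolding s_def of_nat_mult of_nat_power by (simp del: of_nat_Suc)
    moreover have "N = real (card J) * (real m ^ l\<^sup>2 * real (Suc i))"
      by (simp only: N_def L_def of_nat_mult of_nat_power)
    moreover have "real m ^ l\<^sup>2 * real (Suc i) \<noteq> 0" using mp by (simp del: of_nat_Suc)
    ultimately have "real (s j) / N = e ^ (fst j)\<^sup>2 * (1 / real (card J))" by (simp del: of_nat_Suc)
    then have "(real (s j) / N) ^ (q - 1) * p j ^ (q choose 2)
        = (e ^ (fst j)\<^sup>2 * (1 / real (card J))) ^ (q - 1) * (e ^ (4 * (l - fst j))) ^ (q choose 2)"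
      by (simp only: p_def e_def)
    also have "\<dots> = (1 / real (card J)) ^ (q - 1) * e ^ ((fst j)\<^sup>2 * (q - 1) + 4 * (l - fst j) * (q choose 2))"
      by (simp only: power_mult_distrib power_add power_mult) (simp only: mult_ac)
    also have "(fst j)\<^sup>2 * (q - 1) + 4 * (l - fst j) * (q choose 2)
        = (q - 1) * ((q - fst j) + (fst j - q))\<^sup>2 + (q - 1) * ((2 * l - q) * q)"
      by (rule power_exponent_identity) (use q r in auto)
    finally show ?thesis by (simp add: a_def power_add power_divide)
  qed
  have "hom_sum (necklace c q) (J \<times> {..<L}) (block_matrix s p) / N ^ (c * (q - 1))
      = (\<Sum>j\<in>J. (real (s j) ^ (q - 1) * p j ^ (q choose 2) / N ^ (q - 1)) ^ c)"
    using q hom_sum_necklace_block_matrix[OF J sL _ c]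
    by (simp add: sum_divide_distrib power_divide mult.commute[of c] power_mult)
  also have "\<dots> = (\<Sum>j\<in>J. a ^ c * e ^ (c * ((q - 1) * ((q - fst j) + (fst j - q))\<^sup>2)))"
    by (intro sum.cong refl) (simp only: w power_mult_distrib power_mult mult.commute[of c])
  also have "\<dots> = a ^ c * (\<Sum>r\<in>{2..l}. \<Sum>k<n r. e ^ (c * ((q - 1) * ((q - r) + (r - q))\<^sup>2)))"
    unfolding J_def sum_distrib_left by (subst sum.Sigma) (simp_all add: split_beta)
  finally show ?thesis by (simp add: block_sum_def N_def a_def e_def)
qed

text \<open>Here \<open>m\<close> is fixed and only the blow-up \<open>i\<close> grows, so the
  rounding error tends to zero. The factor \<open>g q ^ c\<close> is of a form that cancels in the
  ratios, and the value at the origin is recorded to control the range.\<close>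

lemma zero_one_kernels_of_blocks:
  fixes n :: "nat \<Rightarrow> nat" and l m :: nat
  assumes l: "l \<ge> 2" and m: "m \<ge> 1" and n: "\<And>r. n r \<ge> 1"
  shows "\<exists>V :: nat \<Rightarrow> real \<times> real \<Rightarrow> real. \<exists>g :: nat \<Rightarrow> real.
    (\<forall>i. graph_kernel (V i) \<and> V i ` ({0..1} \<times> {0..1}) \<subseteq> {0, 1} \<and> V i (0, 0) = 0) \<and> (\<forall>q. g q > 0) \<and>
    (\<forall>q\<in>{2..l}. \<forall>c\<in>{4, 8, 12}.
      (\<lambda>i. hom_density (necklace c q) (V i)) \<longlonglongrightarrow> g q ^ c * block_sum n l c q (1 / real m))"
proof -
  define J where "J = (SIGMA r:{2..l}. {..<n r})"
  define s where "s i j = m ^ (l\<^sup>2 - (fst j)\<^sup>2) * Suc i" for i and j :: "nat \<times> nat"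
  define p where "p j = (1 / real m) ^ (4 * (l - fst j))" for j :: "nat \<times> nat"
  define L where "L i = m ^ l\<^sup>2 * Suc i" for i
  define g where "g q = (1 / real (card J)) ^ (q - 1) * (1 / real m) ^ ((q - 1) * ((2 * l - q) * q))" for q
  define X where "X i = J \<times> {..<L i}" for i
  define I where "I = {4, 8, 12 :: nat} \<times> {2..l}"
  define H where "H j = necklace (fst j) (snd j)" for j
  define C where "C = (\<Sum>j\<in>I. 3 * (real (card (fst (H j))))\<^sup>2)"
  have "(2, 0) \<in> J" using l n[of 2] by (auto simp: J_def)
  have J: "finite J" by (simp add: J_def)
  with \<open>(2, 0) \<in> J\<close> have b: "card J \<ge> 1" by (auto simp: Suc_le_eq card_gt_0_iff)
  have cX: "card (X i) = card J * L i" for i by (simp add: X_def card_cartesian_product)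
  have cX1: "card (X i) \<ge> Suc i" for i
  proof -
    have "1 * (1 * Suc i) \<le> card J * L i" unfolding L_def using b m by (intro mult_le_mono) auto
    then show ?thesis by (simp add: cX)
  qed
  have X: "finite (X i)" "X i \<noteq> {}" for i
  proof -
    show "finite (X i)" using J by (simp add: X_def)
    show "X i \<noteq> {}"
    proof
      assume "X i = {}"
      then show False using cX1[of i] by simp
    qed
  qed
  have fin: "finite_simple_graph (H j)" if "j \<in> I" for j
    unfolding H_def by (rule finite_simple_graph_necklace) (use that in \<open>auto simp: I_def\<close>)
  have p01: "0 \<le> block_matrix (s i) p x y" "block_matrix (s i) p x y \<le> 1" for i x y
    using m by (auto simp: block_matrix_def p_def power_le_one)
  have "\<forall>i. \<exists>M. (\<forall>a b. M a b = M b a) \<and> (\<forall>a b. M a b \<in> {0, 1}) \<and> (\<forall>a. M a a = 0) \<and>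
    (\<Sum>j\<in>I. ((hom_sum (H j) (X i) M - hom_sum (H j) (X i) (block_matrix (s i) p)) / real (card (X i)) ^ card (fst (H j)))\<^sup>2)
      \<le> C / real (card (X i))"
    unfolding C_def
    by (intro allI random_rounding fin block_matrix_sym p01 X) (simp add: I_def)
  from choice[OF this] obtain M where M: "\<forall>i. (\<forall>a b. M i a b = M i b a) \<and> (\<forall>a b. M i a b \<in> {0, 1}) \<and> (\<forall>a. M i a a = 0) \<and>
    (\<Sum>j\<in>I. ((hom_sum (H j) (X i) (M i) - hom_sum (H j) (X i) (block_matrix (s i) p)) / real (card (X i)) ^ card (fst (H j)))\<^sup>2)
      \<le> C / real (card (X i))"
    by (rule exE)
  note M1 = M[THEN spec, THEN conjunct1] and M' = M[THEN spec, THEN conjunct2]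
  note M2 = M'[THEN conjunct1, rule_format] and M3 = M'[THEN conjunct2, THEN conjunct1, rule_format]
    and M4 = M'[THEN conjunct2, THEN conjunct2]
  have "\<exists>h. bij_betw h {..<card (X i)} (X i)" for i
    using ex_bij_betw_nat_finite[OF X(1)] by (simp add: lessThan_atLeast0)
  then obtain h where h: "\<And>i. bij_betw (h i) {..<card (X i)} (X i)" by metis
  define V where "V i = step_kernel (card (X i)) (h i) (M i)" for i
  have MB: "\<bar>M i a b\<bar> \<le> 1" for i a b using M2[of i a b] by auto
  have V: "graph_kernel (V i)" "V i ` ({0..1} \<times> {0..1}) \<subseteq> {0, 1}" "V i (0, 0) = 0" for i
  proof -
    show "graph_kernel (V i)" unfolding V_def by (rule graph_kernel_step_kernel[OF M1 MB])
    show "V i ` ({0..1} \<times> {0..1}) \<subseteq> {0, 1}"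
      by (rule image_subsetI) (simp only: V_def step_kernel_def restrict_apply' M2)
    \<comment> \<open>Both coordinates lie in the same cell, and rounding leaves the diagonal of
      \<open>M i\<close> empty.\<close>
    show "V i (0, 0) = 0" by (simp add: V_def step_kernel_def M3)
  qed
  have lim: "(\<lambda>i. hom_density (H j) (V i)) \<longlonglongrightarrow> g (snd j) ^ fst j * block_sum n l (fst j) (snd j) (1 / real m)"
    if j: "j \<in> I" for j
  proof -
    define t where "t = g (snd j) ^ fst j * block_sum n l (fst j) (snd j) (1 / real m)"
    have cq: "fst j \<ge> 3" "snd j \<in> {2..l}" using j by (auto simp: I_def)
    have dens: "hom_density (H j) (V i) = hom_sum (H j) (X i) (M i) / real (card (X i)) ^ card (fst (H j))" for i
      unfolding V_def by (rule hom_density_step_kernel[OF M1 MB h _ fin[OF j]]) (use cX1[of i] in simp)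
    have "hom_sum (H j) (X i) (block_matrix (s i) p) / real (card (X i)) ^ card (fst (H j)) = t" for i
    proof -
      have "card (fst (H j)) = fst j * (snd j - 1)" unfolding H_def using cq by (intro card_necklace) auto
      then show ?thesis
        using block_matrix_density[OF m cq(2,1), of n i] b
        unfolding t_def g_def cX H_def X_def J_def s_def p_def L_def by simp
    qed
    then have d: "hom_density (H j) (V i) - t
        = (hom_sum (H j) (X i) (M i) - hom_sum (H j) (X i) (block_matrix (s i) p)) / real (card (X i)) ^ card (fst (H j))" for i
      unfolding dens diff_divide_distrib by simp
    have le: "(hom_density (H j) (V i) - t)\<^sup>2 \<le> C / real (Suc i)" for i
    proof -
      have "(hom_density (H j) (V i) - t)\<^sup>2 \<le> C / real (card (X i))"
        unfolding d by (rule order_trans[OF member_le_sum[OF j] M4]) (simp_all add: I_def)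
      also have "\<dots> \<le> C / real (Suc i)"
        by (intro divide_left_mono) (use cX1[of i] in \<open>auto simp: C_def intro!: sum_nonneg\<close>)
      finally show ?thesis .
    qed
    have "(\<lambda>i. (hom_density (H j) (V i) - t)\<^sup>2) \<longlonglongrightarrow> 0"
    proof (rule tendsto_sandwich[OF _ _ tendsto_const])
      show "(\<lambda>i. C / real (Suc i)) \<longlonglongrightarrow> 0" by (rule lim_const_over_n[THEN LIMSEQ_Suc])
    qed (use le in auto)
    then have "(\<lambda>i. sqrt ((hom_density (H j) (V i) - t)\<^sup>2)) \<longlonglongrightarrow> sqrt 0" by (rule tendsto_real_sqrt)
    then have "(\<lambda>i. hom_density (H j) (V i) - t) \<longlonglongrightarrow> 0" by (simp add: tendsto_rabs_zero_iff)
    then show ?thesis unfolding t_def[symmetric] by (simp only: LIM_zero_iff)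
  qed
  have gpos: "g q > 0" for q using b m by (simp add: g_def)
  show ?thesis
  proof (intro exI[of _ V] exI[of _ g] conjI allI ballI V gpos)
    fix q c assume "q \<in> {2..l}" "c \<in> {4, 8, 12 :: nat}"
    then show "(\<lambda>i. hom_density (necklace c q) (V i)) \<longlonglongrightarrow> g q ^ c * block_sum n l c q (1 / real m)"
      using lim[of "(c, q)"] by (simp add: I_def H_def)
  qed
qed

text \<open>As \<open>c\<close> and \<open>q - 1\<close> are positive, the exponent vanishes exactly
  at \<open>r = q\<close>, where \<open>0 ^ 0 = 1\<close> retains the multiplicity
  \<open>n q\<close>.\<close>

lemma tendsto_block_sum:
  assumes q: "q \<in> {2..l}" and c: "c \<ge> 1"
  shows "(\<lambda>m. block_sum n l c q (1 / real (Suc m))) \<longlonglongrightarrow> real (n q)"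
proof -
  let ?d = "\<lambda>r. c * ((q - 1) * ((q - r) + (r - q))\<^sup>2)"
  have e: "(\<lambda>m. 1 / real (Suc m)) \<longlonglongrightarrow> 0" by (rule lim_1_over_n[THEN LIMSEQ_Suc])
  have "(\<lambda>m. block_sum n l c q (1 / real (Suc m))) \<longlonglongrightarrow> (\<Sum>r\<in>{2..l}. real (n r) * 0 ^ ?d r)"
    unfolding block_sum_def by (intro tendsto_intros e)
  also have "(\<Sum>r\<in>{2..l}. real (n r) * 0 ^ ?d r) = (\<Sum>r\<in>{q}. real (n r) * 0 ^ ?d r)"
    by (rule sum.mono_neutral_right) (use q c in auto)
  finally show ?thesis by simp
qed

section \<open>Coordinates\<close>

text \<open>The divisions recover \<open>q\<close> from the odd position \<open>2 * q - 3\<close>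
  and from the even position \<open>2 * q - 2\<close>.\<close>

definition coords_vec :: "(nat \<Rightarrow> 'n::finite) \<Rightarrow> nat \<Rightarrow> (nat \<Rightarrow> real) \<Rightarrow> (nat \<Rightarrow> real) \<Rightarrow> real ^ 'n" where
  "coords_vec ix l f g = (\<chi> i. let k = inv_into {1..2 * l - 2} ix i in
    if odd k then f ((k + 3) div 2) else g ((k + 2) div 2))"

context
  fixes l :: nat and ix :: "nat \<Rightarrow> 'n::finite"
  assumes l: "l \<ge> 2" and ix: "bij_betw ix {1..2 * l - 2} (UNIV :: 'n set)"
begin

lemma coords_vec_nth:
  assumes "q \<in> {2..l}"
  shows "coords_vec ix l f g $ ix (2 * q - 3) = f q" "coords_vec ix l f g $ ix (2 * q - 2) = g q"
proof -
  have inv: "inv_into {1..2 * l - 2} ix (ix k) = k" if "k \<in> {1..2 * l - 2}" for k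
    using ix that by (simp add: bij_betw_def)
  have k: "2 * q - 3 \<in> {1..2 * l - 2}" "2 * q - 2 \<in> {1..2 * l - 2}" using assms l by auto
  have "odd (2 * q - 3)" "(2 * q - 3 + 3) div 2 = q" using assms by auto
  then show "coords_vec ix l f g $ ix (2 * q - 3) = f q"
    unfolding coords_vec_def vec_lambda_beta inv[OF k(1)] Let_def by simp
  have "even (2 * q - 2)" "(2 * q - 2 + 2) div 2 = q" using assms by auto
  then show "coords_vec ix l f g $ ix (2 * q - 2) = g q"
    unfolding coords_vec_def vec_lambda_beta inv[OF k(2)] Let_def by simp
qed

lemma coordinate_cases:
  obtains q where "q \<in> {2..l}" "i = ix (2 * q - 3)" | q where "q \<in> {2..l}" "i = ix (2 * q - 2)"
proof -
  have "i \<in> ix ` {1..2 * l - 2}" using ix by (simp add: bij_betw_def)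
  then obtain k where k: "k \<in> {1..2 * l - 2}" "i = ix k" by blast
  show thesis
  proof (cases "odd k")
    case True
    then obtain j where "k = 2 * j + 1" by (rule oddE)
    then show thesis using k by (intro that(1)[of "j + 2"]) auto
  next
    case False
    then obtain j where "k = 2 * j" by (auto elim: evenE)
    then show thesis using k by (intro that(2)[of "j + 1"]) auto
  qed
qed

lemma vec_eq_coordsI:
  fixes u v :: "real ^ 'n"
  assumes "\<And>q. q \<in> {2..l} \<Longrightarrow> u $ ix (2 * q - 3) = v $ ix (2 * q - 3)"
    and "\<And>q. q \<in> {2..l} \<Longrightarrow> u $ ix (2 * q - 2) = v $ ix (2 * q - 2)"
  shows "u = v"
proof (rule Finite_Cartesian_Product.vec_eq_iff[THEN iffD2, rule_format])
  fix i :: 'n show "u $ i = v $ i"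
    by (cases i rule: coordinate_cases) (use assms in auto)
qed

lemma tendsto_coords_vec:
  assumes "\<And>q. q \<in> {2..l} \<Longrightarrow> (\<lambda>i. f i q) \<longlonglongrightarrow> f' q"
    and "\<And>q. q \<in> {2..l} \<Longrightarrow> (\<lambda>i. g i q) \<longlonglongrightarrow> g' q"
  shows "(\<lambda>i. coords_vec ix l (f i) (g i)) \<longlonglongrightarrow> coords_vec ix l f' g'"
proof (rule vec_tendstoI)
  fix k :: 'n show "(\<lambda>i. coords_vec ix l (f i) (g i) $ k) \<longlonglongrightarrow> coords_vec ix l f' g' $ k"
    by (cases k rule: coordinate_cases) (use assms in \<open>simp_all add: coords_vec_nth\<close>)
qed

text \<open>Replacing a single coordinate pair is an affine operation, so convexity can be used in
  one factor at a time.\<close>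

lemma coords_vec_affine:
  assumes "u + v = (1::real)"
  shows "u *\<^sub>R coords_vec ix l (f(r := a)) (g(r := b)) + v *\<^sub>R coords_vec ix l (f(r := c)) (g(r := d))
    = coords_vec ix l (f(r := u * a + v * c)) (g(r := u * b + v * d))"
proof -
  have "u * z + v * z = z" for z :: real using assms by (simp flip: distrib_right)
  then show ?thesis by (intro vec_eq_coordsI) (simp_all add: coords_vec_nth)
qed

lemma coords_vec_eta: "coords_vec ix l (\<lambda>q. p $ ix (2 * q - 3)) (\<lambda>q. p $ ix (2 * q - 2)) = p"
  by (rule vec_eq_coordsI) (simp_all add: coords_vec_nth)

lemma convex_R_power: "convex (R_power ix l)"
proof (rule convexI)
  fix p p' :: "real ^ 'n" and u v :: real
  assume p: "p \<in> R_power ix l" "p' \<in> R_power ix l" and uv: "0 \<le> u" "0 \<le> v" "u + v = 1"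
  show "u *\<^sub>R p + v *\<^sub>R p' \<in> R_power ix l"
    unfolding R_power_def
  proof (intro CollectI ballI)
    fix q assume "q \<in> {2..l}"
    then have "u *\<^sub>R (p $ ix (2 * q - 3), p $ ix (2 * q - 2)) + v *\<^sub>R (p' $ ix (2 * q - 3), p' $ ix (2 * q - 2)) \<in> R_region"
      using p uv by (intro convexD[OF convex_R_region]) (auto simp: R_power_def)
    then show "((u *\<^sub>R p + v *\<^sub>R p') $ ix (2 * q - 3), (u *\<^sub>R p + v *\<^sub>R p') $ ix (2 * q - 2)) \<in> R_region"
      by simp
  qed
qed

lemma closed_R_power: "closed (R_power ix l)"
proof -
  have "closed {p :: real ^ 'n. (p $ ix (2 * q - 3), p $ ix (2 * q - 2)) \<in> R_region}" for q
    using continuous_closed_vimage[OF closed_R_region, of "\<lambda>p :: real ^ 'n. (p $ ix (2 * q - 3), p $ ix (2 * q - 2))"]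
    by (auto simp: vimage_def intro!: continuous_intros)
  moreover have "R_power ix l = (\<Inter>q\<in>{2..l}. {p. (p $ ix (2 * q - 3), p $ ix (2 * q - 2)) \<in> R_region})"
    by (auto simp: R_power_def)
  ultimately show ?thesis by (simp add: closed_INT)
qed

text \<open>The coordinate pairs are moved from the generators of \<open>R_region\<close> into \<open>R_region\<close> one at a time.\<close>

lemma R_power_subset_convex_hull:
  defines "G \<equiv> insert (0, 0) {(1 / real n, 1 / (real n)\<^sup>2) | n. n \<ge> 1}"
  shows "R_power ix l \<subseteq> convex hull {p. \<forall>q\<in>{2..l}. (p $ ix (2 * q - 3), p $ ix (2 * q - 2)) \<in> G}"
    (is "_ \<subseteq> convex hull ?E")
proof
  have R: "R_region = convex hull G" by (simp add: R_region_def G_def)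
  have *: "coords_vec ix l f g \<in> convex hull ?E"
    if "finite A" "\<And>q. q \<in> A \<Longrightarrow> (f q, g q) \<in> R_region" "\<And>q. q \<in> {2..l} - A \<Longrightarrow> (f q, g q) \<in> G" for A f g
    using that
  proof (induction A arbitrary: f g rule: finite_induct)
    case empty
    then have "coords_vec ix l f g \<in> ?E" by (simp add: coords_vec_nth)
    then show ?case by (rule hull_inc)
  next
    case (insert r A)
    \<comment> \<open>The points that may be inserted as the pair \<open>r\<close>: a convex set
      containing \<open>G\<close>, hence all of \<open>R_region\<close>.\<close>
    define S where "S = {z. coords_vec ix l (f(r := fst z)) (g(r := snd z)) \<in> convex hull ?E}"
    have "G \<subseteq> S"
    proof
      fix z assume z: "z \<in> G"
      have "coords_vec ix l (f(r := fst z)) (g(r := snd z)) \<in> convex hull ?E"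
      proof (rule insert.IH)
        show "((f(r := fst z)) q, (g(r := snd z)) q) \<in> R_region" if "q \<in> A" for q
          using that insert.hyps(2) insert.prems(1)[of q] by auto
        show "((f(r := fst z)) q, (g(r := snd z)) q) \<in> G" if "q \<in> {2..l} - A" for q
          using that z insert.prems(2)[of q] by auto
      qed
      then show "z \<in> S" by (simp add: S_def)
    qed
    moreover have "convex S"
    proof (rule convexI)
      fix z w :: "real \<times> real" and u v :: real
      assume zw: "z \<in> S" "w \<in> S" and uv: "0 \<le> u" "0 \<le> v" "u + v = 1"
      have "u *\<^sub>R coords_vec ix l (f(r := fst z)) (g(r := snd z)) + v *\<^sub>R coords_vec ix l (f(r := fst w)) (g(r := snd w))
          \<in> convex hull ?E"
        using zw uv by (intro convexD[OF convex_convex_hull]) (auto simp: S_def)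
      then show "u *\<^sub>R z + v *\<^sub>R w \<in> S" by (simp add: S_def coords_vec_affine[OF uv(3)])
    qed
    ultimately have "R_region \<subseteq> S" unfolding R by (rule hull_minimal)
    then have "(f r, g r) \<in> S" using insert.prems(1)[of r] by auto
    then show ?case by (simp add: S_def)
  qed
  fix p assume p: "p \<in> R_power ix l"
  have "coords_vec ix l (\<lambda>q. p $ ix (2 * q - 3)) (\<lambda>q. p $ ix (2 * q - 2)) \<in> convex hull ?E"
    by (rule *[of "{2..l}"]) (use p in \<open>auto simp: R_power_def\<close>)
  then show "p \<in> convex hull ?E" by (simp only: coords_vec_eta)
qed

text \<open>The origin is approached by uniform vectors with more and more entries, so a closed set
  only has to contain the points of actual multiplicities \<open>n q \<ge> 1\<close>; all pairs move
  to their limits simultaneously.\<close>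

lemma generators_subset_closure:
  assumes C: "closed C" and sub: "\<And>n :: nat \<Rightarrow> nat. (\<And>q. n q \<ge> 1) \<Longrightarrow>
      coords_vec ix l (\<lambda>q. 1 / real (n q)) (\<lambda>q. 1 / (real (n q))\<^sup>2) \<in> C"
    and p: "\<forall>q\<in>{2..l}. (p $ ix (2 * q - 3), p $ ix (2 * q - 2)) \<in>
      insert (0, 0) {(1 / real n, 1 / (real n)\<^sup>2) | n. n \<ge> 1}"
  shows "p \<in> C"
proof -
  have "\<exists>n :: nat \<Rightarrow> nat. (\<forall>k. n k \<ge> 1) \<and> (q \<in> {2..l} \<longrightarrow>
      (\<lambda>k. 1 / real (n k)) \<longlonglongrightarrow> p $ ix (2 * q - 3) \<and> (\<lambda>k. 1 / (real (n k))\<^sup>2) \<longlonglongrightarrow> p $ ix (2 * q - 2))" for q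
  proof (cases "q \<in> {2..l}")
    case True
    then consider "p $ ix (2 * q - 3) = 0" "p $ ix (2 * q - 2) = 0"
      | n where "n \<ge> 1" "p $ ix (2 * q - 3) = 1 / real n" "p $ ix (2 * q - 2) = 1 / (real n)\<^sup>2"
      using p by blast
    then show ?thesis
    proof cases
      case 1
      have "(\<lambda>k. 1 / real (Suc k)) \<longlonglongrightarrow> 0" by (rule lim_1_over_n[THEN LIMSEQ_Suc])
      moreover from tendsto_power[OF this, of 2] have "(\<lambda>k. 1 / (real (Suc k))\<^sup>2) \<longlonglongrightarrow> 0"
        by (simp only: power_one_over[symmetric] zero_power2)
      ultimately show ?thesis using 1 by (intro exI[of _ Suc]) simp
    next
      case 2
      then show ?thesis by (intro exI[of _ "\<lambda>_. n"]) simp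
    qed
  next
    case False
    then show ?thesis by (intro exI[of _ "\<lambda>_. 1"]) auto
  qed
  then obtain n :: "nat \<Rightarrow> nat \<Rightarrow> nat" where n: "\<And>q k. n q k \<ge> 1"
    "\<And>q. q \<in> {2..l} \<Longrightarrow> (\<lambda>k. 1 / real (n q k)) \<longlonglongrightarrow> p $ ix (2 * q - 3)"
    "\<And>q. q \<in> {2..l} \<Longrightarrow> (\<lambda>k. 1 / (real (n q k))\<^sup>2) \<longlonglongrightarrow> p $ ix (2 * q - 2)"
    by metis
  have "(\<lambda>k. coords_vec ix l (\<lambda>q. 1 / real (n q k)) (\<lambda>q. 1 / (real (n q k))\<^sup>2))
      \<longlonglongrightarrow> coords_vec ix l (\<lambda>q. p $ ix (2 * q - 3)) (\<lambda>q. p $ ix (2 * q - 2))"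
    by (rule tendsto_coords_vec) (rule n, assumption)+
  then show ?thesis
    unfolding coords_vec_eta by (rule closed_sequentially[OF C _, rotated]) (rule sub, rule n(1))
qed

end

section \<open>The two inclusions between the convex hull and the product region\<close>

theorem theorem1p3:
  fixes l :: nat
    and ix :: "nat \<Rightarrow> 'n::finite"
    and \<W> :: "(real \<times> real \<Rightarrow> real) set"
  assumes "l \<ge> 2"
    and "bij_betw ix {1..2 * l - 2} (UNIV :: 'n set)"
    and "\<W> \<subseteq> {W. graph_kernel W}"
    and "{W. graph_kernel W \<and> W ` ({0..1} \<times> {0..1}) = {0, 1}} \<subseteq> \<W>"
  shows "convex hull (D_region ix l \<W>) = R_power ix l"
proof (rule antisym)
  note l = assms(1) and ix = assms(2)
  let ?D0 = "{p :: real ^ 'n. \<exists>W\<in>\<W>. (\<forall>q\<in>{2..l}. hom_density (necklace 4 q) W \<noteq> 0) \<and>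
     (\<forall>q\<in>{2..l}. p $ ix (2 * q - 3) = necklace_x q W \<and> p $ ix (2 * q - 2) = necklace_y q W)}"
  \<comment> \<open>Each kernel satisfies the constraint in every pair, and the product region is
    closed and convex, so neither closure nor hull leaves it.\<close>
  have "?D0 \<subseteq> R_power ix l"
  proof
    fix p assume "p \<in> ?D0"
    then obtain W where W: "W \<in> \<W>" "\<forall>q\<in>{2..l}. hom_density (necklace 4 q) W \<noteq> 0"
      "\<forall>q\<in>{2..l}. p $ ix (2 * q - 3) = necklace_x q W \<and> p $ ix (2 * q - 2) = necklace_y q W" by blast
    have "graph_kernel W" using W(1) assms(3) by blast
    then show "p \<in> R_power ix l"
      using W(2,3) necklace_ratios_in_R_region by (simp add: R_power_def)
  qed
  then have "D_region ix l \<W> \<subseteq> R_power ix l"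
    unfolding D_region_def by (rule closure_minimal) (rule closed_R_power[OF l ix])
  then show "convex hull (D_region ix l \<W>) \<subseteq> R_power ix l"
    by (rule hull_minimal) (rule convex_R_power[OF l ix])
  have closed: "closed (D_region ix l \<W>)" unfolding D_region_def by (rule closed_closure)
  have in_D: "coords_vec ix l (\<lambda>q. 1 / real (n q)) (\<lambda>q. 1 / (real (n q))\<^sup>2) \<in> D_region ix l \<W>"
    if n: "\<And>r. n r \<ge> 1" for n :: "nat \<Rightarrow> nat"
  proof -
    let ?z = "\<lambda>c q m. block_sum n l c q (1 / real (Suc m))"
    have pos: "?z c q m > 0" if "q \<in> {2..l}" for c q m
      unfolding block_sum_def
      by (rule sum_pos2[OF _ that]) (use n[of q] in \<open>auto simp: Suc_le_eq\<close>)
    \<comment> \<open>For fixed \<open>m\<close> these ratios are limits over the kernels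
      \<open>V i\<close>; letting \<open>m\<close> tend to infinity afterwards isolates the
      multiplicities. Both limits stay in the closed set \<open>D_region\<close>.\<close>
    have step: "coords_vec ix l (\<lambda>q. ?z 8 q m / (?z 4 q m)\<^sup>2) (\<lambda>q. ?z 12 q m / ?z 4 q m ^ 3) \<in> D_region ix l \<W>" for m
    proof -
      obtain V g where V: "\<forall>i. graph_kernel (V i) \<and> V i ` ({0..1} \<times> {0..1}) \<subseteq> {0, 1} \<and> V i (0, 0) = 0"
        and g: "\<forall>q. g q > (0::real)"
        and lims: "\<forall>q\<in>{2..l}. \<forall>c\<in>{4, 8, 12}. (\<lambda>i. hom_density (necklace c q) (V i)) \<longlonglongrightarrow> g q ^ c * ?z c q m"
        using zero_one_kernels_of_blocks[where n = n and m = "Suc m" and l = l, OF l Suc_leI[OF zero_less_Suc, folded One_nat_def] n]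
        by (elim exE conjE) simp
      note V1 = V[THEN spec, THEN conjunct1] and V2 = V[THEN spec, THEN conjunct2, THEN conjunct1]
        and V3 = V[THEN spec, THEN conjunct2, THEN conjunct2]
      have lim: "(\<lambda>i. hom_density (necklace c q) (V i)) \<longlonglongrightarrow> g q ^ c * ?z c q m"
        if "q \<in> {2..l}" "c \<in> {4, 8, 12}" for q c
        using lims that by blast
      have nz: "g q ^ 4 * ?z 4 q m \<noteq> 0" if "q \<in> {2..l}" for q using g[THEN spec, of q] pos[OF that, of 4 m] by simp
      have x: "(\<lambda>i. necklace_x q (V i)) \<longlonglongrightarrow> ?z 8 q m / (?z 4 q m)\<^sup>2" if q: "q \<in> {2..l}" for q
      proof -
        have "(\<lambda>i. necklace_x q (V i)) \<longlonglongrightarrow> (g q ^ 8 * ?z 8 q m) / (g q ^ 4 * ?z 4 q m)\<^sup>2"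
          unfolding necklace_x_def using nz[OF q] by (intro tendsto_intros lim q) auto
        also have "(g q ^ 8 * ?z 8 q m) / (g q ^ 4 * ?z 4 q m)\<^sup>2 = ?z 8 q m / (?z 4 q m)\<^sup>2"
          using g[THEN spec, of q] by (simp add: power_mult_distrib flip: power_mult)
        finally show ?thesis .
      qed
      have y: "(\<lambda>i. necklace_y q (V i)) \<longlonglongrightarrow> ?z 12 q m / ?z 4 q m ^ 3" if q: "q \<in> {2..l}" for q
      proof -
        have "(\<lambda>i. necklace_y q (V i)) \<longlonglongrightarrow> (g q ^ 12 * ?z 12 q m) / (g q ^ 4 * ?z 4 q m) ^ 3"
          unfolding necklace_y_def using nz[OF q] by (intro tendsto_intros lim q) auto
        also have "(g q ^ 12 * ?z 12 q m) / (g q ^ 4 * ?z 4 q m) ^ 3 = ?z 12 q m / ?z 4 q m ^ 3"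
          using g[THEN spec, of q] by (simp add: power_mult_distrib flip: power_mult)
        finally show ?thesis .
      qed
      have "\<forall>\<^sub>F i in sequentially. \<forall>q\<in>{2..l}. hom_density (necklace 4 q) (V i) \<noteq> 0"
        by (intro eventually_ball_finite ballI tendsto_imp_eventually_ne[OF lim nz]) auto
      then have "\<forall>\<^sub>F i in sequentially.
          coords_vec ix l (\<lambda>q. necklace_x q (V i)) (\<lambda>q. necklace_y q (V i)) \<in> D_region ix l \<W>"
      proof eventually_elim
        case (elim i)
        \<comment> \<open>Membership in \<open>\<W>\<close> is guaranteed only for kernels taking
          both values. The value 0 occurs at the origin; without the value 1 the density of
          \<open>necklace 4 2\<close> would vanish.\<close>
        have "V i ` ({0..1} \<times> {0..1}) = {0, 1}"
        proof (rule ccontr)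
          assume neq: "V i ` ({0..1} \<times> {0..1}) \<noteq> {0, 1}"
          have "0 \<in> V i ` ({0..1} \<times> {0..1})" using V3[of i] by (intro image_eqI[of _ _ "(0, 0)"]) auto
          then have one: "1 \<notin> V i ` ({0..1} \<times> {0..1})" using neq V2[of i] by blast
          have "V i (x, y) = 0" if xy: "x \<in> {0..1}" "y \<in> {0..1}" for x y
          proof -
            have im: "V i (x, y) \<in> V i ` ({0..1} \<times> {0..1})" by (rule imageI) (use xy in simp)
            then have "V i (x, y) \<noteq> 1" using one by auto
            then show ?thesis using subsetD[OF V2 im] by simp
          qed
          moreover have "snd (necklace 4 2) \<noteq> {}"
            by (auto simp: necklace_def qification_def cycle_graph_def intro: exI[of _ 0])
          ultimately have "hom_density (necklace 4 2) (V i) = 0"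
            by (intro hom_density_zero_kernel[OF V1] finite_simple_graph_necklace) auto
          then show False using elim l by auto
        qed
        then have "V i \<in> \<W>" using assms(4) V1[of i] by blast
        then have "coords_vec ix l (\<lambda>q. necklace_x q (V i)) (\<lambda>q. necklace_y q (V i)) \<in> ?D0"
          using elim coords_vec_nth[OF l ix] by (intro CollectI bexI[of _ "V i"]) auto
        then show ?case unfolding D_region_def by (rule closure_subset[THEN subsetD])
      qed
      then show ?thesis
        by (rule Lim_in_closed_set[OF closed _ sequentially_bot tendsto_coords_vec[OF l ix x y]])
    qed
    have "(\<lambda>m. coords_vec ix l (\<lambda>q. ?z 8 q m / (?z 4 q m)\<^sup>2) (\<lambda>q. ?z 12 q m / ?z 4 q m ^ 3))
        \<longlonglongrightarrow> coords_vec ix l (\<lambda>q. real (n q) / (real (n q))\<^sup>2) (\<lambda>q. real (n q) / real (n q) ^ 3)"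
    proof (rule tendsto_coords_vec[OF l ix])
      fix q assume q: "q \<in> {2..l}"
      have nq: "real (n q) \<noteq> 0" using n[of q] by simp
      show "(\<lambda>m. ?z 8 q m / (?z 4 q m)\<^sup>2) \<longlonglongrightarrow> real (n q) / (real (n q))\<^sup>2"
        using nq by (intro tendsto_intros tendsto_block_sum[OF q]) auto
      show "(\<lambda>m. ?z 12 q m / ?z 4 q m ^ 3) \<longlonglongrightarrow> real (n q) / real (n q) ^ 3"
        using nq by (intro tendsto_intros tendsto_block_sum[OF q]) auto
    qed
    then have "coords_vec ix l (\<lambda>q. real (n q) / (real (n q))\<^sup>2) (\<lambda>q. real (n q) / real (n q) ^ 3) \<in> D_region ix l \<W>"
      by (rule closed_sequentially[OF closed _, rotated]) (rule step)
    moreover have "real (n q) / (real (n q))\<^sup>2 = 1 / real (n q)" "real (n q) / real (n q) ^ 3 = 1 / (real (n q))\<^sup>2" for q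
      using n[of q] by (simp_all add: power2_eq_square power3_eq_cube)
    ultimately show ?thesis by simp
  qed
  \<comment> \<open>All vertices of the product lie in \<open>D_region\<close> itself, so its plain
    convex hull suffices, without a further closure.\<close>
  have "convex hull {p. \<forall>q\<in>{2..l}. (p $ ix (2 * q - 3), p $ ix (2 * q - 2)) \<in>
      insert (0, 0) {(1 / real n, 1 / (real n)\<^sup>2) | n. n \<ge> 1}} \<subseteq> convex hull (D_region ix l \<W>)"
  proof (rule hull_mono, rule subsetI)
    fix p :: "real ^ 'n"
    assume "p \<in> {p. \<forall>q\<in>{2..l}. (p $ ix (2 * q - 3), p $ ix (2 * q - 2)) \<in>
      insert (0, 0) {(1 / real n, 1 / (real n)\<^sup>2) | n. n \<ge> 1}}"
    with closed in_D show "p \<in> D_region ix l \<W>"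
      unfolding mem_Collect_eq[of p] by (rule generators_subset_closure[OF l ix])
  qed
  then show "R_power ix l \<subseteq> convex hull (D_region ix l \<W>)"
    using R_power_subset_convex_hull[OF l ix] by (rule order_trans[rotated])
qed

end
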